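(* Let $(M,J,[\nabla])$ be a c-projective manifold of real dimension $2n\ge4$ with solutions $\eta$ and $\tilde\eta$ of the metrisability equation corresponding to compatible (pseudo-)Kähler metrics $g$ and $\tilde g$ that are not homothetic. Let $\tilde\eta(t)=\tilde\eta-t\eta$, $t\in\mathbb R$, be the corresponding metrisability pencil. (1) The vector fields $\widetilde K(t)$, $t\in\mathbb R$, are Poisson-commuting holomorphic Killing fields with respect to $g$ and $\tilde g$. (2) The tensors $\widetilde H(t)$, $t\in\mathbb R$, are c-projective Hermitian symmetric Killing tensors, invariant with respect to $\widetilde K(s)$ for any $s\in\mathbb R$. In particular, they induce Hermitian symmetric Killing tensors of $g$ respectively $\tilde g$, by tensoring with $\tau_g^{-2}$ respectively $\tau_{\tilde g}^{-2}$.
   Context: $(M,J)$ is a complex manifold; $[\nabla]$ is a class of torsion-free connections with $\nabla J=0$, two being equivalent iff $\hat\nabla_XY=\nabla_XY+\frac12(\Upsilon(X)Y+\Upsilon(Y)X-\Upsilon(JX)JY-\Upsilon(JY)JX)$ for a real $1$-form $\Upsilon$. Unbarred/barred indices refer to $T^{1,0}M$/$T^{0,1}M$. A (pseudo-)Kähler metric is compatible if its Levi-Civita connection is in $[\nabla]$. $\mathcal E_{\mathbb R}(1,1)$ is the oriented $(n+1)$st root of $\Lambda^{2n}TM$, $\mathcal E(k,k)=\mathcal E_{\mathbb R}(1,1)^k\otimes\mathbb C$, $B(k,k)=B\otimes\mathcal E(k,k)$. The metrisability equation for a real section $\eta^{\bar bc}$ of $T^{0,1}M\otimes T^{1,0}M(-1,-1)$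 is $\nabla_a\eta^{\bar bc}+\delta_a{}^cX^{\bar b}=0$, $\nabla_{\bar a}\eta^{\bar bc}+\delta_{\bar a}{}^{\bar b}X^c=0$ for some $X^c$ with conjugate $X^{\bar c}$ (independent of $\nabla\in[\nabla]$). With $\varepsilon_{ab\cdots c}$ the tautological section of $\Lambda^{n,0}(n+1,0)$, set $\det\eta=\frac1{n!}\bar\varepsilon_{\bar a\bar c\cdots\bar e}\varepsilon_{bd\cdots f}\eta^{\bar ab}\cdots\eta^{\bar ef}\in\Gamma(\mathcal E_{\mathbb R}(1,1))$. A nondegenerate solution $\eta$ corresponds to the compatible metric $g$ with inverse $g^{\bar ab}=(\det\eta)\eta^{\bar ab}$, and $\tau_g=\det\eta$ trivialises $\mathcal E_{\mathbb R}(1,1)$. Define the endomorphism $A_a{}^b$ of $T^{1,0}M$ by $\tilde\eta^{\bar ac}=\eta^{\bar ab}A_b{}^c$, $A(t)=A-t\,\mathrm{Id}$, and let $\Omega_{\alpha\beta}=J_\alpha{}^\gamma g_{\gamma\beta}$, $\Omega^{\alpha\beta}=J_\gamma{}^\beta g^{\alpha\gamma}$. Then $$\widetilde K^\beta(t)=\Omega^{\alpha\beta}\nabla_\alpha\det A(t),\qquad \widetilde H_{b\bar a}(t)=\tfrac1{(n-1)!}\bar\varepsilon_{\bar a\bar c\cdots\bar e}\varepsilon_{bd\cdots f}\tilde\eta^{\bar cd}(t)\cdots\tilde\eta^{\bar ef}(t)\in\Gamma(\Lambda^{1,0}\otimes\Lambda^{0,1}(2,2)).$$ A holomorphic Killing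 field of $g$ is a vector field $X$ with $\mathcal L_XJ=0$, $\mathcal L_Xg=0$. Such fields $X,Y$ that are symplectic gradients ($X^\beta=\Omega^{\alpha\beta}\nabla_\alpha f$, $Y^\beta=\Omega^{\alpha\beta}\nabla_\alpha h$) Poisson-commute if $\Omega^{\alpha\beta}(\nabla_\alpha f)(\nabla_\beta h)=0$ (hence $[X,Y]=0$). A c-projective Hermitian symmetric Killing tensor (of valence $(0,2)$) is a real section $H_{b\bar a}$ of $\Lambda^{1,0}\otimes\Lambda^{0,1}(2,2)$ with $\nabla_{(a}H_{b)\bar e}=0$ and $\nabla_{(\bar a}H_{|b|\bar e)}=0$ for one (hence any) $\nabla\in[\nabla]$. A Hermitian symmetric Killing tensor of $g$ is a real section of $\Lambda^{1,0}\otimes\Lambda^{0,1}$ (i.e. a $J$-invariant symmetric $2$-tensor) satisfying the same equations for the Levi-Civita connection of $g$. *)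

theory Defs
  imports "HOL-Analysis.Analysis" "HOL-Combinatorics.Permutations"
begin

text \<open>
  Geometric objects are given by their components in the charts of a holomorphic atlas, subject to
  transformation laws. All components refer to the frame of the complexified tangent bundle
  induced by holomorphic coordinates \<open>z\<close>: the index \<open>Inl a\<close> (unbarred) stands for
  \<open>\<partial>/\<partial>z\<^sup>a\<close>, spanning \<open>T\<^sup>1\<^sup>,\<^sup>0M\<close>, and \<open>Inr a\<close> (barred) for its conjugate, spanning \<open>T\<^sup>0\<^sup>,\<^sup>1M\<close>.
  The index type \<open>'n\<close> has \<open>n\<close> elements, so \<open>'n idx\<close> is the range of an index of the
  (complexified) real tangent bundle, of rank \<open>2n\<close>.
\<close>

type_synonym 'n idx = "'n + 'n"

fun bar :: "'n idx \<Rightarrow> 'n idx" where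
  "bar (Inl a) = Inr a"
| "bar (Inr a) = Inl a"


section \<open>Smooth functions on open subsets of coordinate space\<close>

fun Ck_on :: "nat \<Rightarrow> 'a::real_normed_vector set \<Rightarrow> ('a \<Rightarrow> 'b::real_normed_vector) \<Rightarrow> bool" where
  "Ck_on 0 S f \<longleftrightarrow> continuous_on S f"
| "Ck_on (Suc k) S f \<longleftrightarrow> (\<forall>x\<in>S. f differentiable (at x)) \<and>
     (\<forall>v. Ck_on k S (\<lambda>x. frechet_derivative f (at x) v))"

definition smooth_on :: "'a::real_normed_vector set \<Rightarrow> ('a \<Rightarrow> 'b::real_normed_vector) \<Rightarrow> bool" where
  "smooth_on S f \<longleftrightarrow> (\<forall>k. Ck_on k S f)"

text \<open>The derivations \<open>\<partial>/\<partial>z\<^sup>a\<close> and their conjugates (Wirtinger derivatives).\<close>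

fun pd :: "'n::finite idx \<Rightarrow> (complex^'n \<Rightarrow> complex) \<Rightarrow> complex^'n \<Rightarrow> complex" where
  "pd (Inl a) f x = (frechet_derivative f (at x) (axis a 1)
                      - \<i> * frechet_derivative f (at x) (axis a \<i>)) / 2"
| "pd (Inr a) f x = (frechet_derivative f (at x) (axis a 1)
                      + \<i> * frechet_derivative f (at x) (axis a \<i>)) / 2"

definition holomorphic_map_on :: "(complex^'n::finite) set \<Rightarrow> (complex^'n \<Rightarrow> complex^'n) \<Rightarrow> bool" where
  "holomorphic_map_on S f \<longleftrightarrow> smooth_on S f \<and>
     (\<forall>x\<in>S. \<forall>v. frechet_derivative f (at x) (\<i> *s v) = \<i> *s frechet_derivative f (at x) v)"


section \<open>Complex manifolds\<close>

type_synonym ('m, 'n) chart = "'m set \<times> ('m \<Rightarrow> complex^'n)"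

definition coords :: "('m, 'n::finite) chart \<Rightarrow> (complex^'n) set" where
  "coords c = snd c ` fst c"

definition overlap :: "('m, 'n::finite) chart \<Rightarrow> ('m, 'n) chart \<Rightarrow> (complex^'n) set" where
  "overlap c d = snd c ` (fst c \<inter> fst d)"

definition trans_map :: "('m, 'n::finite) chart \<Rightarrow> ('m, 'n) chart \<Rightarrow> complex^'n \<Rightarrow> complex^'n" where
  "trans_map c d x = snd d (inv_into (fst c) (snd c) x)"

definition complex_manifold :: "'m topology \<Rightarrow> ('m, 'n::finite) chart set \<Rightarrow> bool" where
  "complex_manifold M \<A> \<longleftrightarrow>
     Hausdorff_space M \<and> second_countable M \<and> topspace M = (\<Union>c\<in>\<A>. fst c) \<and>
     (\<forall>c\<in>\<A>. openin M (fst c) \<and> open (coords c) \<and>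
        homeomorphic_map (subtopology M (fst c)) (top_of_set (coords c)) (snd c)) \<and>
     (\<forall>c\<in>\<A>. \<forall>d\<in>\<A>. holomorphic_map_on (overlap c d) (trans_map c d))"

text \<open>The complex structure \<open>J\<^sub>\<alpha>\<^sup>\<beta>\<close>, where \<open>(JX)\<^sup>\<beta> = X\<^sup>\<alpha> J\<^sub>\<alpha>\<^sup>\<beta>\<close>, is constant in holomorphic coordinates.\<close>

definition J :: "'n::finite idx \<Rightarrow> 'n idx \<Rightarrow> complex" where
  "J \<alpha> \<beta> = (if \<alpha> = \<beta> then (case \<alpha> of Inl _ \<Rightarrow> \<i> | Inr _ \<Rightarrow> - \<i>) else 0)"


section \<open>Tensor fields and densities\<close>

fun ccomp :: "'n::finite idx \<Rightarrow> complex^'n \<Rightarrow> complex" where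
  "ccomp (Inl a) v = v $ a"
| "ccomp (Inr a) v = cnj (v $ a)"

text \<open>\<open>jac c d x \<kappa> \<alpha>\<close> is the derivative of the \<open>\<kappa>\<close>-th coordinate of \<open>d\<close> along the \<open>\<alpha>\<close>-th frame field of \<open>c\<close>.\<close>

definition jac :: "('m, 'n::finite) chart \<Rightarrow> ('m, 'n) chart \<Rightarrow> complex^'n \<Rightarrow> 'n idx \<Rightarrow> 'n idx \<Rightarrow> complex" where
  "jac c d x \<kappa> \<alpha> = pd \<alpha> (\<lambda>y. ccomp \<kappa> (trans_map c d y)) x"

text \<open>
  Transition functions of \<open>\<E>\<^sub>R(1,1)\<^sup>k\<close>, with \<open>\<E>\<^sub>R(1,1)\<close> the oriented \<open>(n+1)\<close>-st root of
  \<open>\<Lambda>\<^sup>2\<^sup>nTM\<close>. The latter transforms by the determinant of the real Jacobian, which for a holomorphic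
  coordinate change is the squared modulus of the complex one, hence positive. In each chart
  \<open>\<E>\<^sub>R(1,1)\<close> is trivialised by the positive \<open>(n+1)\<close>-st root of the coordinate volume vector.
\<close>

definition density_factor :: "int \<Rightarrow> ('m, 'n::finite) chart \<Rightarrow> ('m, 'n) chart \<Rightarrow> complex^'n \<Rightarrow> complex" where
  "density_factor k c d x =
     of_real (((cmod (det (\<chi> a b. jac c d x (Inl a) (Inl b) :: complex^'n^'n)))\<^sup>2)
                powr (of_int k / (of_nat CARD('n) + 1)))"

type_synonym ('m, 'n) scalar_field = "('m, 'n) chart \<Rightarrow> complex^'n \<Rightarrow> complex"
type_synonym ('m, 'n) vec_field = "('m, 'n) chart \<Rightarrow> complex^'n \<Rightarrow> 'n idx \<Rightarrow> complex"
type_synonym ('m, 'n) tensor2_field = "('m, 'n) chart \<Rightarrow> complex^'n \<Rightarrow> 'n idx \<Rightarrow> 'n idx \<Rightarrow> complex"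
type_synonym ('m, 'n) herm_field = "('m, 'n) chart \<Rightarrow> complex^'n \<Rightarrow> complex^'n^'n"

definition real_function :: "('m, 'n::finite) chart set \<Rightarrow> ('m, 'n) scalar_field \<Rightarrow> bool" where
  "real_function \<A> f \<longleftrightarrow>
     (\<forall>c\<in>\<A>. smooth_on (coords c) (f c) \<and> (\<forall>x\<in>coords c. f c x \<in> \<real>)) \<and>
     (\<forall>c\<in>\<A>. \<forall>d\<in>\<A>. \<forall>x\<in>overlap c d. f d (trans_map c d x) = f c x)"

text \<open>Real sections of \<open>TM \<otimes> \<E>\<^sub>R(1,1)\<^sup>k\<close>.\<close>

definition real_vector_field :: "int \<Rightarrow> ('m, 'n::finite) chart set \<Rightarrow> ('m, 'n) vec_field \<Rightarrow> bool" where
  "real_vector_field k \<A> X \<longleftrightarrow>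
     (\<forall>c\<in>\<A>. \<forall>\<alpha>. smooth_on (coords c) (\<lambda>x. X c x \<alpha>)) \<and>
     (\<forall>c\<in>\<A>. \<forall>x\<in>coords c. \<forall>\<alpha>. cnj (X c x \<alpha>) = X c x (bar \<alpha>)) \<and>
     (\<forall>c\<in>\<A>. \<forall>d\<in>\<A>. \<forall>x\<in>overlap c d. \<forall>\<kappa>.
        X d (trans_map c d x) \<kappa> = density_factor k c d x * (\<Sum>\<alpha>\<in>UNIV. jac c d x \<kappa> \<alpha> * X c x \<alpha>))"

definition real_one_form :: "('m, 'n::finite) chart set \<Rightarrow> ('m, 'n) vec_field \<Rightarrow> bool" where
  "real_one_form \<A> \<Upsilon> \<longleftrightarrow>
     (\<forall>c\<in>\<A>. \<forall>\<alpha>. smooth_on (coords c) (\<lambda>x. \<Upsilon> c x \<alpha>)) \<and>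
     (\<forall>c\<in>\<A>. \<forall>x\<in>coords c. \<forall>\<alpha>. cnj (\<Upsilon> c x \<alpha>) = \<Upsilon> c x (bar \<alpha>)) \<and>
     (\<forall>c\<in>\<A>. \<forall>d\<in>\<A>. \<forall>x\<in>overlap c d. \<forall>\<alpha>.
        \<Upsilon> c x \<alpha> = (\<Sum>\<kappa>\<in>UNIV. jac c d x \<kappa> \<alpha> * \<Upsilon> d (trans_map c d x) \<kappa>))"

definition real_covariant2 :: "('m, 'n::finite) chart set \<Rightarrow> ('m, 'n) tensor2_field \<Rightarrow> bool" where
  "real_covariant2 \<A> g \<longleftrightarrow>
     (\<forall>c\<in>\<A>. \<forall>\<alpha> \<beta>. smooth_on (coords c) (\<lambda>x. g c x \<alpha> \<beta>)) \<and>
     (\<forall>c\<in>\<A>. \<forall>x\<in>coords c. \<forall>\<alpha> \<beta>. cnj (g c x \<alpha> \<beta>) = g c x (bar \<alpha>) (bar \<beta>)) \<and>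
     (\<forall>c\<in>\<A>. \<forall>d\<in>\<A>. \<forall>x\<in>overlap c d. \<forall>\<alpha> \<beta>.
        g c x \<alpha> \<beta> =
          (\<Sum>\<kappa>\<in>UNIV. \<Sum>\<mu>\<in>UNIV. jac c d x \<kappa> \<alpha> * jac c d x \<mu> \<beta> * g d (trans_map c d x) \<kappa> \<mu>))"

text \<open>
  Real sections \<open>\<eta>\<close> of \<open>T\<^sup>0\<^sup>,\<^sup>1M \<otimes> T\<^sup>1\<^sup>,\<^sup>0M(k,k)\<close>; the first matrix index is the barred one.
\<close>

definition real_herm_contra :: "int \<Rightarrow> ('m, 'n::finite) chart set \<Rightarrow> ('m, 'n) herm_field \<Rightarrow> bool" where
  "real_herm_contra k \<A> \<eta> \<longleftrightarrow>
     (\<forall>c\<in>\<A>. smooth_on (coords c) (\<eta> c)) \<and>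
     (\<forall>c\<in>\<A>. \<forall>x\<in>coords c. \<forall>a b. cnj (\<eta> c x $ a $ b) = \<eta> c x $ b $ a) \<and>
     (\<forall>c\<in>\<A>. \<forall>d\<in>\<A>. \<forall>x\<in>overlap c d. \<forall>p q.
        \<eta> d (trans_map c d x) $ p $ q = density_factor k c d x *
          (\<Sum>a\<in>UNIV. \<Sum>b\<in>UNIV. jac c d x (Inr p) (Inr a) * jac c d x (Inl q) (Inl b) * \<eta> c x $ a $ b))"

text \<open>
  Real sections \<open>H\<close> of \<open>\<Lambda>\<^sup>1\<^sup>,\<^sup>0 \<otimes> \<Lambda>\<^sup>0\<^sup>,\<^sup>1(k,k)\<close>; the first matrix index is the unbarred one.
\<close>

definition real_herm_co :: "int \<Rightarrow> ('m, 'n::finite) chart set \<Rightarrow> ('m, 'n) herm_field \<Rightarrow> bool" where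
  "real_herm_co k \<A> H \<longleftrightarrow>
     (\<forall>c\<in>\<A>. smooth_on (coords c) (H c)) \<and>
     (\<forall>c\<in>\<A>. \<forall>x\<in>coords c. \<forall>b a. cnj (H c x $ b $ a) = H c x $ a $ b) \<and>
     (\<forall>c\<in>\<A>. \<forall>d\<in>\<A>. \<forall>x\<in>overlap c d. \<forall>b a.
        density_factor k c d x * H c x $ b $ a =
          (\<Sum>q\<in>UNIV. \<Sum>p\<in>UNIV. jac c d x (Inl q) (Inl b) * jac c d x (Inr p) (Inr a)
             * H d (trans_map c d x) $ q $ p))"


section \<open>Connections and c-projective structures\<close>

text \<open>\<open>\<Gamma> c x \<alpha> \<beta> \<gamma>\<close> is \<open>\<Gamma>\<^sub>\<alpha>\<^sub>\<beta>\<^sup>\<gamma>\<close>, i.e. \<open>\<nabla>\<^sub>\<alpha> \<partial>\<^sub>\<beta> = \<Gamma>\<^sub>\<alpha>\<^sub>\<beta>\<^sup>\<gamma> \<partial>\<^sub>\<gamma>\<close>.\<close>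

type_synonym 'n christoffel = "complex^'n \<Rightarrow> 'n idx \<Rightarrow> 'n idx \<Rightarrow> 'n idx \<Rightarrow> complex"
type_synonym ('m, 'n) conn = "('m, 'n) chart \<Rightarrow> 'n christoffel"

text \<open>
  The transformation law is the classical one, solved for the second derivatives of the
  coordinate change: \<open>\<nabla>(dy\<^sup>\<kappa>)\<close> is computed in both charts.
\<close>

definition affine_connection :: "('m, 'n::finite) chart set \<Rightarrow> ('m, 'n) conn \<Rightarrow> bool" where
  "affine_connection \<A> \<Gamma> \<longleftrightarrow>
     (\<forall>c\<in>\<A>. \<forall>\<alpha> \<beta> \<gamma>. smooth_on (coords c) (\<lambda>x. \<Gamma> c x \<alpha> \<beta> \<gamma>)) \<and>
     (\<forall>c\<in>\<A>. \<forall>x\<in>coords c. \<forall>\<alpha> \<beta> \<gamma>. cnj (\<Gamma> c x \<alpha> \<beta> \<gamma>) = \<Gamma> c x (bar \<alpha>) (bar \<beta>) (bar \<gamma>)) \<and>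
     (\<forall>c\<in>\<A>. \<forall>d\<in>\<A>. \<forall>x\<in>overlap c d. \<forall>\<alpha> \<beta> \<kappa>.
        (\<Sum>\<gamma>\<in>UNIV. jac c d x \<kappa> \<gamma> * \<Gamma> c x \<alpha> \<beta> \<gamma>) =
          pd \<alpha> (\<lambda>y. jac c d y \<kappa> \<beta>) x +
          (\<Sum>\<mu>\<in>UNIV. \<Sum>\<nu>\<in>UNIV. \<Gamma> d (trans_map c d x) \<mu> \<nu> \<kappa> * jac c d x \<mu> \<alpha> * jac c d x \<nu> \<beta>))"

definition torsion_free :: "('m, 'n::finite) chart set \<Rightarrow> ('m, 'n) conn \<Rightarrow> bool" where
  "torsion_free \<A> \<Gamma> \<longleftrightarrow> (\<forall>c\<in>\<A>. \<forall>x\<in>coords c. \<forall>\<alpha> \<beta> \<gamma>. \<Gamma> c x \<alpha> \<beta> \<gamma> = \<Gamma> c x \<beta> \<alpha> \<gamma>)"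

definition preserves_J :: "('m, 'n::finite) chart set \<Rightarrow> ('m, 'n) conn \<Rightarrow> bool" where
  "preserves_J \<A> \<Gamma> \<longleftrightarrow> (\<forall>c\<in>\<A>. \<forall>x\<in>coords c. \<forall>\<alpha> \<beta> \<gamma>.
     pd \<alpha> (\<lambda>_. J \<beta> \<gamma>) x + (\<Sum>\<delta>\<in>UNIV. \<Gamma> c x \<alpha> \<delta> \<gamma> * J \<beta> \<delta>) - (\<Sum>\<delta>\<in>UNIV. \<Gamma> c x \<alpha> \<beta> \<delta> * J \<delta> \<gamma>) = 0)"

definition complex_connection :: "('m, 'n::finite) chart set \<Rightarrow> ('m, 'n) conn \<Rightarrow> bool" where
  "complex_connection \<A> \<Gamma> \<longleftrightarrow> affine_connection \<A> \<Gamma> \<and> torsion_free \<A> \<Gamma> \<and> preserves_J \<A> \<Gamma>"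

definition kron :: "'a \<Rightarrow> 'a \<Rightarrow> complex" where
  "kron \<alpha> \<beta> = (if \<alpha> = \<beta> then 1 else 0)"

definition cproj_equivalent :: "('m, 'n::finite) chart set \<Rightarrow> ('m, 'n) conn \<Rightarrow> ('m, 'n) conn \<Rightarrow> bool" where
  "cproj_equivalent \<A> \<Gamma> \<Gamma>' \<longleftrightarrow> (\<exists>\<Upsilon>. real_one_form \<A> \<Upsilon> \<and>
     (\<forall>c\<in>\<A>. \<forall>x\<in>coords c. \<forall>\<alpha> \<beta> \<gamma>. \<Gamma>' c x \<alpha> \<beta> \<gamma> = \<Gamma> c x \<alpha> \<beta> \<gamma> + 1/2 *
        (\<Upsilon> c x \<alpha> * kron \<beta> \<gamma> + \<Upsilon> c x \<beta> * kron \<alpha> \<gamma>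
         - (\<Sum>\<delta>\<in>UNIV. J \<alpha> \<delta> * \<Upsilon> c x \<delta>) * J \<beta> \<gamma> - (\<Sum>\<delta>\<in>UNIV. J \<beta> \<delta> * \<Upsilon> c x \<delta>) * J \<alpha> \<gamma>)))"

definition cprojective_manifold ::
    "'m topology \<Rightarrow> ('m, 'n::finite) chart set \<Rightarrow> ('m, 'n) conn set \<Rightarrow> bool" where
  "cprojective_manifold M \<A> \<C> \<longleftrightarrow> complex_manifold M \<A> \<and>
     (\<exists>\<Gamma>. complex_connection \<A> \<Gamma> \<and> \<C> = {\<Gamma>'. complex_connection \<A> \<Gamma>' \<and> cproj_equivalent \<A> \<Gamma> \<Gamma>'})"

text \<open>
  Covariant derivatives of \<open>\<eta>\<close> and \<open>H\<close> in the bundles \<open>T\<^sup>0\<^sup>,\<^sup>1M \<otimes> T\<^sup>1\<^sup>,\<^sup>0M(k,k)\<close> and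
  \<open>\<Lambda>\<^sup>1\<^sup>,\<^sup>0 \<otimes> \<Lambda>\<^sup>0\<^sup>,\<^sup>1(k,k)\<close>, for connections with \<open>\<nabla>J = 0\<close>, so that barred and unbarred indices do
  not mix. On \<open>\<E>\<^sub>R(1,1)\<^sup>k\<close> the induced connection form is \<open>k/(n+1)\<close> times that on \<open>\<Lambda>\<^sup>2\<^sup>nTM\<close>.
\<close>

definition conn_trace :: "'n::finite christoffel \<Rightarrow> complex^'n \<Rightarrow> 'n idx \<Rightarrow> complex" where
  "conn_trace \<Gamma> x \<alpha> = (\<Sum>\<delta>\<in>UNIV. \<Gamma> x \<alpha> \<delta> \<delta>)"

definition cov_herm_contra ::
    "int \<Rightarrow> 'n::finite christoffel \<Rightarrow> (complex^'n \<Rightarrow> complex^'n^'n) \<Rightarrow> complex^'n \<Rightarrow> 'n idx \<Rightarrow> 'n \<Rightarrow> 'n \<Rightarrow> complex" where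
  "cov_herm_contra k \<Gamma> \<eta> x \<alpha> b c =
     pd \<alpha> (\<lambda>y. \<eta> y $ b $ c) x
     + (\<Sum>d\<in>UNIV. \<Gamma> x \<alpha> (Inr d) (Inr b) * \<eta> x $ d $ c)
     + (\<Sum>d\<in>UNIV. \<Gamma> x \<alpha> (Inl d) (Inl c) * \<eta> x $ b $ d)
     + of_int k / (of_nat CARD('n) + 1) * conn_trace \<Gamma> x \<alpha> * \<eta> x $ b $ c"

definition cov_herm_co ::
    "int \<Rightarrow> 'n::finite christoffel \<Rightarrow> (complex^'n \<Rightarrow> complex^'n^'n) \<Rightarrow> complex^'n \<Rightarrow> 'n idx \<Rightarrow> 'n \<Rightarrow> 'n \<Rightarrow> complex" where
  "cov_herm_co k \<Gamma> H x \<alpha> b e =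
     pd \<alpha> (\<lambda>y. H y $ b $ e) x
     - (\<Sum>d\<in>UNIV. \<Gamma> x \<alpha> (Inl b) (Inl d) * H x $ d $ e)
     - (\<Sum>d\<in>UNIV. \<Gamma> x \<alpha> (Inr e) (Inr d) * H x $ b $ d)
     + of_int k / (of_nat CARD('n) + 1) * conn_trace \<Gamma> x \<alpha> * H x $ b $ e"


section \<open>The metrisability equation\<close>

definition metrisability_eq :: "('m, 'n::finite) chart set \<Rightarrow> ('m, 'n) conn \<Rightarrow> ('m, 'n) herm_field \<Rightarrow> bool" where
  "metrisability_eq \<A> \<Gamma> \<eta> \<longleftrightarrow> (\<exists>X. real_vector_field (-1) \<A> X \<and>
     (\<forall>c\<in>\<A>. \<forall>x\<in>coords c. \<forall>a b d.
        cov_herm_contra (-1) (\<Gamma> c) (\<eta> c) x (Inl a) b d + kron a d * X c x (Inr b) = 0 \<and>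
        cov_herm_contra (-1) (\<Gamma> c) (\<eta> c) x (Inr a) b d + kron a b * X c x (Inl d) = 0))"

definition metrisability_solution ::
    "('m, 'n::finite) chart set \<Rightarrow> ('m, 'n) conn set \<Rightarrow> ('m, 'n) herm_field \<Rightarrow> bool" where
  "metrisability_solution \<A> \<C> \<eta> \<longleftrightarrow> real_herm_contra (-1) \<A> \<eta> \<and> (\<exists>\<Gamma>\<in>\<C>. metrisability_eq \<A> \<Gamma> \<eta>)"

text \<open>
  Components of the tautological section \<open>\<epsilon>\<close> of \<open>\<Lambda>\<^sup>n\<^sup>,\<^sup>0(n+1,0)\<close> in the coordinate trivialisation.
  The slots of \<open>\<epsilon>\<close> are indexed by \<open>'n\<close> itself. Enumerating them differently changes
  \<open>\<epsilon>\<close> at most by a sign, which cancels since only products of \<open>\<epsilon>\<close> with its conjugate occur.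
\<close>

definition eps :: "('n::finite \<Rightarrow> 'n) \<Rightarrow> complex" where
  "eps \<sigma> = (if \<sigma> permutes UNIV then of_int (sign \<sigma>) else 0)"

definition det_contra :: "complex^'n^'n \<Rightarrow> complex" where
  "det_contra (\<eta> :: complex^'n::finite^'n) = 1 / fact CARD('n) *
     (\<Sum>\<sigma>\<in>UNIV. \<Sum>\<rho>\<in>UNIV. cnj (eps \<sigma>) * eps \<rho> * (\<Prod>i\<in>UNIV. \<eta> $ \<sigma> i $ \<rho> i))"

text \<open>\<open>first_slot\<close> is the slot of \<open>\<epsilon>\<close> left free in the definition of \<open>H\<close>; any slot gives the same result.\<close>

definition first_slot :: "'n::finite" where
  "first_slot = (SOME i. True)"

definition H_tensor :: "complex^'n^'n \<Rightarrow> complex^'n^'n" where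
  "H_tensor (\<eta> :: complex^'n::finite^'n) = (\<chi> b a. 1 / fact (CARD('n) - 1) *
     (\<Sum>\<sigma> | \<sigma> first_slot = a. \<Sum>\<rho> | \<rho> first_slot = b.
        cnj (eps \<sigma>) * eps \<rho> * (\<Prod>i\<in>UNIV - {first_slot}. \<eta> $ \<sigma> i $ \<rho> i)))"

definition tau :: "('m, 'n::finite) herm_field \<Rightarrow> ('m, 'n) scalar_field" where
  "tau \<eta> c x = det_contra (\<eta> c x)"

definition pencil :: "('m, 'n::finite) herm_field \<Rightarrow> ('m, 'n) herm_field \<Rightarrow> real \<Rightarrow> ('m, 'n) herm_field" where
  "pencil \<eta> \<eta>' t c x = \<eta>' c x - t *\<^sub>R \<eta> c x"

definition Ht :: "('m, 'n::finite) herm_field \<Rightarrow> ('m, 'n) herm_field \<Rightarrow> real \<Rightarrow> ('m, 'n) herm_field" where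
  "Ht \<eta> \<eta>' t c x = H_tensor (pencil \<eta> \<eta>' t c x)"


section \<open>Pseudo-Kaehler metrics\<close>

definition hermitian_metric :: "('m, 'n::finite) chart set \<Rightarrow> ('m, 'n) tensor2_field \<Rightarrow> bool" where
  "hermitian_metric \<A> g \<longleftrightarrow> real_covariant2 \<A> g \<and>
     (\<forall>c\<in>\<A>. \<forall>x\<in>coords c.
        (\<forall>\<alpha> \<beta>. g c x \<alpha> \<beta> = g c x \<beta> \<alpha>) \<and>
        (\<forall>\<alpha> \<beta>. (\<Sum>\<gamma>\<in>UNIV. \<Sum>\<delta>\<in>UNIV. J \<alpha> \<gamma> * J \<beta> \<delta> * g c x \<gamma> \<delta>) = g c x \<alpha> \<beta>) \<and>
        invertible (\<chi> \<alpha> \<beta>. g c x \<alpha> \<beta> :: complex^('n idx)^('n idx)))"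

definition levi_civita :: "('m, 'n::finite) chart set \<Rightarrow> ('m, 'n) conn \<Rightarrow> ('m, 'n) tensor2_field \<Rightarrow> bool" where
  "levi_civita \<A> \<Gamma> g \<longleftrightarrow> affine_connection \<A> \<Gamma> \<and> torsion_free \<A> \<Gamma> \<and>
     (\<forall>c\<in>\<A>. \<forall>x\<in>coords c. \<forall>\<alpha> \<beta> \<gamma>.
        pd \<alpha> (\<lambda>y. g c y \<beta> \<gamma>) x - (\<Sum>\<delta>\<in>UNIV. \<Gamma> c x \<alpha> \<beta> \<delta> * g c x \<delta> \<gamma>)
          - (\<Sum>\<delta>\<in>UNIV. \<Gamma> c x \<alpha> \<gamma> \<delta> * g c x \<beta> \<delta>) = 0)"

definition pseudo_kaehler :: "('m, 'n::finite) chart set \<Rightarrow> ('m, 'n) tensor2_field \<Rightarrow> bool" where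
  "pseudo_kaehler \<A> g \<longleftrightarrow> hermitian_metric \<A> g \<and> (\<exists>\<Gamma>. levi_civita \<A> \<Gamma> g \<and> preserves_J \<A> \<Gamma>)"

definition compatible_metric ::
    "('m, 'n::finite) chart set \<Rightarrow> ('m, 'n) conn set \<Rightarrow> ('m, 'n) tensor2_field \<Rightarrow> bool" where
  "compatible_metric \<A> \<C> g \<longleftrightarrow> pseudo_kaehler \<A> g \<and> (\<exists>\<Gamma>\<in>\<C>. levi_civita \<A> \<Gamma> g)"

definition inv_metric :: "('m, 'n::finite) tensor2_field \<Rightarrow> ('m, 'n) tensor2_field" where
  "inv_metric g c x \<alpha> \<beta> = matrix_inv (\<chi> \<alpha> \<beta>. g c x \<alpha> \<beta> :: complex^('n idx)^('n idx)) $ \<alpha> $ \<beta>"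

definition Omega_up :: "('m, 'n::finite) tensor2_field \<Rightarrow> ('m, 'n) tensor2_field" where
  "Omega_up g c x \<alpha> \<beta> = (\<Sum>\<gamma>\<in>UNIV. J \<gamma> \<beta> * inv_metric g c x \<alpha> \<gamma>)"

definition corresponds_to_metric ::
    "('m, 'n::finite) chart set \<Rightarrow> ('m, 'n) herm_field \<Rightarrow> ('m, 'n) tensor2_field \<Rightarrow> bool" where
  "corresponds_to_metric \<A> \<eta> g \<longleftrightarrow> (\<forall>c\<in>\<A>. \<forall>x\<in>coords c. det_contra (\<eta> c x) \<noteq> 0 \<and>
     (\<forall>a b. inv_metric g c x (Inr a) (Inl b) = det_contra (\<eta> c x) * \<eta> c x $ a $ b))"

definition homothetic ::
    "('m, 'n::finite) chart set \<Rightarrow> ('m, 'n) tensor2_field \<Rightarrow> ('m, 'n) tensor2_field \<Rightarrow> bool" where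
  "homothetic \<A> g g' \<longleftrightarrow>
     (\<exists>r::real. \<forall>c\<in>\<A>. \<forall>x\<in>coords c. \<forall>\<alpha> \<beta>. g' c x \<alpha> \<beta> = of_real r * g c x \<alpha> \<beta>)"

text \<open>\<open>A\<^sub>a\<^sup>b\<close> is stored with the lower index first, so \<open>\<eta>'\<^sup>a\<^sup>c = \<eta>\<^sup>a\<^sup>b A\<^sub>b\<^sup>c\<close> (first indices barred) is a matrix product.\<close>

definition A_endo :: "('m, 'n::finite) herm_field \<Rightarrow> ('m, 'n) herm_field \<Rightarrow> ('m, 'n) herm_field" where
  "A_endo \<eta> \<eta>' c x = (THE A. \<eta>' c x = \<eta> c x ** A)"

definition det_At :: "('m, 'n::finite) herm_field \<Rightarrow> ('m, 'n) herm_field \<Rightarrow> real \<Rightarrow> ('m, 'n) scalar_field" where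
  "det_At \<eta> \<eta>' t c x = det (A_endo \<eta> \<eta>' c x - mat (of_real t))"

definition symp_grad :: "('m, 'n::finite) tensor2_field \<Rightarrow> ('m, 'n) scalar_field \<Rightarrow> ('m, 'n) vec_field" where
  "symp_grad g f c x \<beta> = (\<Sum>\<alpha>\<in>UNIV. Omega_up g c x \<alpha> \<beta> * pd \<alpha> (f c) x)"

definition poisson_bracket ::
    "('m, 'n::finite) tensor2_field \<Rightarrow> ('m, 'n) scalar_field \<Rightarrow> ('m, 'n) scalar_field \<Rightarrow> ('m, 'n) scalar_field" where
  "poisson_bracket g f h c x =
     (\<Sum>\<alpha>\<in>UNIV. \<Sum>\<beta>\<in>UNIV. Omega_up g c x \<alpha> \<beta> * pd \<alpha> (f c) x * pd \<beta> (h c) x)"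

definition poisson_commute ::
    "('m, 'n::finite) chart set \<Rightarrow> ('m, 'n) tensor2_field \<Rightarrow> ('m, 'n) vec_field \<Rightarrow> ('m, 'n) vec_field \<Rightarrow> bool" where
  "poisson_commute \<A> g X Y \<longleftrightarrow> (\<exists>f h. real_function \<A> f \<and> real_function \<A> h \<and>
     (\<forall>c\<in>\<A>. \<forall>x\<in>coords c.
        (\<forall>\<beta>. X c x \<beta> = symp_grad g f c x \<beta>) \<and> (\<forall>\<beta>. Y c x \<beta> = symp_grad g h c x \<beta>) \<and>
        poisson_bracket g f h c x = 0))"

definition Kt ::
    "('m, 'n::finite) tensor2_field \<Rightarrow> ('m, 'n) herm_field \<Rightarrow> ('m, 'n) herm_field \<Rightarrow> real \<Rightarrow> ('m, 'n) vec_field" where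
  "Kt g \<eta> \<eta>' t = symp_grad g (det_At \<eta> \<eta>' t)"


section \<open>Killing fields and Killing tensors\<close>

definition holomorphic_killing_field ::
    "('m, 'n::finite) chart set \<Rightarrow> ('m, 'n) tensor2_field \<Rightarrow> ('m, 'n) vec_field \<Rightarrow> bool" where
  "holomorphic_killing_field \<A> g X \<longleftrightarrow> real_vector_field 0 \<A> X \<and>
     (\<forall>c\<in>\<A>. \<forall>x\<in>coords c. \<forall>\<alpha> \<beta>.
        (\<Sum>\<gamma>\<in>UNIV. X c x \<gamma> * pd \<gamma> (\<lambda>_. J \<alpha> \<beta>) x + J \<gamma> \<beta> * pd \<alpha> (\<lambda>y. X c y \<gamma>) x
             - J \<alpha> \<gamma> * pd \<gamma> (\<lambda>y. X c y \<beta>) x) = 0 \<and>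
        (\<Sum>\<gamma>\<in>UNIV. X c x \<gamma> * pd \<gamma> (\<lambda>y. g c y \<alpha> \<beta>) x + g c x \<gamma> \<beta> * pd \<alpha> (\<lambda>y. X c y \<gamma>) x
             + g c x \<alpha> \<gamma> * pd \<beta> (\<lambda>y. X c y \<gamma>) x) = 0)"

definition killing_eq :: "int \<Rightarrow> ('m, 'n::finite) chart set \<Rightarrow> ('m, 'n) conn \<Rightarrow> ('m, 'n) herm_field \<Rightarrow> bool" where
  "killing_eq k \<A> \<Gamma> H \<longleftrightarrow> (\<forall>c\<in>\<A>. \<forall>x\<in>coords c. \<forall>a b e.
     cov_herm_co k (\<Gamma> c) (H c) x (Inl a) b e + cov_herm_co k (\<Gamma> c) (H c) x (Inl b) a e = 0 \<and>
     cov_herm_co k (\<Gamma> c) (H c) x (Inr a) b e + cov_herm_co k (\<Gamma> c) (H c) x (Inr e) b a = 0)"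

definition cproj_killing_tensor ::
    "('m, 'n::finite) chart set \<Rightarrow> ('m, 'n) conn set \<Rightarrow> ('m, 'n) herm_field \<Rightarrow> bool" where
  "cproj_killing_tensor \<A> \<C> H \<longleftrightarrow> real_herm_co 2 \<A> H \<and> (\<forall>\<Gamma>\<in>\<C>. killing_eq 2 \<A> \<Gamma> H)"

definition metric_killing_tensor ::
    "('m, 'n::finite) chart set \<Rightarrow> ('m, 'n) tensor2_field \<Rightarrow> ('m, 'n) herm_field \<Rightarrow> bool" where
  "metric_killing_tensor \<A> g H \<longleftrightarrow> real_herm_co 0 \<A> H \<and> (\<exists>\<Gamma>. levi_civita \<A> \<Gamma> g \<and> killing_eq 0 \<A> \<Gamma> H)"

text \<open>
  \<open>\<L>\<^sub>XH = 0\<close> for a section \<open>H\<close> of \<open>\<Lambda>\<^sup>1\<^sup>,\<^sup>0 \<otimes> \<Lambda>\<^sup>0\<^sup>,\<^sup>1(k,k)\<close> and a vector field \<open>X\<close> with \<open>\<L>\<^sub>XJ = 0\<close>; the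
  latter makes the remaining components of the Lie derivative vanish. On \<open>\<Lambda>\<^sup>2\<^sup>nTM\<close> the Lie
  derivative of the coordinate volume vector is minus the coordinate divergence of \<open>X\<close>.
\<close>

definition lie_invariant ::
    "int \<Rightarrow> ('m, 'n::finite) chart set \<Rightarrow> ('m, 'n) vec_field \<Rightarrow> ('m, 'n) herm_field \<Rightarrow> bool" where
  "lie_invariant k \<A> X (H :: ('m, 'n) herm_field) \<longleftrightarrow> (\<forall>c\<in>\<A>. \<forall>x\<in>coords c. \<forall>b a.
     (\<Sum>\<gamma>\<in>UNIV. X c x \<gamma> * pd \<gamma> (\<lambda>y. H c y $ b $ a) x)
     + (\<Sum>d\<in>UNIV. H c x $ d $ a * pd (Inl b) (\<lambda>y. X c y (Inl d)) x)
     + (\<Sum>d\<in>UNIV. H c x $ b $ d * pd (Inr a) (\<lambda>y. X c y (Inr d)) x)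
     - of_int k / (of_nat CARD('n) + 1) * (\<Sum>\<gamma>\<in>UNIV. pd \<gamma> (\<lambda>y. X c y \<gamma>) x) * H c x $ b $ a = 0)"

definition untwist :: "('m, 'n::finite) scalar_field \<Rightarrow> ('m, 'n) herm_field \<Rightarrow> ('m, 'n) herm_field" where
  "untwist \<tau> H c x = (\<chi> b a. H c x $ b $ a / (\<tau> c x)\<^sup>2)"

end

theory Submission
  imports Defs "HOL-Computational_Algebra.Polynomial"
begin

text \<open>
  In a holomorphic chart let \<open>h\<close> be the matrix of \<open>g\<close>, so that \<open>h\<^sup>-\<^sup>1 = (det \<eta>) \<eta>\<close>, and put
  \<open>L = \<eta>' \<eta>\<^sup>-\<^sup>1\<close>. This matrix is conjugate to \<open>A\<close>, hence \<open>det A(t) = det (L - t)\<close>. The metrisability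
  equation holds for every connection of the class (\<open>chart_metrisability_solution\<close>). Differentiating
  \<open>L \<eta> = \<eta>'\<close> and using it for \<open>\<eta>\<close> and \<open>\<eta>'\<close> with one and the same connection, all Christoffel symbols
  cancel, and the derivative of \<open>L\<close> along \<open>\<partial>/\<partial>z\<^sup>a\<close> is the rank one matrix \<open>- X h(\<partial>/\<partial>z\<^sup>a, -)\<close>
  (\<open>pencil_chart_exists\<close>). From here on only ordinary derivatives occur.

  Second derivatives of \<open>L\<close> commute, and in dimension \<open>n \<ge> 2\<close> this forces \<open>\<partial>X/\<partial>z\<^sup>a = 0\<close> (\<open>pd_X\<close>). By
  Jacobi's formula \<open>\<partial>/\<partial>z\<^sup>a det (L - t) = - h(\<partial>/\<partial>z\<^sup>a, V t)\<close> with \<open>V t = adj (L - t) X\<close>. A rank one change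
  in the direction of \<open>X\<close> does not affect \<open>adj (L - t) X\<close> (\<open>dadj_outer_mult_vec\<close>, Cramer's rule), so
  \<open>\<partial>(V t)/\<partial>z\<^sup>a = 0\<close> as well. The symplectic gradient of \<open>det A(t)\<close> has the components \<open>\<i> V t\<close> and their
  conjugates; it therefore preserves \<open>J\<close>, and a symplectic gradient that preserves \<open>J\<close> is a Killing
  field (\<open>symp_grad_holomorphic_killing\<close>). The same field is a symplectic gradient for \<open>g'\<close>, with
  potential \<open>det (L - t) / (t det L)\<close> (\<open>pd_dual_potential\<close>), so it is a Killing field of \<open>g'\<close> too.
  The Poisson bracket of two potentials measures the asymmetry of \<open>h(V s, V t)\<close>, which vanishes because
  the adjugates of \<open>L - s\<close> and \<open>L - t\<close> commute and are self-adjoint (\<open>V_pairing_symmetric\<close>).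

  The tensor \<open>H(t)\<close> is the adjugate of the matrix \<open>\<eta>' - t \<eta>\<close> (\<open>adj_expansion\<close>). Its covariant
  derivative along \<open>\<partial>/\<partial>z\<^sup>a\<close> is the derivative of the adjugate in a direction that changes only column
  \<open>a\<close>; row \<open>a\<close> of the adjugate does not see this column, which gives the Killing equation
  (\<open>dadj_outer_antisym\<close>). Since the Killing fields preserve both metrics they preserve \<open>\<eta>\<close> and \<open>\<eta>'\<close>
  (\<open>along_weighted_inverse\<close>), hence the whole pencil and its adjugates. Finally \<open>det \<eta>\<close> is parallel for the
  Levi-Civita connection of \<open>g\<close>, so dividing by its square turns \<open>H(t)\<close> into a Killing tensor of \<open>g\<close>.

  The matrices \<open>\<eta>' - t \<eta>\<close> may be singular. Identities for adjugates and their derivatives are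
  therefore first proved for invertible matrices, where they concern inverses, and extended by
  continuity (\<open>continuous_zero_on_invertible\<close>).
\<close>

section \<open>Calculus of smooth functions\<close>

lemma Ck_on_SucD: "Ck_on (Suc k) S f \<Longrightarrow> Ck_on k S f"
proof (induction k arbitrary: f)
  case 0
  then show ?case
    by (auto intro!: continuous_at_imp_continuous_on differentiable_imp_continuous_within)
next
  case (Suc k)
  then show ?case by (metis Ck_on.simps(2))
qed

lemma Ck_on_differentiable: "Ck_on (Suc k) S f \<Longrightarrow> x \<in> S \<Longrightarrow> f differentiable (at x)"
  by simp

lemma Ck_on_cong:
  assumes "open S" "\<And>x. x \<in> S \<Longrightarrow> f x = g x" "Ck_on k S f"
  shows "Ck_on k S g"
  using assms(2,3)
proof (induction k arbitrary: f g)
  case 0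
  then show ?case using continuous_on_cong by force
next
  case (Suc k)
  have diff: "g differentiable (at x)" if "x \<in> S" for x
    using Suc.prems that assms(1)
    by (metis Ck_on.simps(2) differentiable_def has_derivative_transform_within_open)
  have "frechet_derivative f (at x) = frechet_derivative g (at x)" if "x \<in> S" for x
    using frechet_derivative_transform_within_open[OF _ assms(1) that Suc.prems(1)] Suc.prems that by simp
  then have "Ck_on k S (\<lambda>x. frechet_derivative g (at x) v)" for v
    using Suc.IH[of "\<lambda>x. frechet_derivative f (at x) v" "\<lambda>x. frechet_derivative g (at x) v"] Suc.prems
    by simp
  then show ?case using diff by simp
qed

lemma Ck_on_const: "Ck_on k S (\<lambda>x. c)"
  by (induction k arbitrary: c) auto

lemma Ck_on_SucI:
  assumes S: "open S" and d: "\<And>x. x \<in> S \<Longrightarrow> (f has_derivative f' x) (at x)"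
    and C: "\<And>v. Ck_on k S (\<lambda>x. f' x v)"
  shows "Ck_on (Suc k) S f"
proof -
  have "Ck_on k S (\<lambda>x. frechet_derivative f (at x) v)" for v
    by (rule Ck_on_cong[OF S _ C[of v]]) (simp add: frechet_derivative_at[OF d, symmetric])
  then show ?thesis using d by (auto simp: differentiable_def)
qed

lemma Ck_on_has_derivative:
  "Ck_on (Suc k) S f \<Longrightarrow> x \<in> S \<Longrightarrow> (f has_derivative frechet_derivative f (at x)) (at x)"
  by (simp add: frechet_derivative_works[symmetric])

lemma Ck_on_linear:
  assumes "open S" "bounded_linear L" "Ck_on k S f"
  shows "Ck_on k S (\<lambda>x. L (f x))"
  using assms(3)
proof (induction k arbitrary: f)
  case 0
  then show ?case using bounded_linear.continuous_on[OF assms(2)] by simp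
next
  case (Suc k)
  show ?case
    by (rule Ck_on_SucI[OF assms(1) bounded_linear.has_derivative[OF assms(2) Ck_on_has_derivative[OF Suc.prems]]])
       (use Suc in auto)
qed

lemma Ck_on_add:
  assumes "open S" "Ck_on k S f" "Ck_on k S g"
  shows "Ck_on k S (\<lambda>x. f x + g x)"
  using assms(2,3)
proof (induction k arbitrary: f g)
  case 0
  then show ?case by (simp add: continuous_on_add)
next
  case (Suc k)
  show ?case
    by (rule Ck_on_SucI[OF assms(1) has_derivative_add[OF Suc.prems[THEN Ck_on_has_derivative]]])
       (use Suc in auto)
qed

lemma Ck_on_mult:
  fixes f g :: "'a::real_normed_vector \<Rightarrow> 'b::real_normed_algebra"
  assumes "open S" "Ck_on k S f" "Ck_on k S g"
  shows "Ck_on k S (\<lambda>x. f x * g x)"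
  using assms(2,3)
proof (induction k arbitrary: f g)
  case 0
  then show ?case by (simp add: continuous_on_mult)
next
  case (Suc k)
  show ?case
  proof (rule Ck_on_SucI[OF assms(1) has_derivative_mult[OF Suc.prems[THEN Ck_on_has_derivative]]])
    show "Ck_on k S (\<lambda>x. f x * frechet_derivative g (at x) v + frechet_derivative f (at x) v * g x)" for v
      using Suc.prems Suc.prems[THEN Ck_on_SucD] by (intro Ck_on_add Suc.IH assms(1)) auto
  qed
qed

lemma Ck_on_inverse:
  fixes f :: "'a::real_normed_vector \<Rightarrow> complex"
  assumes "open S" "\<And>x. x \<in> S \<Longrightarrow> f x \<noteq> 0" "Ck_on k S f"
  shows "Ck_on k S (\<lambda>x. inverse (f x))"
  using assms(3)
proof (induction k)
  case 0
  then show ?case using assms by (auto intro!: continuous_on_inverse)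
next
  case (Suc k)
  show ?case
  proof (rule Ck_on_SucI[OF assms(1) Deriv.has_derivative_inverse[OF assms(2) Ck_on_has_derivative[OF Suc.prems]]])
    have "Ck_on k S (\<lambda>x. - 1 * (inverse (f x) * frechet_derivative f (at x) v * inverse (f x)))" for v
      using Suc.prems Suc.IH[OF Ck_on_SucD[OF Suc.prems]]
      by (intro Ck_on_mult assms(1) Ck_on_const) auto
    then show "Ck_on k S (\<lambda>x. - (inverse (f x) * frechet_derivative f (at x) v * inverse (f x)))" for v
      by simp
  qed
qed

lemma smooth_on_differentiable: "smooth_on S f \<Longrightarrow> x \<in> S \<Longrightarrow> f differentiable (at x)"
  unfolding smooth_on_def by (meson Ck_on_differentiable)

lemma smooth_on_cong:
  "open S \<Longrightarrow> (\<And>x. x \<in> S \<Longrightarrow> f x = g x) \<Longrightarrow> smooth_on S f \<Longrightarrow> smooth_on S g"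
  unfolding smooth_on_def using Ck_on_cong by blast

lemma smooth_on_const: "smooth_on S (\<lambda>x. c)"
  by (simp add: smooth_on_def Ck_on_const)

lemma smooth_on_linear: "open S \<Longrightarrow> bounded_linear L \<Longrightarrow> smooth_on S f \<Longrightarrow> smooth_on S (\<lambda>x. L (f x))"
  unfolding smooth_on_def using Ck_on_linear by blast

lemma smooth_on_add: "open S \<Longrightarrow> smooth_on S f \<Longrightarrow> smooth_on S g \<Longrightarrow> smooth_on S (\<lambda>x. f x + g x)"
  unfolding smooth_on_def using Ck_on_add by blast

lemma smooth_on_mult:
  fixes f g :: "'a::real_normed_vector \<Rightarrow> 'b::real_normed_algebra"
  shows "open S \<Longrightarrow> smooth_on S f \<Longrightarrow> smooth_on S g \<Longrightarrow> smooth_on S (\<lambda>x. f x * g x)"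
  unfolding smooth_on_def using Ck_on_mult by blast

lemma smooth_on_inverse:
  fixes f :: "'a::real_normed_vector \<Rightarrow> complex"
  shows "open S \<Longrightarrow> (\<And>x. x \<in> S \<Longrightarrow> f x \<noteq> 0) \<Longrightarrow> smooth_on S f \<Longrightarrow> smooth_on S (\<lambda>x. inverse (f x))"
  unfolding smooth_on_def using Ck_on_inverse by blast

lemma smooth_on_divide:
  fixes f :: "'a::real_normed_vector \<Rightarrow> complex"
  shows "open S \<Longrightarrow> (\<And>x. x \<in> S \<Longrightarrow> g x \<noteq> 0) \<Longrightarrow> smooth_on S f \<Longrightarrow> smooth_on S g
    \<Longrightarrow> smooth_on S (\<lambda>x. f x / g x)"
  unfolding divide_inverse by (intro smooth_on_mult smooth_on_inverse)

lemma smooth_on_uminus: "open S \<Longrightarrow> smooth_on S f \<Longrightarrow> smooth_on S (\<lambda>x. - f x)"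
  by (rule smooth_on_linear[OF _ bounded_linear_minus[OF bounded_linear_ident]])

lemma smooth_on_diff: "open S \<Longrightarrow> smooth_on S f \<Longrightarrow> smooth_on S g \<Longrightarrow> smooth_on S (\<lambda>x. f x - g x)"
  using smooth_on_add[OF _ _ smooth_on_uminus[of S g], of f] by simp

lemma smooth_on_cnj: "open S \<Longrightarrow> smooth_on S f \<Longrightarrow> smooth_on S (\<lambda>x. cnj (f x))"
  by (rule smooth_on_linear[OF _ bounded_linear_cnj])

lemma smooth_on_sum:
  assumes "open S" "\<And>i. i \<in> I \<Longrightarrow> smooth_on S (f i)"
  shows "smooth_on S (\<lambda>x. \<Sum>i\<in>I. f i x)"
  using assms(2)
  by (induction I rule: infinite_finite_induct) (auto intro!: smooth_on_const smooth_on_add assms(1))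

lemma smooth_on_prod:
  fixes f :: "'i \<Rightarrow> 'a::real_normed_vector \<Rightarrow> complex"
  assumes "open S" "\<And>i. i \<in> I \<Longrightarrow> smooth_on S (f i)"
  shows "smooth_on S (\<lambda>x. \<Prod>i\<in>I. f i x)"
  using assms(2)
  by (induction I rule: infinite_finite_induct) (auto intro!: smooth_on_const smooth_on_mult assms(1))

lemmas smooth_intros = smooth_on_const smooth_on_add smooth_on_mult smooth_on_divide smooth_on_diff
  smooth_on_uminus smooth_on_cnj smooth_on_sum smooth_on_prod

lemma smooth_on_nth: "open S \<Longrightarrow> smooth_on S F \<Longrightarrow> smooth_on S (\<lambda>x. F x $ i)"
  by (rule smooth_on_linear[OF _ bounded_linear_vec_nth])

lemma bounded_linear_axis: "bounded_linear (\<lambda>v::'b::real_normed_vector. axis i v :: 'b^'n)"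
proof (rule bounded_linear_intro[of _ 1])
  fix v :: 'b
  have "norm (axis i v :: 'b^'n) \<le> (\<Sum>j\<in>UNIV. norm (axis i v $ j :: 'b))"
    unfolding norm_vec_def by (rule L2_set_le_sum) simp
  also have "\<dots> = (\<Sum>j\<in>UNIV. if j = i then norm v else 0)"
    by (rule sum.cong) (auto simp: axis_def)
  finally show "norm (axis i v :: 'b^'n) \<le> norm v * 1" by simp
qed (auto simp: vec_eq_iff axis_def)

lemma smooth_on_vecI:
  fixes F :: "'a::real_normed_vector \<Rightarrow> 'b::real_normed_vector^'n"
  assumes "open S" "\<And>i. smooth_on S (\<lambda>x. F x $ i)"
  shows "smooth_on S F"
proof (rule smooth_on_cong[OF assms(1)])
  show "smooth_on S (\<lambda>x. \<Sum>i\<in>UNIV. axis i (F x $ i) :: 'b^'n)"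
    by (intro smooth_on_sum assms smooth_on_linear[OF _ bounded_linear_axis])
  show "(\<Sum>i\<in>UNIV. axis i (F x $ i)) = F x" for x
    by (simp add: vec_eq_iff axis_def)
qed

lemma smooth_on_det:
  fixes F :: "'a::real_normed_vector \<Rightarrow> complex^'n::finite^'n"
  assumes "open S" "\<And>i j. smooth_on S (\<lambda>x. F x $ i $ j)"
  shows "smooth_on S (\<lambda>x. det (F x))"
  unfolding det_def by (intro smooth_intros assms)

lemma smooth_on_matrix_mult:
  fixes F G :: "'a::real_normed_vector \<Rightarrow> complex^'n::finite^'n"
  assumes "open S" "\<And>i j. smooth_on S (\<lambda>x. F x $ i $ j)" "\<And>i j. smooth_on S (\<lambda>x. G x $ i $ j)"
  shows "smooth_on S (\<lambda>x. (F x ** G x) $ i $ j)"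
  unfolding matrix_matrix_mult_def by (simp, intro smooth_intros assms)

subsection \<open>Wirtinger derivatives\<close>

text \<open>The complex-valued combination of a real-linear map that \<^const>\<open>pd\<close> applies to a derivative.\<close>

fun wirtinger :: "'n::finite idx \<Rightarrow> (complex^'n \<Rightarrow> complex) \<Rightarrow> complex" where
  "wirtinger (Inl a) f = (f (axis a 1) - \<i> * f (axis a \<i>)) / 2"
| "wirtinger (Inr a) f = (f (axis a 1) + \<i> * f (axis a \<i>)) / 2"

lemma pd_wirtinger: "pd \<alpha> f x = wirtinger \<alpha> (frechet_derivative f (at x))"
  by (cases \<alpha>) auto

lemma pd_eqI: "(f has_derivative f') (at x) \<Longrightarrow> pd \<alpha> f x = wirtinger \<alpha> f'"
  by (metis pd_wirtinger frechet_derivative_at)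

lemma has_derivative_frechet: "f differentiable (at x) \<Longrightarrow> (f has_derivative frechet_derivative f (at x)) (at x)"
  by (simp add: frechet_derivative_works)

lemma pd_const [simp]: "pd \<alpha> (\<lambda>x. c) x = 0"
  by (cases \<alpha>) auto

lemma pd_add:
  assumes "f differentiable (at x)" "g differentiable (at x)"
  shows "pd \<alpha> (\<lambda>x. f x + g x) x = pd \<alpha> f x + pd \<alpha> g x"
  using pd_eqI[OF has_derivative_add[OF assms[THEN has_derivative_frechet]], of \<alpha>]
  by (cases \<alpha>) (auto simp: algebra_simps add_divide_distrib diff_divide_distrib)

lemma pd_mult:
  assumes "f differentiable (at x)" "g differentiable (at x)"
  shows "pd \<alpha> (\<lambda>x. f x * g x) x = pd \<alpha> f x * g x + f x * pd \<alpha> g x"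
  using pd_eqI[OF has_derivative_mult[OF assms[THEN has_derivative_frechet]], of \<alpha>]
  by (cases \<alpha>) (auto simp: algebra_simps add_divide_distrib diff_divide_distrib)

lemma pd_cmult:
  assumes "f differentiable (at x)"
  shows "pd \<alpha> (\<lambda>x. c * f x) x = c * pd \<alpha> f x"
  using pd_mult[of "\<lambda>x. c" x f] assms by simp

lemma pd_uminus:
  assumes "f differentiable (at x)"
  shows "pd \<alpha> (\<lambda>x. - f x) x = - pd \<alpha> f x"
  using pd_cmult[OF assms, of \<alpha> "-1"] by simp

lemma pd_diff:
  assumes "f differentiable (at x)" "g differentiable (at x)"
  shows "pd \<alpha> (\<lambda>x. f x - g x) x = pd \<alpha> f x - pd \<alpha> g x"
  using pd_add[OF assms(1), of "\<lambda>x. - g x"] pd_uminus[OF assms(2)] assms(2) by simp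

lemma pd_inverse:
  assumes "f differentiable (at x)" "f x \<noteq> 0"
  shows "pd \<alpha> (\<lambda>x. inverse (f x)) x = - pd \<alpha> f x / (f x)\<^sup>2"
proof -
  let ?D = "frechet_derivative f (at x)"
  have "pd \<alpha> (\<lambda>x. inverse (f x)) x = wirtinger \<alpha> (\<lambda>v. - (inverse (f x) * ?D v * inverse (f x)))"
    using assms by (intro pd_eqI Deriv.has_derivative_inverse has_derivative_frechet)
  also have "\<dots> = - wirtinger \<alpha> ?D / (f x)\<^sup>2"
    using assms(2) by (cases \<alpha>) (simp_all add: field_simps power2_eq_square)
  finally show ?thesis by (simp add: pd_wirtinger)
qed

lemma differentiable_inverse_complex:
  fixes f :: "'a::real_normed_vector \<Rightarrow> complex"
  shows "f differentiable (at x) \<Longrightarrow> f x \<noteq> 0 \<Longrightarrow> (\<lambda>x. inverse (f x)) differentiable (at x)"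
  unfolding differentiable_def using Deriv.has_derivative_inverse by blast

lemma pd_divide:
  assumes "f differentiable (at x)" "g differentiable (at x)" "g x \<noteq> 0"
  shows "pd \<alpha> (\<lambda>x. f x / g x) x = (pd \<alpha> f x * g x - f x * pd \<alpha> g x) / (g x)\<^sup>2"
proof -
  have "pd \<alpha> (\<lambda>x. f x * inverse (g x)) x = pd \<alpha> f x * inverse (g x) + f x * (- pd \<alpha> g x / (g x)\<^sup>2)"
    by (simp add: pd_mult[OF assms(1) differentiable_inverse_complex[OF assms(2,3)]] pd_inverse[OF assms(2,3)])
  also have "\<dots> = (pd \<alpha> f x * g x - f x * pd \<alpha> g x) / (g x)\<^sup>2"
    using assms(3) by (simp add: field_simps power2_eq_square)
  finally show ?thesis by (simp add: divide_inverse)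
qed

lemma pd_sum:
  assumes "\<And>i. i \<in> I \<Longrightarrow> f i differentiable (at x)"
  shows "pd \<alpha> (\<lambda>x. \<Sum>i\<in>I. f i x) x = (\<Sum>i\<in>I. pd \<alpha> (f i) x)"
  using assms
  by (induction I rule: infinite_finite_induct) (auto simp: pd_add)

lemma differentiable_prod:
  fixes f :: "'i \<Rightarrow> 'a::real_normed_vector \<Rightarrow> complex"
  shows "(\<And>i. i \<in> I \<Longrightarrow> f i differentiable (at x)) \<Longrightarrow> (\<lambda>x. \<Prod>i\<in>I. f i x) differentiable (at x)"
  by (induction I rule: infinite_finite_induct) auto

lemma pd_prod:
  assumes "finite I" "\<And>i. i \<in> I \<Longrightarrow> f i differentiable (at x)"
  shows "pd \<alpha> (\<lambda>x. \<Prod>i\<in>I. f i x) x = (\<Sum>i\<in>I. pd \<alpha> (f i) x * (\<Prod>j\<in>I - {i}. f j x))"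
  using assms
proof (induction I rule: finite_induct)
  case (insert k I)
  have "(\<Prod>j\<in>insert k I - {i}. f j x) = f k x * (\<Prod>j\<in>I - {i}. f j x)" if "i \<in> I" for i
  proof -
    have "insert k I - {i} = insert k (I - {i})" using that insert.hyps by auto
    then show ?thesis using insert.hyps by simp
  qed
  moreover have "insert k I - {k} = I" using insert.hyps by auto
  ultimately show ?case
    using insert by (simp add: pd_mult differentiable_prod sum_distrib_left algebra_simps)
qed simp

lemma pd_cnj:
  assumes "f differentiable (at x)"
  shows "pd \<alpha> (\<lambda>x. cnj (f x)) x = cnj (pd (bar \<alpha>) f x)"
  using pd_eqI[OF bounded_linear.has_derivative[OF bounded_linear_cnj has_derivative_frechet[OF assms]], of \<alpha>]
  by (cases \<alpha>) auto

lemma pd_cong_open: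
  assumes "open S" "x \<in> S" "\<And>y. y \<in> S \<Longrightarrow> f y = g y"
  shows "pd \<alpha> f x = pd \<alpha> g x"
proof -
  have "(f has_derivative D) (at x) \<longleftrightarrow> (g has_derivative D) (at x)" for D
    using has_derivative_transform_within_open[OF _ assms(1,2)] assms(3) by metis
  then have "frechet_derivative f (at x) = frechet_derivative g (at x)"
    by (simp add: frechet_derivative_def)
  then show ?thesis by (simp add: pd_wirtinger)
qed

lemma sum_idx:
  fixes F :: "'n::finite idx \<Rightarrow> 'b::comm_monoid_add"
  shows "(\<Sum>\<kappa>\<in>UNIV. F \<kappa>) = (\<Sum>a\<in>UNIV. F (Inl a)) + (\<Sum>a\<in>UNIV. F (Inr a))"
proof -
  have "(\<Sum>\<kappa>\<in>UNIV. F \<kappa>) = sum F (UNIV <+> UNIV)" by simp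
  also have "\<dots> = sum (F \<circ> Inl) UNIV + sum (F \<circ> Inr) UNIV" by (rule sum.Plus) auto
  finally show ?thesis by (simp add: o_def)
qed

lemma real_linear_wirtinger:
  fixes f :: "complex^'n::finite \<Rightarrow> complex"
  assumes "linear f"
  shows "f v = (\<Sum>\<kappa>\<in>UNIV. wirtinger \<kappa> f * ccomp \<kappa> v)"
proof -
  have ax: "f (axis a z) = wirtinger (Inl a) f * z + wirtinger (Inr a) f * cnj z" for a z
  proof -
    have "axis a z = Re z *\<^sub>R axis a (1::complex) + Im z *\<^sub>R axis a \<i>"
      by (simp add: vec_eq_iff axis_def complex_eq_iff)
    then have "f (axis a z) = Re z *\<^sub>R f (axis a 1) + Im z *\<^sub>R f (axis a \<i>)"
      using assms by (simp add: linear_add linear_scale)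
    then show ?thesis by (simp add: complex_eq_iff field_simps)
  qed
  have "f v = f (\<Sum>a\<in>UNIV. axis a (v $ a))"
    by (rule arg_cong[of _ _ f]) (simp add: vec_eq_iff axis_def)
  also have "\<dots> = (\<Sum>a\<in>UNIV. f (axis a (v $ a)))"
    using linear_sum[OF assms] by auto
  also have "\<dots> = (\<Sum>\<kappa>\<in>UNIV. wirtinger \<kappa> f * ccomp \<kappa> v)"
    by (simp only: ax sum_idx sum.distrib ccomp.simps)
  finally show ?thesis .
qed

lemma wirtinger_sum:
  "wirtinger \<alpha> (\<lambda>v. \<Sum>\<kappa>\<in>I. c \<kappa> * F \<kappa> v) = (\<Sum>\<kappa>\<in>I. c \<kappa> * wirtinger \<alpha> (F \<kappa>))"
proof -
  have *: "(\<Sum>\<kappa>\<in>I. c \<kappa> * ((p \<kappa> + e * q \<kappa>) / 2)) = ((\<Sum>\<kappa>\<in>I. c \<kappa> * p \<kappa>) + e * (\<Sum>\<kappa>\<in>I. c \<kappa> * q \<kappa>)) / 2"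
    for p q and e :: complex
    by (simp add: sum_distrib_left sum_divide_distrib sum.distrib[symmetric] distrib_left
        mult.left_commute)
  show ?thesis
    using *[where e = "\<i>"] *[where e = "- \<i>"] by (cases \<alpha>) simp_all
qed

lemma pd_chain:
  assumes "\<phi> differentiable (at x)" "f differentiable (at (\<phi> x))"
  shows "pd \<alpha> (\<lambda>y. f (\<phi> y)) x = (\<Sum>\<kappa>\<in>UNIV. pd \<kappa> f (\<phi> x) * pd \<alpha> (\<lambda>y. ccomp \<kappa> (\<phi> y)) x)"
proof -
  let ?F = "frechet_derivative f (at (\<phi> x))" and ?P = "frechet_derivative \<phi> (at x)"
  have lin: "linear ?F" using assms(2) linear_frechet_derivative by blast
  have cc: "((\<lambda>y. ccomp \<kappa> (\<phi> y)) has_derivative (\<lambda>v. ccomp \<kappa> (?P v))) (at x)" for \<kappa>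
  proof (cases \<kappa>)
    case (Inl a)
    then show ?thesis
      using bounded_linear.has_derivative[OF bounded_linear_vec_nth has_derivative_frechet[OF assms(1)]] by simp
  next
    case (Inr a)
    then show ?thesis
      using bounded_linear.has_derivative[OF bounded_linear_cnj bounded_linear.has_derivative[OF
          bounded_linear_vec_nth has_derivative_frechet[OF assms(1)]]] by simp
  qed
  have "pd \<alpha> (\<lambda>y. f (\<phi> y)) x = wirtinger \<alpha> (\<lambda>v. ?F (?P v))"
    using diff_chain_at[OF has_derivative_frechet[OF assms(1)] has_derivative_frechet[OF assms(2)]]
    by (intro pd_eqI) (simp add: o_def)
  also have "\<dots> = wirtinger \<alpha> (\<lambda>v. \<Sum>\<kappa>\<in>UNIV. wirtinger \<kappa> ?F * ccomp \<kappa> (?P v))"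
    by (subst real_linear_wirtinger[OF lin]) simp
  also have "\<dots> = (\<Sum>\<kappa>\<in>UNIV. wirtinger \<kappa> ?F * wirtinger \<alpha> (\<lambda>v. ccomp \<kappa> (?P v)))"
    by (rule wirtinger_sum)
  also have "\<dots> = (\<Sum>\<kappa>\<in>UNIV. pd \<kappa> f (\<phi> x) * pd \<alpha> (\<lambda>y. ccomp \<kappa> (\<phi> y)) x)"
    by (simp add: pd_wirtinger frechet_derivative_at[OF cc, symmetric])
  finally show ?thesis .
qed

subsection \<open>Symmetry of second derivatives\<close>

text \<open>
  The second difference of \<open>f\<close> over a small parallelogram with sides \<open>s v\<close> and \<open>s w\<close> is, by the
  mean value theorem applied twice, \<open>s\<^sup>2\<close> times a value of \<open>D\<^sub>w D\<^sub>v f\<close> in the parallelogram.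
\<close>

lemma second_difference_mean_value:
  fixes f :: "'a::real_normed_vector \<Rightarrow> real"
  assumes s: "s > 0" and inS: "\<And>p q. 0 \<le> p \<Longrightarrow> p \<le> s \<Longrightarrow> 0 \<le> q \<Longrightarrow> q \<le> s \<Longrightarrow> x + p *\<^sub>R v + q *\<^sub>R w \<in> S"
    and df: "\<And>y. y \<in> S \<Longrightarrow> (f has_derivative f' y) (at y)"
    and ddf: "\<And>y. y \<in> S \<Longrightarrow> ((\<lambda>y. f' y v) has_derivative f'' y) (at y)"
  obtains p q where "0 \<le> p" "p \<le> s" "0 \<le> q" "q \<le> s"
    "f (x + s *\<^sub>R v + s *\<^sub>R w) - f (x + s *\<^sub>R v) - f (x + s *\<^sub>R w) + f x
      = s\<^sup>2 * f'' (x + p *\<^sub>R v + q *\<^sub>R w) w"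
proof -
  define \<phi> where "\<phi> p = f (x + p *\<^sub>R v + s *\<^sub>R w) - f (x + p *\<^sub>R v)" for p
  have line: "((\<lambda>p. g (y + p *\<^sub>R u)) has_real_derivative g' u) (at p)"
    if "(g has_derivative g') (at (y + p *\<^sub>R u))" for g :: "'a \<Rightarrow> real" and g' y u p
  proof -
    have "((\<lambda>p. y + p *\<^sub>R u) has_derivative (\<lambda>t. t *\<^sub>R u)) (at p)"
      by (auto intro!: derivative_eq_intros)
    from diff_chain_at[OF this that] show ?thesis
      using linear_scale[OF has_derivative_linear[OF that]]
      by (simp add: has_field_derivative_def o_def mult_commute_abs)
  qed
  have d\<phi>: "(\<phi> has_real_derivative (f' (x + p *\<^sub>R v + s *\<^sub>R w) v - f' (x + p *\<^sub>R v) v)) (at p)"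
    if "0 \<le> p" "p \<le> s" for p
  proof -
    have "(f has_derivative f' ((x + s *\<^sub>R w) + p *\<^sub>R v)) (at ((x + s *\<^sub>R w) + p *\<^sub>R v))"
      using df[OF inS[of p s]] that s by (simp add: algebra_simps)
    from line[OF this]
    have 1: "((\<lambda>p. f (x + p *\<^sub>R v + s *\<^sub>R w)) has_real_derivative f' (x + p *\<^sub>R v + s *\<^sub>R w) v) (at p)"
      by (simp add: algebra_simps)
    have 2: "((\<lambda>p. f (x + p *\<^sub>R v)) has_real_derivative f' (x + p *\<^sub>R v) v) (at p)"
      using df[OF inS[of p 0]] that s by (intro line) simp
    show ?thesis unfolding \<phi>_def by (rule DERIV_diff[OF 1 2])
  qed
  obtain p where p: "0 < p" "p < s"
      "\<phi> s - \<phi> 0 = (s - 0) * (f' (x + p *\<^sub>R v + s *\<^sub>R w) v - f' (x + p *\<^sub>R v) v)"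
    using MVT2[OF s d\<phi>] by blast
  have "((\<lambda>q. f' (x + p *\<^sub>R v + q *\<^sub>R w) v) has_real_derivative f'' (x + p *\<^sub>R v + q *\<^sub>R w) w) (at q)"
    if "0 \<le> q" "q \<le> s" for q
    using ddf[OF inS[of p q]] p that by (intro line) auto
  from MVT2[OF s this] obtain q where q: "0 < q" "q < s"
      "f' (x + p *\<^sub>R v + s *\<^sub>R w) v - f' (x + p *\<^sub>R v) v = s * f'' (x + p *\<^sub>R v + q *\<^sub>R w) w"
    by auto
  have "f (x + s *\<^sub>R v + s *\<^sub>R w) - f (x + s *\<^sub>R v) - f (x + s *\<^sub>R w) + f x = \<phi> s - \<phi> 0"
    by (simp add: \<phi>_def)
  also have "\<dots> = s\<^sup>2 * f'' (x + p *\<^sub>R v + q *\<^sub>R w) w"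
    using p(3) q(3) by (simp add: power2_eq_square)
  finally show ?thesis using that[of p q] p q by auto
qed

lemma second_derivative_symmetric_real:
  fixes f :: "'a::real_normed_vector \<Rightarrow> real"
  assumes S: "open S" "x \<in> S"
    and df: "\<And>y. y \<in> S \<Longrightarrow> (f has_derivative f' y) (at y)"
    and dv: "\<And>y. y \<in> S \<Longrightarrow> ((\<lambda>y. f' y v) has_derivative fv y) (at y)"
    and dw: "\<And>y. y \<in> S \<Longrightarrow> ((\<lambda>y. f' y w) has_derivative fw y) (at y)"
    and cont: "continuous_on S (\<lambda>y. fv y w)" "continuous_on S (\<lambda>y. fw y v)"
  shows "fv x w = fw x v"
proof (rule ccontr)
  assume ne: "fv x w \<noteq> fw x v"
  define e where "e = dist (fv x w) (fw x v) / 2"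
  have e: "e > 0" using ne by (simp add: e_def)
  have "isCont (\<lambda>y. fv y w) x" "isCont (\<lambda>y. fw y v) x"
    using cont S by (simp_all add: continuous_on_eq_continuous_at)
  then obtain d1 d2 where d1: "d1 > 0" "\<And>y. dist y x < d1 \<Longrightarrow> dist (fv y w) (fv x w) < e"
    and d2: "d2 > 0" "\<And>y. dist y x < d2 \<Longrightarrow> dist (fw y v) (fw x v) < e"
    using e unfolding continuous_at_eps_delta by metis
  obtain d3 where d3: "d3 > 0" "\<And>y. dist y x < d3 \<Longrightarrow> y \<in> S"
    using S open_dist by metis
  define d where "d = min d1 (min d2 d3)"
  have d: "d > 0" using d1 d2 d3 by (simp add: d_def)
  \<comment> \<open>small enough for the parallelogram with sides \<open>s v\<close> and \<open>s w\<close> to lie in the ball of radius \<open>d\<close>\<close>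
  define s where "s = d / (2 * (norm v + norm w + 1))"
  have pos: "norm v + norm w + 1 > 0" using norm_ge_zero[of v] norm_ge_zero[of w] by linarith
  have s: "s > 0" using d pos by (simp add: s_def)
  have near: "dist (x + p *\<^sub>R v + q *\<^sub>R w) x < d" if "0 \<le> p" "p \<le> s" "0 \<le> q" "q \<le> s" for p q
  proof -
    have "dist (x + p *\<^sub>R v + q *\<^sub>R w) x \<le> norm (p *\<^sub>R v) + norm (q *\<^sub>R w)"
      using norm_triangle_ineq[of "p *\<^sub>R v" "q *\<^sub>R w"] by (simp add: dist_norm algebra_simps)
    also have "\<dots> \<le> s * norm v + s * norm w"
      using that by (simp add: add_mono mult_right_mono)
    also have "\<dots> \<le> s * (norm v + norm w + 1)" using s by (simp add: algebra_simps)
    also have "\<dots> = d / 2" using pos unfolding s_def by (simp add: divide_simps del: distrib_left_numeral)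
    finally show ?thesis using d by simp
  qed
  have inS: "x + p *\<^sub>R v + q *\<^sub>R w \<in> S" if "0 \<le> p" "p \<le> s" "0 \<le> q" "q \<le> s" for p q
    using near[OF that] d3(2) by (simp add: d_def)
  obtain p q where pq: "0 \<le> p" "p \<le> s" "0 \<le> q" "q \<le> s"
    "f (x + s *\<^sub>R v + s *\<^sub>R w) - f (x + s *\<^sub>R v) - f (x + s *\<^sub>R w) + f x
      = s\<^sup>2 * fv (x + p *\<^sub>R v + q *\<^sub>R w) w"
    using second_difference_mean_value[OF s inS df dv] by blast
  have inS': "x + p *\<^sub>R w + q *\<^sub>R v \<in> S" if "0 \<le> p" "p \<le> s" "0 \<le> q" "q \<le> s" for p q
    using inS[of q p] that by (simp add: algebra_simps)
  obtain p' q' where pq': "0 \<le> p'" "p' \<le> s" "0 \<le> q'" "q' \<le> s"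
    "f (x + s *\<^sub>R w + s *\<^sub>R v) - f (x + s *\<^sub>R w) - f (x + s *\<^sub>R v) + f x
      = s\<^sup>2 * fw (x + p' *\<^sub>R w + q' *\<^sub>R v) v"
    using second_difference_mean_value[OF s inS' df dw] by blast
  have "s\<^sup>2 * fv (x + p *\<^sub>R v + q *\<^sub>R w) w = s\<^sup>2 * fw (x + q' *\<^sub>R v + p' *\<^sub>R w) v"
    using pq(5) pq'(5) by (simp add: algebra_simps)
  then have eq: "fv (x + p *\<^sub>R v + q *\<^sub>R w) w = fw (x + q' *\<^sub>R v + p' *\<^sub>R w) v"
    using s by simp
  have "dist (fv (x + p *\<^sub>R v + q *\<^sub>R w) w) (fv x w) < e"
    using d1(2) near[OF pq(1-4)] by (simp add: d_def)
  moreover have "dist (fv (x + p *\<^sub>R v + q *\<^sub>R w) w) (fw x v) < e"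
    using d2(2) near[OF pq'(3,4,1,2)] eq by (simp add: d_def)
  ultimately show False
    unfolding e_def dist_real_def by (auto simp: abs_if split: if_splits)
qed

lemma second_derivative_symmetric:
  fixes f :: "'a::real_normed_vector \<Rightarrow> complex"
  assumes S: "open S" "x \<in> S" and sm: "smooth_on S f"
  shows "frechet_derivative (\<lambda>y. frechet_derivative f (at y) v) (at x) w
       = frechet_derivative (\<lambda>y. frechet_derivative f (at y) w) (at x) v"
proof -
  let ?D = "\<lambda>v y. frechet_derivative f (at y) v"
  let ?DD = "\<lambda>v y. frechet_derivative (?D v) (at y)"
  have C2: "Ck_on (Suc (Suc 0)) S f" using sm by (auto simp only: smooth_on_def)
  have 1: "(f has_derivative frechet_derivative f (at y)) (at y)" if "y \<in> S" for y
    using C2 that by (simp add: frechet_derivative_works)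
  have 2: "(?D u has_derivative ?DD u y) (at y)" if "y \<in> S" for y u
    using C2 that by (simp add: frechet_derivative_works)
  have 3: "continuous_on S (\<lambda>y. ?DD u y u')" for u u' using C2 by simp
  have "R (?DD v x w) = R (?DD w x v)" if R: "bounded_linear R" for R :: "complex \<Rightarrow> real"
    by (rule second_derivative_symmetric_real[OF S, where f = "\<lambda>y. R (f y)"])
       (auto intro: bounded_linear.has_derivative[OF R] 1 2 bounded_linear.continuous_on[OF R] 3)
  from this[OF bounded_linear_Re] this[OF bounded_linear_Im] show ?thesis
    by (simp add: complex_eq_iff)
qed

lemma smooth_on_frechet: "smooth_on S f \<Longrightarrow> smooth_on S (\<lambda>x. frechet_derivative f (at x) v)"
  unfolding smooth_on_def using Ck_on.simps(2) by blast

lemma smooth_on_pd: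
  assumes "open S" "smooth_on S f"
  shows "smooth_on S (pd \<alpha> f)"
proof -
  have "smooth_on S (\<lambda>x. wirtinger \<alpha> (frechet_derivative f (at x)))"
    by (cases \<alpha>; simp; intro smooth_intros smooth_on_frechet assms; simp)
  then show ?thesis by (simp add: pd_wirtinger[abs_def])
qed

lemma pd_commute:
  assumes S: "open S" "x \<in> S" and sm: "smooth_on S f"
  shows "pd \<alpha> (pd \<beta> f) x = pd \<beta> (pd \<alpha> f) x"
proof -
  let ?D = "\<lambda>v. frechet_derivative (\<lambda>y. frechet_derivative f (at y) v) (at x)"
  have D: "((\<lambda>y. frechet_derivative f (at y) v) has_derivative ?D v) (at x)" for v
    by (intro has_derivative_frechet smooth_on_differentiable[OF smooth_on_frechet[OF sm] S(2)])
  have "pd \<gamma> (pd \<delta> f) x = wirtinger \<gamma> (\<lambda>w. wirtinger \<delta> (\<lambda>v. ?D v w))" for \<gamma> \<delta>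
  proof (rule pd_eqI)
    show "(pd \<delta> f has_derivative (\<lambda>w. wirtinger \<delta> (\<lambda>v. ?D v w))) (at x)"
      unfolding pd_wirtinger[abs_def]
      by (cases \<delta>) (auto intro!: derivative_eq_intros D)
  qed
  moreover have "?D v w = ?D w v" for v w by (rule second_derivative_symmetric[OF S sm])
  ultimately show ?thesis
    by (cases \<alpha>; cases \<beta>) (simp_all add: field_simps)
qed

declare pd.simps [simp del]

section \<open>The adjugate matrix and its derivative\<close>

lemma mat_mult_nth [simp]: "(mat c ** (M::complex^'n::finite^'m::finite)) $ i $ j = c * M $ i $ j"
  by (simp add: matrix_matrix_mult_def mat_def if_distrib[of "\<lambda>x. x * _"] cong: if_cong)

lemma mult_mat: "(M::complex^'n::finite^'n) ** mat c = mat c ** M"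
  by (simp add: vec_eq_iff) (simp add: matrix_matrix_mult_def mat_def if_distrib[of "\<lambda>x. _ * x"] cong: if_cong)

lemma mat_mult_mat: "mat a ** mat b = (mat (a * b) :: complex^'n::finite^'n)"
  by (simp add: vec_eq_iff) (simp add: mat_def)

lemma mat_mult_mat_assoc: "mat a ** (mat b ** M) = mat (a * b) ** (M::complex^'n::finite^'n)"
  by (simp add: vec_eq_iff)

lemma mult_mat_left: "(A::complex^'n::finite^'n) ** (mat c ** B) = mat c ** (A ** B)"
  by (metis matrix_mul_assoc mult_mat)

lemma matrix_sub_ldistrib: "A ** (B - C) = A ** B - A ** (C::complex^'n::finite^'n)"
  by (simp add: vec_eq_iff matrix_matrix_mult_def sum_subtractf algebra_simps)

lemma matrix_sub_rdistrib: "(A - B) ** C = A ** C - B ** (C::complex^'n::finite^'n)"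
  by (simp add: vec_eq_iff matrix_matrix_mult_def sum_subtractf algebra_simps)

lemma matrix_add_rdistrib: "(A + B) ** C = A ** C + B ** (C::complex^'n::finite^'n)"
  by (simp add: vec_eq_iff matrix_matrix_mult_def sum.distrib algebra_simps)

lemma matrix_minus_left: "(- A) ** B = - (A ** (B::complex^'n::finite^'n))"
  by (simp add: vec_eq_iff matrix_matrix_mult_def sum_negf)

lemma matrix_minus_right: "A ** (- B) = - (A ** (B::complex^'n::finite^'n))"
  by (simp add: vec_eq_iff matrix_matrix_mult_def sum_negf)

lemma mat_mult_left_cancel: "c \<noteq> 0 \<Longrightarrow> mat c ** A = mat c ** B \<longleftrightarrow> A = (B::complex^'n::finite^'n)"
  by (simp add: vec_eq_iff)

lemma inverse_matrix_exists:
  assumes "det (C::complex^'n::finite^'n) \<noteq> 0"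
  obtains D where "C ** D = mat 1" "D ** C = mat 1"
  using assms invertible_det_nz invertible_def by metis

lemma trace_mat_mult: "trace (mat c ** M) = c * trace (M::complex^'n::finite^'n)"
  by (simp add: trace_def sum_distrib_left)

subsection \<open>Expansion of the determinant and of the adjugate\<close>

abbreviation perms :: "('n::finite \<Rightarrow> 'n) set" where
  "perms \<equiv> {p. p permutes UNIV}"

lemma finite_perms: "finite (perms :: ('n::finite \<Rightarrow> 'n) set)"
  by (rule finite_permutations) simp

lemma perms_bij: "\<sigma> \<in> perms \<Longrightarrow> bij \<sigma>"
  by (simp add: permutes_bij)

lemma sign_comp_perms: "\<sigma> \<in> perms \<Longrightarrow> \<rho> \<in> perms \<Longrightarrow> sign (\<sigma> \<circ> \<rho>) = sign \<sigma> * sign (\<rho>::'n::finite \<Rightarrow> 'n)"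
  by (intro sign_compose) (auto simp: permutation_permutes intro: finite)

text \<open>
  The pairs of permutations in the epsilon contractions are reparametrised by their quotient:
  writing \<open>\<rho> = p \<circ> \<sigma>\<close> turns the summand into one that depends on \<open>p\<close> only.
\<close>

lemma eps_sum_quotient:
  fixes C :: "complex^'n::finite^'n"
  assumes "\<sigma> \<in> perms"
  shows "(\<Sum>\<rho> | \<rho> \<in> perms \<and> Q (\<rho> \<circ> inv \<sigma>). cnj (eps \<sigma>) * eps \<rho> * (\<Prod>i\<in>A. C $ \<sigma> i $ \<rho> i))
       = (\<Sum>p | p \<in> perms \<and> Q p. of_int (sign p) * (\<Prod>j\<in>\<sigma> ` A. C $ j $ p j))"
proof (rule sum.reindex_bij_witness[of _ "\<lambda>p. p \<circ> \<sigma>" "\<lambda>\<rho>. \<rho> \<circ> inv \<sigma>"])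
  have inv: "\<sigma> \<circ> inv \<sigma> = id" "inv \<sigma> \<circ> \<sigma> = id"
    using permutes_inv_o assms by auto
  have invp: "inv \<sigma> \<in> perms" using permutes_inv assms by auto
  fix \<rho> assume \<rho>: "\<rho> \<in> {\<rho>. \<rho> \<in> perms \<and> Q (\<rho> \<circ> inv \<sigma>)}"
  show "(\<rho> \<circ> inv \<sigma>) \<circ> \<sigma> = \<rho>" by (simp add: comp_assoc inv)
  show "\<rho> \<circ> inv \<sigma> \<in> {p. p \<in> perms \<and> Q p}" using \<rho> invp by (auto intro: permutes_compose)
  have inj: "inj_on \<sigma> A" using perms_bij[OF assms] by (meson bij_is_inj inj_on_subset subset_UNIV)
  have "sign \<rho> = sign (\<rho> \<circ> inv \<sigma>) * sign \<sigma>"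
    using sign_comp_perms[of "\<rho> \<circ> inv \<sigma>" \<sigma>] \<rho> invp assms permutes_compose[of "inv \<sigma>" UNIV \<rho>]
    by (simp add: comp_assoc inv)
  then have "eps \<rho> = of_int (sign (\<rho> \<circ> inv \<sigma>)) * of_int (sign \<sigma>)" using \<rho> by (simp add: eps_def)
  moreover have "of_int (sign \<sigma>) * of_int (sign \<sigma>) = (1::complex)"
    by (metis of_int_1 of_int_mult sign_idempotent)
  ultimately have e: "cnj (eps \<sigma>) * eps \<rho> = of_int (sign (\<rho> \<circ> inv \<sigma>))"
    using assms by (simp add: eps_def mult.left_commute)
  show "of_int (sign (\<rho> \<circ> inv \<sigma>)) * (\<Prod>j\<in>\<sigma> ` A. C $ j $ (\<rho> \<circ> inv \<sigma>) j)
      = cnj (eps \<sigma>) * eps \<rho> * (\<Prod>i\<in>A. C $ \<sigma> i $ \<rho> i)"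
    using inv by (simp add: e prod.reindex[OF inj] o_def fun_eq_iff)
next
  fix p assume p: "p \<in> {p. p \<in> perms \<and> Q p}"
  have inv: "\<sigma> \<circ> inv \<sigma> = id" using permutes_inv_o assms by auto
  show "(p \<circ> \<sigma>) \<circ> inv \<sigma> = p" by (simp add: comp_assoc inv)
  then show "p \<circ> \<sigma> \<in> {\<rho>. \<rho> \<in> perms \<and> Q (\<rho> \<circ> inv \<sigma>)}"
    using p assms by (auto intro: permutes_compose)
qed

lemma det_contra_eq_det: "det_contra C = det (C::complex^'n::finite^'n)"
proof -
  let ?f = "\<lambda>\<sigma> \<rho>. cnj (eps \<sigma>) * eps \<rho> * (\<Prod>i\<in>UNIV. C $ \<sigma> i $ \<rho> i)"
  have "(\<Sum>\<sigma>\<in>UNIV. \<Sum>\<rho>\<in>UNIV. ?f \<sigma> \<rho>) = (\<Sum>\<sigma>\<in>perms. \<Sum>\<rho>\<in>UNIV. ?f \<sigma> \<rho>)"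
    by (rule sum.mono_neutral_right) (auto simp: eps_def)
  also have "\<dots> = (\<Sum>\<sigma>\<in>perms. \<Sum>\<rho>\<in>perms. ?f \<sigma> \<rho>)"
    by (intro sum.cong refl sum.mono_neutral_right) (auto simp: eps_def)
  also have "\<dots> = (\<Sum>\<sigma>\<in>(perms::('n \<Rightarrow> 'n) set). det C)"
  proof (rule sum.cong[OF refl])
    fix \<sigma> :: "'n \<Rightarrow> 'n" assume s: "\<sigma> \<in> perms"
    have "surj \<sigma>" using s permutes_surj by auto
    then show "(\<Sum>\<rho>\<in>perms. ?f \<sigma> \<rho>) = det C"
      using eps_sum_quotient[OF s, where Q = "\<lambda>_. True" and A = UNIV and C = C] by (simp add: det_def)
  qed
  also have "\<dots> = fact CARD('n) * det C"
    by (simp add: card_permutations[OF refl])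
  finally show ?thesis by (simp add: det_contra_def)
qed

abbreviation adj :: "complex^'n::finite^'n \<Rightarrow> complex^'n^'n" where
  "adj \<equiv> H_tensor"

lemma card_perms_fixing:
  "card {\<sigma>. \<sigma> \<in> perms \<and> \<sigma> i = (a::'n::finite)} = fact (CARD('n) - 1)"
proof -
  have "bij_betw (\<lambda>\<sigma>. Transposition.transpose i a \<circ> \<sigma>) {\<sigma>. \<sigma> permutes (UNIV - {i})} {\<sigma>. \<sigma> \<in> perms \<and> \<sigma> i = a}"
  proof (rule bij_betwI[where g = "\<lambda>\<sigma>. Transposition.transpose i a \<circ> \<sigma>"])
    have tp: "Transposition.transpose i a permutes UNIV" by (simp add: permutes_swap_id)
    have iff: "\<sigma> permutes (UNIV - {i}) \<longleftrightarrow> \<sigma> permutes UNIV \<and> \<sigma> i = i" for \<sigma>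
      by (auto simp: permutes_def)
    show "(\<lambda>\<sigma>. Transposition.transpose i a \<circ> \<sigma>) \<in> {\<sigma>. \<sigma> permutes (UNIV - {i})} \<rightarrow> {\<sigma>. \<sigma> \<in> perms \<and> \<sigma> i = a}"
      using tp by (auto intro!: permutes_compose simp: iff)
    show "(\<lambda>\<sigma>. Transposition.transpose i a \<circ> \<sigma>) \<in> {\<sigma>. \<sigma> \<in> perms \<and> \<sigma> i = a} \<rightarrow> {\<sigma>. \<sigma> permutes (UNIV - {i})}"
      using tp by (auto intro!: permutes_compose simp: iff)
    show "Transposition.transpose i a \<circ> (Transposition.transpose i a \<circ> \<sigma>) = \<sigma>" for \<sigma>
      by (simp add: comp_assoc[symmetric])
    show "Transposition.transpose i a \<circ> (Transposition.transpose i a \<circ> \<sigma>) = \<sigma>" for \<sigma>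
      by (simp add: comp_assoc[symmetric])
  qed
  from bij_betw_same_card[OF this] show ?thesis
    by (simp add: card_permutations[OF refl] card_Diff_singleton)
qed

lemma adj_expansion:
  fixes C :: "complex^'n::finite^'n"
  shows "adj C $ b $ a = (\<Sum>p | p \<in> perms \<and> p a = b. of_int (sign p) * (\<Prod>j\<in>UNIV - {a}. C $ j $ p j))"
proof -
  let ?S = "{\<sigma>::'n \<Rightarrow> 'n. \<sigma> \<in> perms \<and> \<sigma> first_slot = a}"
  let ?f = "\<lambda>\<sigma> \<rho>. cnj (eps \<sigma>) * eps \<rho> * (\<Prod>i\<in>UNIV - {first_slot}. C $ \<sigma> i $ \<rho> i)"
  let ?R = "\<Sum>p | p \<in> perms \<and> p a = b. of_int (sign p) * (\<Prod>j\<in>UNIV - {a}. C $ j $ p j)"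
  have "(\<Sum>\<sigma> | \<sigma> first_slot = a. \<Sum>\<rho> | \<rho> first_slot = b. ?f \<sigma> \<rho>)
      = (\<Sum>\<sigma>\<in>?S. \<Sum>\<rho> | \<rho> first_slot = b. ?f \<sigma> \<rho>)"
    by (rule sum.mono_neutral_right) (auto simp: eps_def)
  also have "\<dots> = (\<Sum>\<sigma>\<in>?S. \<Sum>\<rho> | \<rho> \<in> perms \<and> \<rho> first_slot = b. ?f \<sigma> \<rho>)"
    by (intro sum.cong refl sum.mono_neutral_right) (auto simp: eps_def)
  also have "\<dots> = (\<Sum>\<sigma>\<in>?S. ?R)"
  proof (rule sum.cong[OF refl])
    fix \<sigma> assume s: "\<sigma> \<in> ?S"
    then have s': "\<sigma> \<in> perms" by simp
    have "bij \<sigma>" using perms_bij[OF s'] .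
    then have im: "\<sigma> ` (UNIV - {first_slot}) = UNIV - {a}" and iv: "inv \<sigma> a = first_slot"
      using s by (auto simp: image_set_diff bij_is_inj bij_is_surj inv_f_eq)
    show "(\<Sum>\<rho> | \<rho> \<in> perms \<and> \<rho> first_slot = b. ?f \<sigma> \<rho>) = ?R"
      using eps_sum_quotient[OF s', where Q = "\<lambda>p. p a = b" and A = "UNIV - {first_slot}" and C = C] by (simp add: im iv)
  qed
  also have "\<dots> = fact (CARD('n) - 1) * ?R" by (simp add: card_perms_fixing[simplified])
  finally show ?thesis by (simp add: H_tensor_def)
qed

text \<open>
  Laplace expansion. Column \<open>a\<close> of the adjugate does not involve row \<open>a\<close> of \<open>C\<close>, so it
  computes the determinants of all matrices that differ from \<open>C\<close> in this row only.
\<close>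

lemma row_mult_adj:
  fixes C :: "complex^'n::finite^'n"
  shows "(\<Sum>b\<in>UNIV. r $ b * adj C $ b $ a) = det (\<chi> i. if i = a then r else C $ i)"
proof -
  let ?t = "\<lambda>p. of_int (sign p) * (\<Prod>j\<in>UNIV - {a}. C $ j $ p j)"
  have "det (\<chi> i. if i = a then r else C $ i) = (\<Sum>p\<in>perms. r $ p a * ?t p)"
    unfolding det_def
  proof (rule sum.cong[OF refl])
    fix p :: "'n \<Rightarrow> 'n"
    have "(\<Prod>i\<in>UNIV. (\<chi> i. if i = a then r else C $ i) $ i $ p i)
        = r $ p a * (\<Prod>j\<in>UNIV - {a}. C $ j $ p j)"
      by (subst prod.remove[of _ a]) (auto intro!: prod.cong)
    then show "of_int (sign p) * (\<Prod>i\<in>UNIV. (\<chi> i. if i = a then r else C $ i) $ i $ p i) = r $ p a * ?t p"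
      by simp
  qed
  also have "\<dots> = (\<Sum>b\<in>UNIV. \<Sum>p | p \<in> perms \<and> p a = b. r $ p a * ?t p)"
    using sum.group[OF finite_perms, of UNIV "\<lambda>p. p a" "\<lambda>p. r $ p a * ?t p"] by simp
  also have "\<dots> = (\<Sum>b\<in>UNIV. r $ b * adj C $ b $ a)"
    by (rule sum.cong[OF refl]) (simp add: adj_expansion sum_distrib_left)
  finally show ?thesis by simp
qed

lemma mult_adj: "C ** adj C = mat (det (C::complex^'n::finite^'n))"
proof -
  have "(C ** adj C) $ c $ a = mat (det C) $ c $ a" for c a
  proof -
    have "(C ** adj C) $ c $ a = det (\<chi> i. if i = a then C $ c else C $ i)"
      by (simp add: matrix_matrix_mult_def row_mult_adj)
    also have "\<dots> = (if c = a then det C else 0)"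
    proof (cases "c = a")
      case True
      have "(\<chi> i. if i = a then C $ c else C $ i) = C" using True by (simp add: vec_eq_iff)
      then show ?thesis using True by simp
    next
      case False
      then show ?thesis
        using det_identical_rows[of c a "\<chi> i. if i = a then C $ c else C $ i"] by (simp add: row_def)
    qed
    finally show ?thesis by (simp add: mat_def)
  qed
  then show ?thesis by (simp add: vec_eq_iff)
qed

lemma adj_eq_inverse:
  assumes "(C::complex^'n::finite^'n) ** D = mat 1"
  shows "adj C = mat (det C) ** D"
proof -
  have "D ** C = mat 1" using assms matrix_left_right_inverse by blast
  then have "adj C = D ** (C ** adj C)" by (simp add: matrix_mul_assoc)
  then show ?thesis by (simp add: mult_adj mult_mat)
qed

lemma adj_mat_mult: "adj (mat r ** C) = mat (r ^ (CARD('n) - 1)) ** adj (C::complex^'n::finite^'n)"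
  by (simp add: vec_eq_iff adj_expansion prod.distrib sum_distrib_left mult.left_commute card_Diff_singleton)

lemma det_mat_mult: "det (mat r ** C) = r ^ CARD('n) * det (C::complex^'n::finite^'n)"
  by (simp add: det_def prod.distrib sum_distrib_left mult.left_commute)

lemma adj_conj_transpose:
  fixes C :: "complex^'n::finite^'n"
  shows "cnj (adj C $ b $ a) = adj (\<chi> i j. cnj (C $ j $ i)) $ a $ b"
proof -
  have ce: "cnj (eps \<rho>) = eps \<rho>" for \<rho> :: "'n \<Rightarrow> 'n" by (simp add: eps_def)
  have "cnj (adj C $ b $ a) = 1 / fact (CARD('n) - 1) * (\<Sum>\<sigma> | \<sigma> first_slot = a. \<Sum>\<rho> | \<rho> first_slot = b.
      eps \<sigma> * eps \<rho> * (\<Prod>i\<in>UNIV - {first_slot}. cnj (C $ \<sigma> i $ \<rho> i)))"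
    by (simp add: H_tensor_def ce)
  also have "\<dots> = 1 / fact (CARD('n) - 1) * (\<Sum>\<rho> | \<rho> first_slot = b. \<Sum>\<sigma> | \<sigma> first_slot = a.
      eps \<rho> * eps \<sigma> * (\<Prod>i\<in>UNIV - {first_slot}. cnj (C $ \<sigma> i $ \<rho> i)))"
    by (subst sum.swap) (simp add: mult_ac)
  also have "\<dots> = adj (\<chi> i j. cnj (C $ j $ i)) $ a $ b"
    by (simp add: H_tensor_def ce)
  finally show ?thesis .
qed

lemma det_conj_transpose: "cnj (det C) = det (\<chi> i j. cnj ((C::complex^'n::finite^'n) $ j $ i))"
proof -
  have "det (\<chi> i j. cnj (C $ j $ i)) = det (transpose (\<chi> i j. cnj (C $ i $ j)))"
    by (simp add: transpose_def)
  also have "\<dots> = cnj (det C)" unfolding det_transpose by (simp add: det_def)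
  finally show ?thesis by simp
qed

subsection \<open>Invertible matrices are dense\<close>

text \<open>
  Along the line from \<open>C\<close> to the identity the determinant is a polynomial that equals \<open>1\<close> at the
  far end, so it has finitely many zeros, and invertible matrices accumulate at \<open>C\<close>.
\<close>

lemma continuous_zero_on_invertible:
  fixes F :: "complex^'n::finite^'n \<Rightarrow> complex"
  assumes cont: "continuous_on UNIV F" and zero: "\<And>C. det C \<noteq> 0 \<Longrightarrow> F C = 0"
  shows "F C = 0"
proof -
  define M where "M z = (\<chi> i j. C $ i $ j + z * ((if i = j then 1 else 0) - C $ i $ j))" for z
  define p where "p = (\<Sum>\<sigma>\<in>(perms::('n \<Rightarrow> 'n) set). of_int (sign \<sigma>) *
      (\<Prod>i\<in>UNIV. [:C $ i $ \<sigma> i, (if i = \<sigma> i then 1 else 0) - C $ i $ \<sigma> i:]))"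
  have p: "poly p z = det (M z)" for z
    by (simp add: p_def M_def det_def poly_sum poly_prod)
  have "M 1 = mat 1" by (simp add: M_def mat_def vec_eq_iff)
  then have "poly p 1 = 1" by (simp add: p)
  then have "finite {z. poly p z = 0}" by (intro poly_roots_finite) auto
  then have ev: "eventually (\<lambda>z. det (M z) \<noteq> 0) (at 0)"
    using islimpt_finite[of "{z. poly p z = 0}" 0] by (simp add: p islimpt_iff_eventually)
  have "continuous_on UNIV (\<lambda>z. F (M z))"
    unfolding M_def by (intro continuous_on_compose2[OF cont] continuous_intros) auto
  then have "((\<lambda>z. F (M z)) \<longlongrightarrow> F (M 0)) (at 0)"
    by (simp add: continuous_on_def)
  moreover have "((\<lambda>z. F (M z)) \<longlongrightarrow> 0) (at 0)"
    by (rule tendsto_eventually, rule eventually_mono[OF ev]) (simp add: zero)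
  ultimately have "F (M 0) = 0" using tendsto_unique[OF at_neq_bot] by blast
  moreover have "M 0 = C" by (simp add: M_def vec_eq_iff)
  ultimately show ?thesis by simp
qed

lemma continuous_eq_on_invertible:
  fixes F G :: "complex^'n::finite^'n \<Rightarrow> complex^'k::finite^'m::finite"
  assumes "\<And>i j. continuous_on UNIV (\<lambda>C. F C $ i $ j)" "\<And>i j. continuous_on UNIV (\<lambda>C. G C $ i $ j)"
    and "\<And>C. det C \<noteq> 0 \<Longrightarrow> F C = G C"
  shows "F C = G C"
proof -
  have "F C $ i $ j - G C $ i $ j = 0" for i j
    by (rule continuous_zero_on_invertible) (auto intro!: continuous_intros assms(1,2) simp: assms(3))
  then show ?thesis by (simp add: vec_eq_iff)
qed

lemma continuous_on_nth_nth: "continuous_on S (\<lambda>C::'a::topological_space^'n^'m. C $ i $ j)"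
  by (intro continuous_intros)

lemma continuous_on_det:
  fixes F :: "'a::topological_space \<Rightarrow> complex^'n::finite^'n"
  assumes "\<And>i j. continuous_on S (\<lambda>x. F x $ i $ j)"
  shows "continuous_on S (\<lambda>x. det (F x))"
  unfolding det_def by (intro continuous_intros assms)

lemma continuous_on_matrix_mult:
  fixes F :: "'a::topological_space \<Rightarrow> complex^'n::finite^'m" and G :: "'a \<Rightarrow> complex^'k^'n"
  assumes "\<And>i j. continuous_on S (\<lambda>x. F x $ i $ j)" "\<And>i j. continuous_on S (\<lambda>x. G x $ i $ j)"
  shows "continuous_on S (\<lambda>x. (F x ** G x) $ i $ j)"
  unfolding matrix_matrix_mult_def by (simp, intro continuous_intros assms)

lemma continuous_on_adj:
  fixes F :: "'a::topological_space \<Rightarrow> complex^'n::finite^'n"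
  assumes "\<And>i j. continuous_on S (\<lambda>x. F x $ i $ j)"
  shows "continuous_on S (\<lambda>x. adj (F x) $ i $ j)"
  unfolding adj_expansion by (intro continuous_intros assms)

lemma continuous_on_entry_add:
  fixes F G :: "'a::topological_space \<Rightarrow> complex^'n^'m"
  shows "(\<And>i j. continuous_on S (\<lambda>x. F x $ i $ j)) \<Longrightarrow> (\<And>i j. continuous_on S (\<lambda>x. G x $ i $ j))
    \<Longrightarrow> continuous_on S (\<lambda>x. (F x + G x) $ i $ j)"
  by (simp add: continuous_on_add)

lemma continuous_on_entry_diff:
  fixes F G :: "'a::topological_space \<Rightarrow> complex^'n^'m"
  shows "(\<And>i j. continuous_on S (\<lambda>x. F x $ i $ j)) \<Longrightarrow> (\<And>i j. continuous_on S (\<lambda>x. G x $ i $ j))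
    \<Longrightarrow> continuous_on S (\<lambda>x. (F x - G x) $ i $ j)"
  by (simp add: continuous_on_diff)

lemmas continuous_entries = continuous_on_matrix_mult continuous_on_adj continuous_on_nth_nth
  continuous_on_entry_add continuous_on_entry_diff continuous_on_const

lemma smooth_on_adj:
  fixes F :: "'a::real_normed_vector \<Rightarrow> complex^'n::finite^'n"
  assumes "open S" "\<And>i j. smooth_on S (\<lambda>x. F x $ i $ j)"
  shows "smooth_on S (\<lambda>x. adj (F x) $ b $ a)"
  unfolding adj_expansion by (intro smooth_intros assms)

lemma adj_mult: "adj C ** C = mat (det (C::complex^'n::finite^'n))"
proof (rule continuous_eq_on_invertible[where F = "\<lambda>C. adj C ** C" and G = "\<lambda>C. mat (det C)"])
  fix C :: "complex^'n^'n" assume "det C \<noteq> 0"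
  then obtain D where D: "C ** D = mat 1" "D ** C = mat 1" by (rule inverse_matrix_exists)
  show "adj C ** C = mat (det C)"
    by (simp add: adj_eq_inverse[OF D(1)] matrix_mul_assoc[symmetric] D(2))
next
  show "continuous_on UNIV (\<lambda>C::complex^'n^'n. mat (det C) $ i $ j)" for i j :: 'n
    by (cases "i = j") (auto simp: mat_def intro!: continuous_on_det continuous_intros)
qed (intro continuous_entries)

text \<open>
  For invertible \<open>C\<close> this is the formula for the inverse of a product.
\<close>

lemma adj_congruence:
  fixes A B C :: "complex^'n::finite^'n"
  assumes "det A \<noteq> 0" "det B \<noteq> 0"
  shows "B ** adj (A ** C ** B) ** A = mat (det A * det B) ** adj C"
proof (rule continuous_eq_on_invertible[where F = "\<lambda>C. B ** adj (A ** C ** B) ** A"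
      and G = "\<lambda>C. mat (det A * det B) ** adj C"])
  fix C :: "complex^'n^'n" assume "det C \<noteq> 0"
  then obtain D where D: "C ** D = mat 1" by (rule inverse_matrix_exists)
  obtain A' where A: "A ** A' = mat 1" "A' ** A = mat 1" using assms inverse_matrix_exists by metis
  obtain B' where B: "B ** B' = mat 1" "B' ** B = mat 1" using assms inverse_matrix_exists by metis
  have "(A ** C ** B) ** (B' ** D ** A') = A ** (C ** (B ** B') ** D) ** A'"
    by (simp add: matrix_mul_assoc)
  also have "\<dots> = mat 1" by (simp add: A B D)
  finally have "adj (A ** C ** B) = mat (det (A ** C ** B)) ** (B' ** D ** A')"
    by (rule adj_eq_inverse)
  then have "B ** adj (A ** C ** B) ** A = mat (det (A ** C ** B)) ** ((B ** B') ** D ** (A' ** A))"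
    by (simp add: matrix_mul_assoc mult_mat)
  then show "B ** adj (A ** C ** B) ** A = mat (det A * det B) ** adj C"
    by (simp add: A B adj_eq_inverse[OF D] mat_mult_mat_assoc det_mul mult_ac)
qed (intro continuous_entries)+

text \<open>
  Here \<open>M\<close> is the conjugate of \<open>L\<close> by \<open>h\<close>, and adjugates are compatible with conjugation. This covers
  singular \<open>L\<close>, whose adjugate is not a multiple of an inverse.
\<close>

lemma adj_intertwine:
  fixes h L M :: "complex^'n::finite^'n"
  assumes "det h \<noteq> 0" "M ** h = h ** L"
  shows "adj M ** h = h ** adj L"
proof -
  obtain k where k: "h ** k = mat 1" "k ** h = mat 1" using assms inverse_matrix_exists by metis
  have "det h * det k = 1" using k by (metis det_I det_mul)
  then have dk: "det k \<noteq> 0" "det h * det k = 1" by auto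
  have "M = h ** L ** k" using assms k by (metis matrix_mul_assoc matrix_mul_rid)
  then have "k ** adj M ** h = adj L" using adj_congruence[OF assms(1) dk(1), of L] dk(2) by simp
  then have "h ** adj L = h ** (k ** adj M ** h)" by simp
  also have "\<dots> = (h ** k) ** adj M ** h" by (simp add: matrix_mul_assoc)
  finally show ?thesis using k by simp
qed

text \<open>
  If \<open>A\<close> is invertible, its adjugate is a multiple of \<open>A\<^sup>-\<^sup>1\<close>. The matrix \<open>A + c\<close> commutes with its
  adjugate, so \<open>A\<close> and \<open>A\<^sup>-\<^sup>1\<close> commute with that adjugate too.
\<close>

lemma adj_shift_commute:
  "adj (L - mat s) ** adj (L - mat t) = adj (L - mat t) ** adj ((L::complex^'n::finite^'n) - mat s)"
proof -
  define c where "c = s - t"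
  have "adj A ** adj (A + mat c) = adj (A + mat c) ** adj A" for A :: "complex^'n^'n"
  proof (rule continuous_eq_on_invertible[where F = "\<lambda>A. adj A ** adj (A + mat c)"
        and G = "\<lambda>A. adj (A + mat c) ** adj A"])
    fix A :: "complex^'n^'n" assume "det A \<noteq> 0"
    then obtain D where D: "A ** D = mat 1" "D ** A = mat 1" by (rule inverse_matrix_exists)
    have "(A + mat c) ** adj (A + mat c) = adj (A + mat c) ** (A + mat c)"
      by (simp add: mult_adj adj_mult)
    then have "A ** adj (A + mat c) = adj (A + mat c) ** A"
      by (simp add: matrix_add_ldistrib matrix_add_rdistrib mult_mat)
    then have "D ** (A ** adj (A + mat c)) ** D = D ** (adj (A + mat c) ** A) ** D" by simp
    then have "D ** A ** (adj (A + mat c) ** D) = D ** adj (A + mat c) ** (A ** D)"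
      by (simp add: matrix_mul_assoc)
    then have "adj (A + mat c) ** D = D ** adj (A + mat c)" by (simp add: D)
    then show "adj A ** adj (A + mat c) = adj (A + mat c) ** adj A"
      by (simp add: adj_eq_inverse[OF D(1)] mult_mat_left matrix_mul_assoc[symmetric])
  qed (intro continuous_entries)+
  moreover have "L - mat s + mat c = L - mat t" by (simp add: c_def mat_def vec_eq_iff)
  ultimately show ?thesis by metis
qed

subsection \<open>The derivative of the adjugate\<close>

text \<open>The directional derivative of \<^const>\<open>H_tensor\<close> at \<open>C\<close> along \<open>E\<close>.\<close>

definition dadj :: "complex^'n::finite^'n \<Rightarrow> complex^'n^'n \<Rightarrow> complex^'n^'n" where
  "dadj C E = (\<chi> b a. \<Sum>p | p \<in> perms \<and> p a = b. of_int (sign p) *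
     (\<Sum>i\<in>UNIV - {a}. E $ i $ p i * (\<Prod>j\<in>UNIV - {a} - {i}. C $ j $ p j)))"

definition pd_mat :: "'n::finite idx \<Rightarrow> (complex^'n \<Rightarrow> complex^'k^'m) \<Rightarrow> complex^'n \<Rightarrow> complex^'k^'m" where
  "pd_mat \<alpha> F x = (\<chi> i j. pd \<alpha> (\<lambda>y. F y $ i $ j) x)"

lemma pd_mat_nth [simp]: "pd_mat \<alpha> F x $ i $ j = pd \<alpha> (\<lambda>y. F y $ i $ j) x"
  by (simp add: pd_mat_def)

lemma differentiable_det:
  fixes C :: "'a::real_normed_vector \<Rightarrow> complex^'n::finite^'n"
  assumes "\<And>i j. (\<lambda>y. C y $ i $ j) differentiable (at x)"
  shows "(\<lambda>y. det (C y)) differentiable (at x)"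
  unfolding det_def using assms
  by (intro differentiable_sum differentiable_mult differentiable_const ballI differentiable_prod) (auto intro: finite_perms)

lemma differentiable_adj:
  fixes C :: "'a::real_normed_vector \<Rightarrow> complex^'n::finite^'n"
  assumes "\<And>i j. (\<lambda>y. C y $ i $ j) differentiable (at x)"
  shows "(\<lambda>y. adj (C y) $ b $ a) differentiable (at x)"
  unfolding adj_expansion using assms
  by (intro differentiable_sum differentiable_mult differentiable_const ballI differentiable_prod) (auto intro: finite_perms)

lemma pd_adj:
  fixes C :: "complex^'k::finite \<Rightarrow> complex^'n::finite^'n"
  assumes "\<And>i j. (\<lambda>y. C y $ i $ j) differentiable (at x)"
  shows "pd \<alpha> (\<lambda>y. adj (C y) $ b $ a) x = dadj (C x) (pd_mat \<alpha> C x) $ b $ a"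
  unfolding adj_expansion dadj_def using assms
  by (simp add: pd_sum pd_cmult pd_prod differentiable_prod)

lemma pd_det:
  fixes C :: "complex^'k::finite \<Rightarrow> complex^'n::finite^'n"
  assumes "\<And>i j. (\<lambda>y. C y $ i $ j) differentiable (at x)"
  shows "pd \<alpha> (\<lambda>y. det (C y)) x = trace (pd_mat \<alpha> C x ** adj (C x))"
proof -
  let ?E = "pd_mat \<alpha> C x"
  let ?t = "\<lambda>i p. of_int (sign p) * (\<Prod>j\<in>UNIV - {i}. C x $ j $ p j)"
  have "pd \<alpha> (\<lambda>y. det (C y)) x = (\<Sum>p\<in>perms. of_int (sign p) *
      (\<Sum>i\<in>UNIV. ?E $ i $ p i * (\<Prod>j\<in>UNIV - {i}. C x $ j $ p j)))"
    unfolding det_def using assms by (simp add: pd_sum pd_cmult pd_prod differentiable_prod)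
  also have "\<dots> = (\<Sum>i\<in>UNIV. \<Sum>p\<in>perms. ?E $ i $ p i * ?t i p)"
    by (subst sum.swap) (simp add: sum_distrib_left mult.left_commute)
  also have "\<dots> = (\<Sum>i\<in>UNIV. \<Sum>k\<in>UNIV. \<Sum>p | p \<in> perms \<and> p i = k. ?E $ i $ p i * ?t i p)"
  proof (rule sum.cong[OF refl])
    fix i :: 'n
    show "(\<Sum>p\<in>perms. ?E $ i $ p i * ?t i p) = (\<Sum>k\<in>UNIV. \<Sum>p | p \<in> perms \<and> p i = k. ?E $ i $ p i * ?t i p)"
      using sum.group[OF finite_perms, of UNIV "\<lambda>p. p i" "\<lambda>p. ?E $ i $ p i * ?t i p"] by simp
  qed
  also have "\<dots> = (\<Sum>i\<in>UNIV. \<Sum>k\<in>UNIV. ?E $ i $ k * adj (C x) $ k $ i)"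
    by (intro sum.cong[OF refl]) (simp add: adj_expansion sum_distrib_left)
  finally show ?thesis by (simp add: trace_def matrix_matrix_mult_def)
qed

lemma dadj_add: "dadj C (E + F) = dadj C E + dadj C F"
  by (simp add: dadj_def vec_eq_iff sum.distrib distrib_right distrib_left)

lemma dadj_mat_mult: "dadj C (mat c ** E) = mat c ** dadj C E"
  by (simp add: vec_eq_iff) (simp add: dadj_def sum_distrib_left mult_ac)

lemma dadj_uminus: "dadj C (- E) = - dadj C E"
  by (simp add: dadj_def vec_eq_iff sum_negf)

lemma dadj_diff: "dadj C (E - F) = dadj C E - dadj C F"
  using dadj_add[of C E "- F"] by (simp add: dadj_uminus)

lemma dadj_sum: "dadj C (\<Sum>i\<in>I. E i) = (\<Sum>i\<in>I. dadj C (E i))"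
proof (induction I rule: infinite_finite_induct)
  case empty
  then show ?case using dadj_mat_mult[of C 0 0] by (simp add: vec_eq_iff)
qed (use dadj_mat_mult[of C 0 0] in \<open>auto simp: dadj_add vec_eq_iff\<close>)

lemma continuous_on_dadj:
  fixes F :: "'a::topological_space \<Rightarrow> complex^'n::finite^'n"
  assumes "\<And>i j. continuous_on S (\<lambda>x. F x $ i $ j)" "\<And>i j. continuous_on S (\<lambda>x. E x $ i $ j)"
  shows "continuous_on S (\<lambda>x. dadj (F x) (E x) $ i $ j)"
  unfolding dadj_def by (simp, intro continuous_intros assms)

lemma pd_mat_mult:
  fixes F G :: "complex^'k::finite \<Rightarrow> complex^'n::finite^'n"
  assumes "\<And>i j. (\<lambda>y. F y $ i $ j) differentiable (at x)" "\<And>i j. (\<lambda>y. G y $ i $ j) differentiable (at x)"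
  shows "pd_mat \<alpha> (\<lambda>y. F y ** G y) x = pd_mat \<alpha> F x ** G x + F x ** pd_mat \<alpha> G x"
  using assms by (simp add: vec_eq_iff matrix_matrix_mult_def pd_sum pd_mult sum.distrib)

lemma pd_coordinate: "pd (Inl k) (\<lambda>y. y $ k) x = 1" "(\<lambda>y::complex^'k::finite. y $ k) differentiable (at x)"
proof -
  have d: "((\<lambda>y. y $ k) has_derivative (\<lambda>v::complex^'k. v $ k)) (at x)"
    using bounded_linear_vec_nth by (rule bounded_linear_imp_has_derivative)
  show "pd (Inl k) (\<lambda>y. y $ k) x = 1" by (simp add: pd_eqI[OF d])
  show "(\<lambda>y::complex^'k::finite. y $ k) differentiable (at x)" using d by (auto simp: differentiable_def)
qed

text \<open>
  The product rule for \<open>C adj C = det C\<close>, along a line in the direction of \<open>E\<close> that is parametrised by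
  one of the coordinates.
\<close>

lemma dadj_product_rule:
  "E ** adj C + C ** dadj C E = mat (trace (E ** adj (C::complex^'n::finite^'n)))"
proof -
  define k :: 'n where "k = undefined"
  define c where "c y = (\<chi> i j. C $ i $ j + y $ k * E $ i $ j)" for y :: "complex^'n"
  have dc: "(\<lambda>y. c y $ i $ j) differentiable (at 0)" for i j
    by (simp add: c_def pd_coordinate(2))
  have c0: "c 0 = C" by (simp add: c_def vec_eq_iff)
  have E: "pd_mat (Inl k) c 0 = E"
    unfolding vec_eq_iff pd_mat_nth c_def
    by (simp add: pd_add pd_mult pd_coordinate)
  have a: "pd_mat (Inl k) (\<lambda>y. adj (c y)) 0 = dadj C E"
    by (simp add: vec_eq_iff pd_adj[OF dc] c0 E)
  have "pd_mat (Inl k) (\<lambda>y. c y ** adj (c y)) 0 = E ** adj C + C ** dadj C E"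
    by (simp add: pd_mat_mult dc differentiable_adj a c0 E)
  moreover have "pd_mat (Inl k) (\<lambda>y. c y ** adj (c y)) 0 = mat (trace (E ** adj C))"
    using pd_det[OF dc, of "Inl k"] by (simp add: mult_adj vec_eq_iff c0 E) (simp add: mat_def)
  ultimately show ?thesis by simp
qed

lemma dadj_invertible:
  assumes "(C::complex^'n::finite^'n) ** D = mat 1"
  shows "dadj C E = mat (det C) ** (mat (trace (E ** D)) ** D - D ** E ** D)"
proof -
  have D: "D ** C = mat 1" using assms matrix_left_right_inverse by blast
  have "C ** dadj C E = mat (trace (E ** adj C)) - E ** adj C"
    using dadj_product_rule[of E C] by (simp add: algebra_simps)
  moreover have "dadj C E = D ** (C ** dadj C E)" by (simp add: matrix_mul_assoc D)
  ultimately have "dadj C E = mat (trace (E ** adj C)) ** D - D ** (E ** adj C)"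
    by (simp only: matrix_sub_ldistrib mult_mat[of D])
  moreover have "E ** adj C = mat (det C) ** (E ** D)"
    by (simp only: adj_eq_inverse[OF assms] mult_mat_left[of E])
  ultimately have "dadj C E = mat (det C * trace (E ** D)) ** D - mat (det C) ** (D ** (E ** D))"
    by (simp only: trace_mat_mult mult_mat_left[of D])
  also have "D ** (E ** D) = D ** E ** D" by (rule matrix_mul_assoc)
  finally show ?thesis by (simp add: vec_eq_iff algebra_simps)
qed

lemma dadj_right: "dadj C (C ** M) = mat (trace M) ** adj C - M ** adj (C::complex^'n::finite^'n)"
proof (rule continuous_eq_on_invertible[where F = "\<lambda>C. dadj C (C ** M)"
      and G = "\<lambda>C. mat (trace M) ** adj C - M ** adj C"])
  fix C :: "complex^'n^'n" assume "det C \<noteq> 0"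
  then obtain D where D: "C ** D = mat 1" "D ** C = mat 1" by (rule inverse_matrix_exists)
  have "trace (C ** M ** D) = trace M"
    using trace_mul_sym[of "C ** M" D] by (simp add: matrix_mul_assoc D)
  moreover have "D ** (C ** M) ** D = M ** D" by (simp add: matrix_mul_assoc D)
  ultimately have "dadj C (C ** M) = mat (det C) ** (mat (trace M) ** D - M ** D)"
    by (simp only: dadj_invertible[OF D(1)])
  then show "dadj C (C ** M) = mat (trace M) ** adj C - M ** adj C"
    by (simp add: adj_eq_inverse[OF D(1)] mult_mat_left[of M] vec_eq_iff algebra_simps)
qed (intro continuous_entries continuous_on_dadj)+

lemma dadj_left: "dadj C (N ** C) = mat (trace N) ** adj C - adj (C::complex^'n::finite^'n) ** N"
proof (rule continuous_eq_on_invertible[where F = "\<lambda>C. dadj C (N ** C)"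
      and G = "\<lambda>C. mat (trace N) ** adj C - adj C ** N"])
  fix C :: "complex^'n^'n" assume "det C \<noteq> 0"
  then obtain D where D: "C ** D = mat 1" "D ** C = mat 1" by (rule inverse_matrix_exists)
  have "N ** C ** D = N" "D ** (N ** C) ** D = D ** N" by (simp_all add: matrix_mul_assoc[symmetric] D)
  then have "dadj C (N ** C) = mat (det C) ** (mat (trace N) ** D - D ** N)"
    by (simp only: dadj_invertible[OF D(1)])
  then show "dadj C (N ** C) = mat (trace N) ** adj C - adj C ** N"
    by (simp add: adj_eq_inverse[OF D(1)] matrix_mul_assoc[symmetric] vec_eq_iff algebra_simps)
qed (intro continuous_entries continuous_on_dadj)+

lemma dadj_self: "dadj C C = mat (of_nat CARD('n) - 1) ** adj (C::complex^'n::finite^'n)"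
  using dadj_right[of C "mat 1"] by (simp add: trace_I vec_eq_iff algebra_simps)

definition outer :: "complex^'m::finite \<Rightarrow> complex^'n::finite \<Rightarrow> complex^'n^'m" where
  "outer u v = (\<chi> i j. u $ i * v $ j)"

lemma outer_nth [simp]: "outer u v $ i $ j = u $ i * v $ j"
  by (simp add: outer_def)

lemma trace_outer_mult: "trace (outer u v ** D) = (\<Sum>i\<in>UNIV. v $ i * (D *v u) $ i)"
proof -
  have "trace (outer u v ** D) = (\<Sum>i\<in>UNIV. \<Sum>k\<in>UNIV. v $ k * (D $ k $ i * u $ i))"
    by (simp add: trace_def matrix_matrix_mult_def mult_ac)
  also have "\<dots> = (\<Sum>k\<in>UNIV. v $ k * (D *v u) $ k)"
    by (subst sum.swap) (simp add: matrix_vector_mult_def sum_distrib_left)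
  finally show ?thesis .
qed

lemma mult_outer_mult: "A ** outer u v ** B = outer (A *v u) (v v* B)"
  by (simp add: vec_eq_iff matrix_matrix_mult_def matrix_vector_mult_def vector_matrix_mult_def
      sum_distrib_left sum_distrib_right mult_ac, intro allI, rule sum.swap)

text \<open>
  A rank one change \<open>C + s u v\<^sup>T\<close> adds multiples of \<open>u\<close> to the columns of \<open>C\<close>, and by Cramer's
  rule \<open>adj C u\<close> consists of determinants of \<open>C\<close> with a column replaced by \<open>u\<close>; so \<open>adj C u\<close>
  does not change.
\<close>

lemma dadj_outer_mult_vec:
  fixes C :: "complex^'n::finite^'n"
  shows "dadj C (outer u v) *v u = 0"
proof -
  have "dadj C (outer u v) ** outer u u = 0" for C
  proof (rule continuous_eq_on_invertible[where F = "\<lambda>C. dadj C (outer u v) ** outer u u" and G = "\<lambda>_. 0"])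
    fix C :: "complex^'n^'n" assume "det C \<noteq> 0"
    then obtain D where D: "C ** D = mat 1" "D ** C = mat 1" by (rule inverse_matrix_exists)
    have s: "(\<Sum>x\<in>UNIV. (v v* D) $ x * u $ x) = (\<Sum>i\<in>UNIV. v $ i * (D *v u) $ i)"
      unfolding matrix_vector_mult_def vector_matrix_mult_def
      by (simp add: sum_distrib_left sum_distrib_right mult_ac, subst sum.swap, simp)
    have "(\<Sum>k\<in>UNIV. dadj C (outer u v) $ i $ k * u $ k) = 0" for i
    proof -
      have "(\<Sum>k\<in>UNIV. dadj C (outer u v) $ i $ k * u $ k)
          = det C * (trace (outer u v ** D) * (\<Sum>k\<in>UNIV. D $ i $ k * u $ k)
             - (D *v u) $ i * (\<Sum>k\<in>UNIV. (v v* D) $ k * u $ k))"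
        by (simp add: dadj_invertible[OF D(1)] mult_outer_mult algebra_simps sum_subtractf sum_distrib_left)
      also have "\<dots> = 0" unfolding s trace_outer_mult by (simp add: matrix_vector_mult_def)
      finally show ?thesis .
    qed
    then show "dadj C (outer u v) ** outer u u = 0"
      by (simp add: vec_eq_iff matrix_matrix_mult_def sum_distrib_right[symmetric] mult.assoc[symmetric])
  qed (intro continuous_entries continuous_on_dadj)+
  then have z: "(\<Sum>k\<in>UNIV. dadj C (outer u v) $ i $ k * u $ k) * u $ j = 0" for i j
    by (simp add: vec_eq_iff matrix_matrix_mult_def sum_distrib_right mult.assoc)
  show ?thesis
  proof (cases "u = 0")
    case False
    then obtain j where "u $ j \<noteq> 0" by (auto simp: vec_eq_iff)
    then show ?thesis using z[of _ j] by (simp add: vec_eq_iff matrix_vector_mult_def)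
  qed simp
qed

text \<open>
  Row \<open>a\<close> of the adjugate consists of minors that omit column \<open>a\<close> of \<open>C\<close>, so it is unaffected by
  changes of that column. This is the case \<open>a = b\<close>, from which the general one follows by
  polarisation.
\<close>

lemma dadj_outer_antisym:
  fixes C :: "complex^'n::finite^'n"
  shows "dadj C (outer u (axis a 1)) $ b $ e + dadj C (outer u (axis b 1)) $ a $ e = 0"
proof (rule continuous_zero_on_invertible[where F = "\<lambda>C. dadj C (outer u (axis a 1)) $ b $ e
      + dadj C (outer u (axis b 1)) $ a $ e"])
  fix C :: "complex^'n^'n" assume "det C \<noteq> 0"
  then obtain D where D: "C ** D = mat 1" "D ** C = mat 1" by (rule inverse_matrix_exists)
  have ax: "(\<Sum>i\<in>UNIV. axis c 1 $ i * w $ i) = w $ c" for c and w :: "complex^'n"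
    by (simp add: axis_def if_distrib[of "\<lambda>x. x * _"] cong: if_cong)
  have ax': "(axis c 1 v* D) $ i = D $ c $ i" for c i
    by (simp add: vector_matrix_mult_def axis_def if_distrib[of "\<lambda>x. x * _"] if_distrib[of "\<lambda>x. _ * x"] cong: if_cong)
  show "dadj C (outer u (axis a 1)) $ b $ e + dadj C (outer u (axis b 1)) $ a $ e = 0"
    by (simp add: dadj_invertible[OF D(1)] mult_outer_mult trace_outer_mult ax ax' algebra_simps)
qed (intro continuous_on_dadj continuous_on_add continuous_entries)

section \<open>The pencil in a chart\<close>

subsection \<open>Differentiating along a tangent vector\<close>

text \<open>
  The \<open>k \<gamma>\<close> are the components of a vector at the point \<open>x\<close> only. With the components of a vector
  field at \<open>x\<close> this gives the part of the Lie derivative that differentiates \<open>f\<close>, and with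
  \<open>kron \<alpha>\<close> the partial derivatives.
\<close>

definition along :: "('n::finite idx \<Rightarrow> complex) \<Rightarrow> (complex^'n \<Rightarrow> complex) \<Rightarrow> complex^'n \<Rightarrow> complex" where
  "along k f x = (\<Sum>\<gamma>\<in>UNIV. k \<gamma> * pd \<gamma> f x)"

definition along_mat :: "('n::finite idx \<Rightarrow> complex) \<Rightarrow> (complex^'n \<Rightarrow> complex^'m^'l) \<Rightarrow> complex^'n \<Rightarrow> complex^'m^'l" where
  "along_mat k F x = (\<chi> i j. along k (\<lambda>y. F y $ i $ j) x)"

lemma of_nat_plus_one_neq_0: "of_nat n + 1 \<noteq> (0::complex)"
  by (metis of_nat_1 of_nat_add of_nat_eq_0_iff add_eq_0_iff_both_eq_0 one_neq_zero)

lemma along_mat_nth [simp]: "along_mat k F x $ i $ j = along k (\<lambda>y. F y $ i $ j) x"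
  by (simp add: along_mat_def)

lemma along_mat_sum: "along_mat k F x = (\<Sum>\<gamma>\<in>UNIV. mat (k \<gamma>) ** pd_mat \<gamma> F x)"
  by (simp add: vec_eq_iff along_def)

lemma along_kron: "along (kron \<alpha>) f x = pd \<alpha> f x"
  by (simp add: along_def kron_def if_distrib[of "\<lambda>x. x * _"] cong: if_cong)

lemma along_mat_kron: "along_mat (kron \<alpha>) F x = pd_mat \<alpha> F x"
  by (simp add: vec_eq_iff along_kron)

lemma along_const [simp]: "along k (\<lambda>y. c) x = 0"
  by (simp add: along_def)

lemma along_cong_open:
  "open S \<Longrightarrow> x \<in> S \<Longrightarrow> (\<And>y. y \<in> S \<Longrightarrow> f y = g y) \<Longrightarrow> along k f x = along k g x"
  unfolding along_def by (intro sum.cong refl arg_cong2[where f = "(*)"] pd_cong_open)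

lemma along_mat_cong_open:
  "open S \<Longrightarrow> x \<in> S \<Longrightarrow> (\<And>y. y \<in> S \<Longrightarrow> F y = G y) \<Longrightarrow> along_mat k F x = along_mat k G x"
  unfolding vec_eq_iff along_mat_nth by (intro allI, rule along_cong_open) auto

lemma pd_mat_cong_open:
  "open S \<Longrightarrow> x \<in> S \<Longrightarrow> (\<And>y. y \<in> S \<Longrightarrow> F y = G y) \<Longrightarrow> pd_mat \<alpha> F x = pd_mat \<alpha> G x"
  using along_mat_cong_open[of S x F G "kron \<alpha>"] by (simp add: along_mat_kron)

lemma along_mult:
  assumes "f differentiable (at x)" "g differentiable (at x)"
  shows "along k (\<lambda>y. f y * g y) x = along k f x * g x + f x * along k g x"
  by (simp add: along_def pd_mult[OF assms] sum.distrib sum_distrib_left sum_distrib_right algebra_simps)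

lemma along_diff:
  assumes "f differentiable (at x)" "g differentiable (at x)"
  shows "along k (\<lambda>y. f y - g y) x = along k f x - along k g x"
  by (simp add: along_def pd_diff[OF assms] sum_subtractf algebra_simps)

lemma along_mat_mult:
  fixes F G :: "complex^'k::finite \<Rightarrow> complex^'n::finite^'n"
  assumes "\<And>i j. (\<lambda>y. F y $ i $ j) differentiable (at x)" "\<And>i j. (\<lambda>y. G y $ i $ j) differentiable (at x)"
  shows "along_mat k (\<lambda>y. F y ** G y) x = along_mat k F x ** G x + F x ** along_mat k G x"
proof -
  have "pd_mat \<gamma> (\<lambda>y. F y ** G y) x $ i $ j = (pd_mat \<gamma> F x ** G x + F x ** pd_mat \<gamma> G x) $ i $ j" for \<gamma> i j
    by (simp add: pd_mat_mult assms)
  then show ?thesis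
    by (simp add: vec_eq_iff along_def matrix_matrix_mult_def sum_distrib_left sum_distrib_right sum.distrib
        distrib_left mult_ac sum.swap[of _ "UNIV :: 'k idx set"])
qed

lemma along_det:
  fixes C :: "complex^'k::finite \<Rightarrow> complex^'n::finite^'n"
  assumes "\<And>i j. (\<lambda>y. C y $ i $ j) differentiable (at x)"
  shows "along k (\<lambda>y. det (C y)) x = trace (along_mat k C x ** adj (C x))"
proof -
  have "along k (\<lambda>y. det (C y)) x = (\<Sum>\<gamma>\<in>UNIV. trace (mat (k \<gamma>) ** pd_mat \<gamma> C x ** adj (C x)))"
    unfolding along_def pd_det[OF assms]
    by (simp add: matrix_mul_assoc[symmetric] trace_mat_mult)
  also have "\<dots> = trace ((\<Sum>\<gamma>\<in>UNIV. mat (k \<gamma>) ** pd_mat \<gamma> C x) ** adj (C x))"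
    by (simp add: trace_def matrix_matrix_mult_def sum_distrib_right sum.swap[of _ "UNIV :: 'k idx set"])
  finally show ?thesis by (simp add: along_mat_sum)
qed

lemma along_adj:
  fixes C :: "complex^'k::finite \<Rightarrow> complex^'n::finite^'n"
  assumes "\<And>i j. (\<lambda>y. C y $ i $ j) differentiable (at x)"
  shows "along k (\<lambda>y. adj (C y) $ b $ a) x = dadj (C x) (along_mat k C x) $ b $ a"
  by (simp add: along_def pd_adj[OF assms] along_mat_sum dadj_sum dadj_mat_mult)

text \<open>
  A density weighted tensor \<open>\<eta>\<close> and the metric \<open>h\<close> with inverse \<open>(det \<eta>) \<eta>\<close> determine each
  other, hence so do their derivatives. The unknown derivative of \<open>det \<eta>\<close> is found by taking the
  trace: it enters \<open>n\<close> times through \<open>\<eta>\<close> and once through the density.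
\<close>

lemma along_weighted_inverse:
  fixes h \<eta> :: "complex^'n::finite \<Rightarrow> complex^'n^'n"
  assumes S: "open S" "x \<in> S"
    and d\<eta>: "\<And>i j. (\<lambda>y. \<eta> y $ i $ j) differentiable (at x)"
    and dh: "\<And>i j. (\<lambda>y. h y $ i $ j) differentiable (at x)"
    and inv: "\<And>y. y \<in> S \<Longrightarrow> h y ** (mat (det (\<eta> y)) ** \<eta> y) = mat 1"
    and h: "along_mat k h x = - (M ** h x) - h x ** N"
  defines "\<delta> \<equiv> (trace M + trace N) / (of_nat CARD('n) + 1)"
  shows "along_mat k \<eta> x = \<eta> x ** M + N ** \<eta> x - mat \<delta> ** \<eta> x"
    and "along k (\<lambda>y. det (\<eta> y)) x = \<delta> * det (\<eta> x)"
proof -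
  let ?\<tau> = "\<lambda>y. det (\<eta> y)" and ?P = "\<lambda>y. mat (det (\<eta> y)) ** \<eta> y"
  \<comment> \<open>the logarithmic derivative of the density, unknown until the trace is taken\<close>
  define \<theta> where "\<theta> = along k ?\<tau> x / ?\<tau> x"
  have d\<tau>: "?\<tau> differentiable (at x)" by (rule differentiable_det[OF d\<eta>])
  have dP: "(\<lambda>y. ?P y $ i $ j) differentiable (at x)" for i j
    using d\<tau> d\<eta> by simp
  have 1: "h x ** ?P x = mat 1" by (rule inv[OF S(2)])
  then have 2: "?P x ** h x = mat 1" using matrix_left_right_inverse by blast
  have "det (h x) * det (?P x) = 1" using 1 by (metis det_I det_mul)
  then have \<tau>0: "?\<tau> x \<noteq> 0" by (auto simp: det_mat_mult)
  have "along_mat k (\<lambda>y. h y ** ?P y) x = along_mat k (\<lambda>y. mat 1) x"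
    by (rule along_mat_cong_open[OF S inv])
  then have "along_mat k h x ** ?P x + h x ** along_mat k ?P x = 0"
    by (simp add: along_mat_mult[OF dh dP]) (simp add: vec_eq_iff)
  then have "h x ** along_mat k ?P x = - (along_mat k h x ** ?P x)" by (simp add: eq_neg_iff_add_eq_0 add.commute)
  also have "\<dots> = M ** (h x ** ?P x) + h x ** N ** ?P x"
    unfolding h by (simp only: matrix_minus_left matrix_sub_rdistrib matrix_mul_assoc) simp
  also have "\<dots> = M + h x ** N ** ?P x" by (simp only: 1 matrix_mul_rid)
  finally have "?P x ** (h x ** along_mat k ?P x) = ?P x ** (M + h x ** N ** ?P x)" by (rule arg_cong)
  then have "?P x ** h x ** along_mat k ?P x = ?P x ** M + ?P x ** h x ** N ** ?P x"
    by (simp only: matrix_mul_assoc matrix_add_ldistrib)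
  then have Pd: "along_mat k ?P x = ?P x ** M + N ** ?P x" by (simp only: 2 matrix_mul_lid)
  have "along_mat k ?P x = mat (along k ?\<tau> x) ** \<eta> x + mat (?\<tau> x) ** along_mat k \<eta> x"
    by (simp add: vec_eq_iff along_mult[OF d\<tau> d\<eta>])
  then have "mat (?\<tau> x) ** along_mat k \<eta> x = mat (?\<tau> x) ** (\<eta> x ** M) + mat (?\<tau> x) ** (N ** \<eta> x)
      - mat (?\<tau> x) ** (mat \<theta> ** \<eta> x)"
    using Pd \<tau>0 by (simp add: matrix_mul_assoc[symmetric] mult_mat_left[of N] mat_mult_mat_assoc \<theta>_def algebra_simps)
  then have "mat (?\<tau> x) ** along_mat k \<eta> x = mat (?\<tau> x) ** (\<eta> x ** M + N ** \<eta> x - mat \<theta> ** \<eta> x)"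
    by (simp only: matrix_add_ldistrib matrix_sub_ldistrib)
  then have e: "along_mat k \<eta> x = \<eta> x ** M + N ** \<eta> x - mat \<theta> ** \<eta> x"
    using \<tau>0 mat_mult_left_cancel by blast
  obtain D where D: "\<eta> x ** D = mat 1" "D ** \<eta> x = mat 1" using \<tau>0 by (rule inverse_matrix_exists)
  have "along k ?\<tau> x = trace (along_mat k \<eta> x ** adj (\<eta> x))" by (rule along_det[OF d\<eta>])
  also have "\<dots> = ?\<tau> x * trace (along_mat k \<eta> x ** D)"
    by (simp only: adj_eq_inverse[OF D(1)] mult_mat_left[of "along_mat k \<eta> x"] trace_mat_mult)
  also have "along_mat k \<eta> x ** D = \<eta> x ** M ** D + N - mat \<theta>"
    unfolding e by (simp only: matrix_add_rdistrib matrix_sub_rdistrib matrix_mul_assoc[symmetric] D matrix_mul_rid)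
  also have "trace \<dots> = trace M + trace N - \<theta> * of_nat CARD('n)"
  proof -
    have "trace (\<eta> x ** M ** D) = trace M"
      using trace_mul_sym[of "\<eta> x ** M" D] by (simp add: matrix_mul_assoc D)
    moreover have "trace (mat \<theta> :: complex^'n^'n) = \<theta> * of_nat CARD('n)"
      using trace_mat_mult[of \<theta> "mat 1 :: complex^'n^'n"] by (simp add: trace_I)
    ultimately show ?thesis by (simp add: trace_add trace_sub)
  qed
  finally have "along k ?\<tau> x / ?\<tau> x = trace M + trace N - \<theta> * of_nat CARD('n)"
    using \<tau>0 by simp
  then have "\<theta> = trace M + trace N - \<theta> * of_nat CARD('n)" by (simp only: \<theta>_def[symmetric])
  moreover have "of_nat CARD('n) + 1 \<noteq> (0::complex)" by (rule of_nat_plus_one_neq_0)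
  ultimately have "\<theta> = \<delta>" by (simp add: \<delta>_def field_simps)
  then show "along_mat k \<eta> x = \<eta> x ** M + N ** \<eta> x - mat \<delta> ** \<eta> x"
    and "along k ?\<tau> x = \<delta> * ?\<tau> x"
    using e \<tau>0 by (simp_all add: \<theta>_def field_simps)
qed

subsection \<open>Symplectic gradients of Killing potentials\<close>

text \<open>
  The components \<open>h a b\<close> of a Kaehler metric on \<open>\<partial>/\<partial>z\<^sup>a\<close> and the conjugate of \<open>\<partial>/\<partial>z\<^sup>b\<close>.
\<close>

locale kaehler_chart =
  fixes U :: "(complex^'n::finite) set" and h :: "complex^'n \<Rightarrow> complex^'n^'n"
  assumes open_U: "open U"
    and smooth_h: "\<And>i j. smooth_on U (\<lambda>x. h x $ i $ j)"
    and det_h: "\<And>x. x \<in> U \<Longrightarrow> det (h x) \<noteq> 0"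
    and hermitian_h: "\<And>x a b. x \<in> U \<Longrightarrow> cnj (h x $ a $ b) = h x $ b $ a"
    and kaehler_h: "\<And>x a b e. x \<in> U \<Longrightarrow> pd (Inl a) (\<lambda>y. h y $ b $ e) x = pd (Inl b) (\<lambda>y. h y $ a $ e) x"

definition sesquilinear :: "complex^'n::finite^'n \<Rightarrow> complex^'n \<Rightarrow> complex^'n \<Rightarrow> complex" where
  "sesquilinear k v w = (\<Sum>a\<in>UNIV. cnj (v $ a) * (k *v w) $ a)"

text \<open>
  The real vector with \<open>T\<^sup>0\<^sup>,\<^sup>1M\<close> part \<open>\<i> V\<close>. It is the symplectic gradient at points where \<open>- h V\<close>
  are the unbarred derivatives of the potential.
\<close>

fun real_vector :: "complex^'n \<Rightarrow> 'n idx \<Rightarrow> complex" where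
  "real_vector V (Inl b) = - \<i> * cnj (V $ b)"
| "real_vector V (Inr b) = \<i> * V $ b"

context kaehler_chart
begin

lemma diff_h: "x \<in> U \<Longrightarrow> (\<lambda>y. h y $ i $ j) differentiable (at x)"
  using smooth_on_differentiable[OF smooth_h] .

lemma kaehler_h_bar:
  assumes "x \<in> U"
  shows "pd (Inr b) (\<lambda>y. h y $ a $ c) x = pd (Inr c) (\<lambda>y. h y $ a $ b) x"
proof -
  have "pd (Inr b) (\<lambda>y. h y $ a $ c) x = cnj (pd (Inl b) (\<lambda>y. h y $ c $ a) x)" for b c
    using pd_cong_open[OF open_U assms, of "\<lambda>y. h y $ a $ c" "\<lambda>y. cnj (h y $ c $ a)" "Inr b"]
      pd_cnj[OF diff_h[OF assms], of "Inr b" c a] by (simp add: hermitian_h)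
  then show ?thesis using kaehler_h[OF assms, of b c a] by simp
qed

lemma pd_bar_real:
  assumes "x \<in> U" "\<And>y. y \<in> U \<Longrightarrow> f y \<in> \<real>" "f differentiable (at x)"
  shows "pd (Inr a) f x = cnj (pd (Inl a) f x)"
proof -
  have "pd (Inr a) f x = pd (Inr a) (\<lambda>y. cnj (f y)) x"
    using pd_cong_open[OF open_U assms(1)] assms(2) by (metis Reals_cnj_iff)
  then show ?thesis using pd_cnj[OF assms(3), of "Inr a"] by simp
qed

text \<open>
  Lowering the index of the symplectic gradient gives \<open>\<plusminus>\<i>\<close> times the derivatives of \<open>f\<close>. In the
  mixed component of the Lie derivative of the metric the second derivatives of \<open>f\<close> therefore
  occur with opposite signs, and the derivatives of \<open>h\<close> cancel by the Kaehler condition.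
\<close>

lemma symplectic_gradient_killing:
  assumes x: "x \<in> U"
    and smooth_f: "smooth_on U f" and real_f: "\<And>y. y \<in> U \<Longrightarrow> f y \<in> \<real>"
    and smooth_V: "\<And>b. smooth_on U (\<lambda>x. V x $ b)"
    and grad: "\<And>y a. y \<in> U \<Longrightarrow> pd (Inl a) f y = - (h y *v V y) $ a"
  shows "(\<Sum>\<gamma>\<in>UNIV. real_vector (V x) \<gamma> * pd \<gamma> (\<lambda>y. h y $ a $ b) x)
    + (\<Sum>c\<in>UNIV. h x $ c $ b * pd (Inl a) (\<lambda>y. real_vector (V y) (Inl c)) x)
    + (\<Sum>c\<in>UNIV. h x $ a $ c * pd (Inr b) (\<lambda>y. real_vector (V y) (Inr c)) x) = 0"
proof -
  let ?K = "\<lambda>y. real_vector (V y)"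
  have dK: "(\<lambda>y. ?K y \<gamma>) differentiable (at x)" for \<gamma>
    by (cases \<gamma>; simp) (auto intro!: smooth_on_differentiable[OF _ x] smooth_intros open_U smooth_V)
  have gradbar: "pd (Inr b) f y = - (\<Sum>c\<in>UNIV. h y $ c $ b * cnj (V y $ c))" if "y \<in> U" for y b
    using pd_bar_real[OF that real_f smooth_on_differentiable[OF smooth_f that], of b] grad[OF that, of b] that
    by (simp add: matrix_vector_mult_def hermitian_h)
  have "pd (Inl a) (\<lambda>y. \<Sum>c\<in>UNIV. h y $ c $ b * ?K y (Inl c)) x = pd (Inl a) (\<lambda>y. \<i> * pd (Inr b) f y) x"
    by (rule pd_cong_open[OF open_U x]) (simp add: gradbar sum_distrib_left sum_negf mult_ac)
  then have 1: "(\<Sum>c\<in>UNIV. pd (Inl a) (\<lambda>y. h y $ c $ b) x * ?K x (Inl c) + h x $ c $ b * pd (Inl a) (\<lambda>y. ?K y (Inl c)) x)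
      = \<i> * pd (Inl a) (pd (Inr b) f) x"
    using smooth_on_differentiable[OF smooth_on_pd[OF open_U smooth_f] x]
    by (simp add: pd_sum pd_mult diff_h[OF x] dK pd_cmult del: real_vector.simps)
  have "pd (Inr b) (\<lambda>y. \<Sum>c\<in>UNIV. h y $ a $ c * ?K y (Inr c)) x = pd (Inr b) (\<lambda>y. - \<i> * pd (Inl a) f y) x"
    by (rule pd_cong_open[OF open_U x]) (simp add: grad matrix_vector_mult_def sum_distrib_left sum_negf mult_ac)
  then have 2: "(\<Sum>c\<in>UNIV. pd (Inr b) (\<lambda>y. h y $ a $ c) x * ?K x (Inr c) + h x $ a $ c * pd (Inr b) (\<lambda>y. ?K y (Inr c)) x)
      = - \<i> * pd (Inr b) (pd (Inl a) f) x"
    using smooth_on_differentiable[OF smooth_on_pd[OF open_U smooth_f] x] pd_cmult[of "pd (Inl a) f" x "Inr b" "-\<i>"]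
    by (simp add: pd_sum pd_mult diff_h[OF x] dK del: real_vector.simps)
  have 3: "(\<Sum>\<gamma>\<in>UNIV. ?K x \<gamma> * pd \<gamma> (\<lambda>y. h y $ a $ b) x)
      = (\<Sum>c\<in>UNIV. pd (Inl a) (\<lambda>y. h y $ c $ b) x * ?K x (Inl c))
        + (\<Sum>c\<in>UNIV. pd (Inr b) (\<lambda>y. h y $ a $ c) x * ?K x (Inr c))"
    using kaehler_h[OF x, of _ a b] kaehler_h_bar[OF x, of b a]
    by (simp add: sum_idx mult.commute del: real_vector.simps)
  have "(\<Sum>c\<in>UNIV. pd (Inl a) (\<lambda>y. h y $ c $ b) x * ?K x (Inl c) + h x $ c $ b * pd (Inl a) (\<lambda>y. ?K y (Inl c)) x)
      + (\<Sum>c\<in>UNIV. pd (Inr b) (\<lambda>y. h y $ a $ c) x * ?K x (Inr c) + h x $ a $ c * pd (Inr b) (\<lambda>y. ?K y (Inr c)) x) = 0"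
    unfolding 1 2 by (simp add: pd_commute[OF open_U x smooth_f, of "Inl a" "Inr b"])
  then show ?thesis unfolding 3 by (simp only: sum.distrib ac_simps)
qed

end

subsection \<open>Canonical potentials of the pencil\<close>

text \<open>
  Here \<open>L\<close> stands for \<open>\<eta>' \<eta>\<^sup>-\<^sup>1\<close>, an endomorphism of \<open>T\<^sup>0\<^sup>,\<^sup>1M\<close>. The metrisability equations of \<open>\<eta>\<close>
  and \<open>\<eta>'\<close> combine to the rank one equation for its derivatives.
\<close>

locale pencil_chart = kaehler_chart U h
  for U :: "(complex^'n::finite) set" and h +
  fixes L :: "complex^'n \<Rightarrow> complex^'n^'n" and X :: "complex^'n \<Rightarrow> complex^'n"
  assumes dim: "CARD('n) \<ge> 2"
    and smooth_L: "\<And>i j. smooth_on U (\<lambda>x. L x $ i $ j)"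
    and smooth_X: "\<And>b. smooth_on U (\<lambda>x. X x $ b)"
    and pd_L: "\<And>x a b e. x \<in> U \<Longrightarrow> pd (Inl a) (\<lambda>y. L y $ b $ e) x = - (X x $ b * h x $ a $ e)"
    and selfadjoint_L: "\<And>x. x \<in> U \<Longrightarrow> (\<chi> i j. cnj (L x $ j $ i)) ** h x = h x ** L x"
begin

lemma diff_L: "x \<in> U \<Longrightarrow> (\<lambda>y. L y $ i $ j) differentiable (at x)"
  using smooth_on_differentiable[OF smooth_L] .

lemma diff_X: "x \<in> U \<Longrightarrow> (\<lambda>y. X y $ b) differentiable (at x)"
  using smooth_on_differentiable[OF smooth_X] .

text \<open>
  Second derivatives of \<open>L\<close> commute and \<open>h\<close> satisfies the Kaehler condition, so
  \<open>h(\<partial>/\<partial>z\<^sup>a, -) \<partial>X/\<partial>z\<^sup>d\<close> is symmetric in \<open>a\<close> and \<open>d\<close>. The covectors \<open>h(\<partial>/\<partial>z\<^sup>a, -)\<close> are linearly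
  independent and there are at least two of them.
\<close>

lemma pd_X:
  assumes x: "x \<in> U"
  shows "pd (Inl d) (\<lambda>y. X y $ b) x = 0"
proof -
  let ?dX = "\<lambda>d. pd (Inl d) (\<lambda>y. X y $ b) x"
  have dd: "pd (Inl d) (pd (Inl a) (\<lambda>y. L y $ b $ e)) x
      = - (?dX d * h x $ a $ e + X x $ b * pd (Inl d) (\<lambda>y. h y $ a $ e) x)" for a d e
  proof -
    have "pd (Inl d) (pd (Inl a) (\<lambda>y. L y $ b $ e)) x = pd (Inl d) (\<lambda>y. - (X y $ b * h y $ a $ e)) x"
      by (rule pd_cong_open[OF open_U x]) (simp add: pd_L)
    then show ?thesis using diff_X[OF x] diff_h[OF x] by (simp add: pd_uminus pd_mult)
  qed
  have sym: "?dX d * h x $ a $ e = ?dX a * h x $ d $ e" for a e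
    using dd[of d a e] dd[of a d e] pd_commute[OF open_U x smooth_L, of "Inl d" "Inl a" b e]
      kaehler_h[OF x, of d a e] by simp
  obtain k where k: "h x ** k = mat 1" using det_h[OF x] by (rule inverse_matrix_exists)
  have id: "(\<Sum>e\<in>UNIV. h x $ p $ e * k $ e $ q) = (if p = q then 1 else 0)" for p q
    using k by (simp add: vec_eq_iff matrix_matrix_mult_def mat_def)
  have "\<exists>a. a \<noteq> d"
  proof (rule ccontr)
    assume "\<nexists>a. a \<noteq> d"
    then have "UNIV = {d}" by auto
    then have "CARD('n) = card {d}" by (rule arg_cong)
    then show False using dim by simp
  qed
  then obtain a where a: "a \<noteq> d" ..
  have "?dX d * (\<Sum>e\<in>UNIV. h x $ a $ e * k $ e $ a) = ?dX a * (\<Sum>e\<in>UNIV. h x $ d $ e * k $ e $ a)"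
    by (simp add: sum_distrib_left mult.assoc[symmetric] sym)
  then show ?thesis using a by (simp add: id)
qed

text \<open>
  Up to sign, the gradient of \<open>det (L - t)\<close> with its index raised by \<open>h\<close>.
\<close>

definition V :: "complex \<Rightarrow> complex^'n \<Rightarrow> complex^'n" where
  "V t x = adj (L x - mat t) *v X x"

lemma smooth_shift: "smooth_on U (\<lambda>x. (L x - mat t) $ i $ j)"
  by (simp, intro smooth_intros open_U smooth_L)

lemma diff_shift: "x \<in> U \<Longrightarrow> (\<lambda>y. (L y - mat t) $ i $ j) differentiable (at x)"
  using smooth_on_differentiable[OF smooth_shift] .

lemma smooth_potential: "smooth_on U (\<lambda>x. det (L x - mat t))"
  by (intro smooth_on_det open_U smooth_shift)

lemma smooth_V: "smooth_on U (\<lambda>x. V t x $ b)"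
  unfolding V_def matrix_vector_mult_def
  by (simp, intro smooth_intros open_U smooth_X smooth_on_adj smooth_shift)

lemma pd_mat_shift: "x \<in> U \<Longrightarrow> pd_mat (Inl a) (\<lambda>y. L y - mat t) x = - outer (X x) (h x $ a)"
  using diff_L by (simp add: vec_eq_iff pd_diff pd_L)

text \<open>
  Jacobi's formula; the trace of a rank one matrix is a pairing of its two factors.
\<close>

lemma pd_potential:
  assumes "x \<in> U"
  shows "pd (Inl a) (\<lambda>y. det (L y - mat t)) x = - (h x *v V t x) $ a"
  using assms
  by (simp add: pd_det[OF diff_shift] pd_mat_shift matrix_minus_left V_def)
     (simp add: trace_def sum_negf flip: trace_outer_mult[unfolded trace_def],
      simp add: trace_outer_mult[unfolded trace_def] matrix_vector_mult_def)

lemma pd_V: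
  assumes x: "x \<in> U"
  shows "pd (Inl a) (\<lambda>y. V t y $ b) x = 0"
proof -
  have "pd (Inl a) (\<lambda>y. V t y $ b) x
      = (\<Sum>e\<in>UNIV. dadj (L x - mat t) (- outer (X x) (h x $ a)) $ b $ e * X x $ e)"
    using differentiable_adj[OF diff_shift[OF x]] diff_X[OF x]
    by (simp add: V_def matrix_vector_mult_def pd_sum pd_mult pd_X[OF x] pd_adj[OF diff_shift[OF x]] pd_mat_shift[OF x])
  also have "\<dots> = - (dadj (L x - mat t) (outer (X x) (h x $ a)) *v X x) $ b"
    by (simp add: dadj_uminus matrix_vector_mult_def sum_negf)
  finally show ?thesis by (simp add: dadj_outer_mult_vec)
qed

lemma potential_real:
  assumes x: "x \<in> U"
  shows "det (L x - mat (of_real t)) \<in> \<real>"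
proof -
  have e: "(\<chi> i j. cnj ((L x - mat (of_real t)) $ j $ i)) = (\<chi> i j. cnj (L x $ j $ i)) - mat (of_real t)"
    by (simp add: vec_eq_iff mat_def)
  have "(\<chi> i j. cnj ((L x - mat (of_real t)) $ j $ i)) ** h x = h x ** (L x - mat (of_real t))"
    unfolding e by (simp add: matrix_sub_rdistrib matrix_sub_ldistrib selfadjoint_L[OF x] mult_mat[of "h x"])
  then have "det (\<chi> i j. cnj ((L x - mat (of_real t)) $ j $ i)) * det (h x) = det (h x) * det (L x - mat (of_real t))"
    by (metis det_mul)
  then have "cnj (det (L x - mat (of_real t))) = det (L x - mat (of_real t))"
    using det_h[OF x] by (simp add: det_conj_transpose)
  then show ?thesis by (simp add: Reals_cnj_iff)
qed

text \<open>
  If \<open>L\<close> is self-adjoint for \<open>k\<close>, then so are the adjugates of \<open>L - s\<close> and \<open>L - t\<close>, and these commute.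
  The form \<open>k\<close> is \<open>h\<close> or the matrix of the second metric.
\<close>

lemma V_pairing_symmetric:
  assumes x: "x \<in> U" and k: "det k \<noteq> 0" "(\<chi> i j. cnj (L x $ j $ i)) ** k = k ** L x"
  shows "sesquilinear k (V (of_real s) x) (V (of_real t) x) = sesquilinear k (V (of_real t) x) (V (of_real s) x)"
proof -
  let ?B = "\<lambda>s. adj (L x - mat s)"
  have W: "sesquilinear k (V (of_real s) x) (V (of_real t) x) = sesquilinear (k ** (?B (of_real s) ** ?B (of_real t))) (X x) (X x)" for s t
  proof -
    let ?Ls = "(\<chi> i j. cnj ((L x - mat (of_real s)) $ j $ i))"
    have "?Ls = (\<chi> i j. cnj (L x $ j $ i)) - mat (of_real s)"
      by (simp add: vec_eq_iff mat_def)
    then have "?Ls ** k = k ** (L x - mat (of_real s))"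
      by (simp add: matrix_sub_rdistrib matrix_sub_ldistrib k(2) mult_mat[of k])
    then have ik: "adj ?Ls ** k = k ** ?B (of_real s)" by (rule adj_intertwine[OF k(1)])
    define Q where "Q = adj ?Ls"
    have Q: "cnj (?B (of_real s) $ b $ a) = Q $ a $ b" for a b
      by (simp only: Q_def adj_conj_transpose)
    define w where "w = k *v V (of_real t) x"
    have "sesquilinear k (V (of_real s) x) (V (of_real t) x) = (\<Sum>a\<in>UNIV. \<Sum>b\<in>UNIV. cnj (X x $ b) * (Q $ b $ a * w $ a))"
      unfolding sesquilinear_def w_def[symmetric]
      by (simp add: V_def matrix_vector_mult_def[of "?B (of_real s)"] sum_distrib_left Q mult_ac)
    also have "\<dots> = (\<Sum>b\<in>UNIV. cnj (X x $ b) * (Q *v w) $ b)"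
      by (subst sum.swap) (simp add: matrix_vector_mult_def[of Q] sum_distrib_left)
    also have "Q *v w = k ** (?B (of_real s) ** ?B (of_real t)) *v X x"
      by (simp only: w_def V_def matrix_vector_mul_assoc Q_def ik matrix_mul_assoc)
    finally show ?thesis by (simp only: sesquilinear_def)
  qed
  show ?thesis unfolding W adj_shift_commute[of "L x" "of_real s" "of_real t"] ..
qed

end

text \<open>
  The second metric \<open>h'\<close> of the pencil has the same fields \<open>V t\<close>. Its potentials are the
  \<open>det (L - t)\<close> relative to the density of \<open>h'\<close>, up to the factor \<open>t\<close>; at \<open>t = 0\<close> the quotient
  is constant, and the potential is the limit of \<open>(det (L - t) - det L) / (t det L)\<close>.
\<close>

definition dual_potential :: "complex \<Rightarrow> complex^'n::finite^'n \<Rightarrow> complex" where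
  "dual_potential t B = (if t = 0 then - trace (mat (inverse (det B)) ** adj B)
     else det (B - mat t) / (t * det B))"

context pencil_chart
begin

lemma smooth_dual_potential:
  assumes "\<And>x. x \<in> U \<Longrightarrow> det (L x) \<noteq> 0"
  shows "smooth_on U (\<lambda>x. dual_potential t (L x))"
proof (cases "t = 0")
  case True
  have "smooth_on U (\<lambda>x. - (\<Sum>i\<in>UNIV. inverse (det (L x)) * adj (L x) $ i $ i))"
    by (intro smooth_intros smooth_on_inverse smooth_on_adj smooth_on_det open_U smooth_L assms)
  then show ?thesis using True by (simp add: dual_potential_def trace_def)
next
  case False
  have "smooth_on U (\<lambda>x. det (L x - mat t) / (t * det (L x)))"
    using assms False by (intro smooth_intros smooth_on_det open_U smooth_L smooth_potential) auto
  then show ?thesis using False by (simp add: dual_potential_def)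
qed

lemma L_mult_V: "L x *v V t x = t *s V t x + det (L x - mat t) *s X x"
proof -
  have "(L x - mat t) ** adj (L x - mat t) *v X x = det (L x - mat t) *s X x"
    unfolding mult_adj by (simp add: vec_eq_iff matrix_vector_mult_def mat_def if_distrib[of "\<lambda>x. x * _"] cong: if_cong)
  moreover have "mat t *v V t x = t *s V t x"
    by (simp add: vec_eq_iff matrix_vector_mult_def mat_def if_distrib[of "\<lambda>x. x * _"] cong: if_cong)
  ultimately have "L x *v V t x - t *s V t x = det (L x - mat t) *s X x"
    by (simp add: V_def matrix_vector_mul_assoc[symmetric] matrix_vector_mult_diff_rdistrib)
  then show ?thesis by (simp add: algebra_simps)
qed

lemma pd_dual_potential:
  assumes x: "x \<in> U" and L0: "\<And>x. x \<in> U \<Longrightarrow> det (L x) \<noteq> 0"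
    and h': "h x = mat (det (L x)) ** (h' ** L x)"
  shows "pd (Inl a) (\<lambda>y. dual_potential t (L y)) x = - (h' *v V t x) $ a"
proof -
  have hv: "h x *v w = det (L x) *s (h' *v (L x *v w))" for w
    unfolding h' by (simp add: matrix_vector_mul_assoc)
       (simp add: vec_eq_iff matrix_vector_mult_def sum_distrib_left mult_ac)
  note dL = diff_L[OF x]
  show ?thesis
  proof (cases "t = 0")
    case False
    let ?f = "\<lambda>y. det (L y - mat t)" and ?d = "\<lambda>y. det (L y)"
    have p0: "pd (Inl a) ?d x = - (h x *v V 0 x) $ a" using pd_potential[OF x, of a 0] by simp
    have df: "?f differentiable (at x)" "?d differentiable (at x)"
      by (intro differentiable_det diff_shift[OF x] dL)+
    have "pd (Inl a) (\<lambda>y. ?f y / (t * ?d y)) x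
        = (pd (Inl a) ?f x * (t * ?d x) - ?f x * pd (Inl a) (\<lambda>y. t * ?d y) x) / (t * ?d x)\<^sup>2"
      by (rule pd_divide) (use df False L0[OF x] in auto)
    also have "\<dots> = (- (h x *v V t x) $ a * (t * ?d x) + ?f x * (t * (h x *v V 0 x) $ a)) / (t * ?d x)\<^sup>2"
      unfolding pd_cmult[OF df(2)] pd_potential[OF x, of a t] p0 by simp
    also have "\<dots> = - (h' *v V t x) $ a"
    proof -
      have "(h x *v V 0 x) $ a = (?d x)\<^sup>2 * (h' *v X x) $ a"
        using L_mult_V[of x 0] by (simp add: hv power2_eq_square vector_scalar_commute matrix_vector_mult_scaleR)
      moreover have "(h x *v V t x) $ a = ?d x * (t * (h' *v V t x) $ a + ?f x * (h' *v X x) $ a)"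
        by (simp add: hv L_mult_V matrix_vector_right_distrib vector_scalar_commute) (simp add: algebra_simps)
      ultimately show ?thesis using False L0[OF x] by (simp add: field_simps power2_eq_square)
    qed
    finally show ?thesis using False by (simp add: dual_potential_def)
  next
    case True
    let ?N = "\<lambda>y. mat (inverse (det (L y))) ** adj (L y)"
    have LN: "L y ** ?N y = mat 1" "?N y ** L y = mat 1" if "y \<in> U" for y
    proof -
      show 1: "L y ** ?N y = mat 1"
        using L0[OF that] by (simp add: mult_mat_left[of "L y"] mult_adj mat_mult_mat)
      then show "?N y ** L y = mat 1" using matrix_left_right_inverse by blast
    qed
    have dN: "(\<lambda>y. ?N y $ i $ j) differentiable (at x)" for i j
      using differentiable_inverse_complex[OF differentiable_det[OF dL] L0[OF x]] differentiable_adj[OF dL]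
      by simp
    let ?pN = "pd_mat (Inl a) ?N x"
    have "pd_mat (Inl a) (\<lambda>y. L y ** ?N y) x = pd_mat (Inl a) (\<lambda>y. mat 1) x"
      by (rule pd_mat_cong_open[OF open_U x LN(1)])
    then have "L x ** ?pN = outer (X x) (h x $ a) ** ?N x"
      using pd_mat_shift[OF x, of a 0]
      by (simp add: pd_mat_mult[OF dL dN] matrix_minus_left) (simp add: vec_eq_iff)
    then have "?N x ** L x ** ?pN = ?N x ** outer (X x) (h x $ a) ** ?N x"
      by (simp only: matrix_mul_assoc[symmetric])
    then have "?pN = ?N x ** outer (X x) (h x $ a) ** ?N x" by (simp only: LN[OF x] matrix_mul_lid)
    then have "trace ?pN = trace (outer (X x) (h x $ a) ** (?N x ** ?N x))"
      using trace_mul_sym[of "?N x" "outer (X x) (h x $ a) ** ?N x"] by (simp add: matrix_mul_assoc)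
    also have "\<dots> = (h x *v (?N x *v (?N x *v X x))) $ a"
      by (simp only: trace_outer_mult matrix_vector_mul_assoc[symmetric])
         (simp add: matrix_vector_mult_def[of "h x"])
    also have "\<dots> = det (L x) * (h' *v (?N x *v X x)) $ a"
    proof -
      have "L x *v (?N x *v w) = w" for w
        by (simp only: matrix_vector_mul_assoc LN(1)[OF x] matrix_vector_mul_lid)
      then show ?thesis unfolding hv by (simp only: vector_smult_component)
    qed
    also have "\<dots> = (h' *v V 0 x) $ a"
    proof -
      have "V 0 x = det (L x) *s (?N x *v X x)"
        using L0[OF x] by (simp add: V_def vec_eq_iff matrix_vector_mult_def sum_distrib_left mult.assoc[symmetric])
      then show ?thesis by (simp add: vector_scalar_commute)
    qed
    finally have "trace ?pN = (h' *v V 0 x) $ a" .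
    moreover have "pd (Inl a) (\<lambda>y. - trace (?N y)) x = - trace ?pN"
      using dN unfolding trace_def by (simp add: pd_uminus pd_sum)
    ultimately show ?thesis using True by (simp add: dual_potential_def)
  qed
qed

lemma dual_potential_real:
  assumes x: "x \<in> U" and L0: "det (L x) \<noteq> 0"
  shows "dual_potential (of_real t) (L x) \<in> \<real>"
proof (cases "t = 0")
  case False
  then show ?thesis
    using potential_real[OF x, of t] potential_real[OF x, of 0]
    by (simp add: dual_potential_def)
next
  case True
  let ?Ls = "\<chi> i j. cnj (L x $ j $ i)"
  obtain k where k: "h x ** k = mat 1" "k ** h x = mat 1" using det_h[OF x] by (rule inverse_matrix_exists)
  have "trace (adj ?Ls) = trace (adj ?Ls ** h x ** k)" by (simp add: matrix_mul_assoc[symmetric] k)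
  also have "\<dots> = trace (h x ** adj (L x) ** k)" by (simp add: adj_intertwine[OF det_h[OF x] selfadjoint_L[OF x]])
  also have "\<dots> = trace (adj (L x))"
    using trace_mul_sym[of "h x ** adj (L x)" k] by (simp add: matrix_mul_assoc k)
  also have "trace (adj ?Ls) = cnj (trace (adj (L x)))" by (simp add: trace_def adj_conj_transpose)
  finally have "trace (adj (L x)) \<in> \<real>" by (simp add: Reals_cnj_iff)
  then show ?thesis using True potential_real[OF x, of 0]
    by (simp add: dual_potential_def trace_mat_mult)
qed

end

section \<open>Changes of charts\<close>

lemma open_coords: "complex_manifold M \<A> \<Longrightarrow> c \<in> \<A> \<Longrightarrow> open (coords c)"
  by (simp add: complex_manifold_def)

lemma overlap_coords: "x \<in> overlap c d \<Longrightarrow> x \<in> coords c"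
  by (auto simp: overlap_def coords_def)

lemma chart_homeomorphic:
  assumes "complex_manifold M \<A>" "c \<in> \<A>"
  shows "openin M (fst c)" "homeomorphic_map (subtopology M (fst c)) (top_of_set (coords c)) (snd c)"
    "topspace (subtopology M (fst c)) = fst c"
  using assms openin_subset[of M "fst c"] unfolding complex_manifold_def by auto

lemma trans_map_coords:
  assumes "complex_manifold M \<A>" "c \<in> \<A>" "x \<in> overlap c d"
  shows "trans_map c d x \<in> coords d"
proof -
  have inj: "inj_on (snd c) (fst c)"
    using homeomorphic_imp_injective_map[OF chart_homeomorphic(2)[OF assms(1,2)]] chart_homeomorphic(3)[OF assms(1,2)]
    by simp
  obtain p where "p \<in> fst c" "p \<in> fst d" "x = snd c p" using assms(3) by (auto simp: overlap_def)
  then show ?thesis by (simp add: trans_map_def coords_def inv_into_f_f[OF inj])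
qed

lemma open_overlap:
  assumes "complex_manifold M \<A>" "c \<in> \<A>" "d \<in> \<A>"
  shows "open (overlap c d)"
proof -
  have "openin (subtopology M (fst c)) (fst c \<inter> fst d)"
    using chart_homeomorphic(1)[OF assms(1,3)] by (simp add: openin_subtopology_Int2)
  then have "openin (top_of_set (coords c)) (overlap c d)"
    using homeomorphic_imp_open_map[OF chart_homeomorphic(2)[OF assms(1,2)]]
    by (simp add: open_map_def overlap_def)
  then show ?thesis using open_coords[OF assms(1,2)] openin_open_eq by blast
qed

lemma trans_map_differentiable:
  assumes "complex_manifold M \<A>" "c \<in> \<A>" "d \<in> \<A>" "x \<in> overlap c d"
  shows "trans_map c d differentiable (at x)"
    "frechet_derivative (trans_map c d) (at x) (\<i> *s v) = \<i> *s frechet_derivative (trans_map c d) (at x) v"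
  using assms smooth_on_differentiable[of "overlap c d" "trans_map c d" x]
  unfolding complex_manifold_def holomorphic_map_on_def by blast+

lemma jac_mixed:
  assumes "complex_manifold M \<A>" "c \<in> \<A>" "d \<in> \<A>" "x \<in> overlap c d"
  shows "jac c d x (Inl p) (Inr a) = 0" "jac c d x (Inr p) (Inl a) = 0"
    "jac c d x (Inr p) (Inr a) = cnj (jac c d x (Inl p) (Inl a))"
proof -
  let ?D = "frechet_derivative (trans_map c d) (at x)"
  have D: "((\<lambda>y. trans_map c d y $ p) has_derivative (\<lambda>v. ?D v $ p)) (at x)"
    using bounded_linear.has_derivative[OF bounded_linear_vec_nth
        has_derivative_frechet[OF trans_map_differentiable(1)[OF assms]]] .
  then have diff: "(\<lambda>y. trans_map c d y $ p) differentiable (at x)" by (auto simp: differentiable_def)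
  have "axis a \<i> = \<i> *s axis a (1::complex)" by (simp add: vec_eq_iff axis_def)
  then show z: "jac c d x (Inl p) (Inr a) = 0"
    using trans_map_differentiable(2)[OF assms, of "axis a 1"] by (simp add: jac_def pd_eqI[OF D])
  show "jac c d x (Inr p) (Inl a) = 0" "jac c d x (Inr p) (Inr a) = cnj (jac c d x (Inl p) (Inl a))"
    using z pd_cnj[OF diff] by (simp_all add: jac_def)
qed

definition hol_jac :: "('m, 'n::finite) chart \<Rightarrow> ('m, 'n) chart \<Rightarrow> complex^'n \<Rightarrow> complex^'n^'n" where
  "hol_jac c d x = (\<chi> p a. jac c d x (Inl p) (Inl a))"

definition cnj_mat :: "complex^'n^'m \<Rightarrow> complex^'n^'m" where
  "cnj_mat A = (\<chi> i j. cnj (A $ i $ j))"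

lemma cnj_mat_nth [simp]: "cnj_mat A $ i $ j = cnj (A $ i $ j)"
  by (simp add: cnj_mat_def)

lemma det_cnj_mat: "det (cnj_mat A) = cnj (det (A::complex^'n::finite^'n))"
  by (simp add: det_def)

lemma density_factor_hol_jac:
  "density_factor k c d x = of_real (((cmod (det (hol_jac c d x)))\<^sup>2) powr (of_int k / (of_nat CARD('n) + 1)))"
  for c :: "('m, 'n::finite) chart"
  by (simp add: density_factor_def hol_jac_def)

lemma herm_contra_transform:
  assumes "complex_manifold M \<A>" "real_herm_contra k \<A> \<eta>" "c \<in> \<A>" "d \<in> \<A>" "x \<in> overlap c d"
  shows "\<eta> d (trans_map c d x) = mat (density_factor k c d x) **
    (cnj_mat (hol_jac c d x) ** \<eta> c x ** transpose (hol_jac c d x))"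
proof -
  have "\<eta> d (trans_map c d x) $ p $ q = density_factor k c d x *
      (\<Sum>a\<in>UNIV. \<Sum>b\<in>UNIV. cnj (hol_jac c d x $ p $ a) * hol_jac c d x $ q $ b * \<eta> c x $ a $ b)" for p q
    using assms jac_mixed(3)[OF assms(1,3,4,5)] by (simp add: real_herm_contra_def hol_jac_def)
  moreover have "(cnj_mat (hol_jac c d x) ** \<eta> c x ** transpose (hol_jac c d x)) $ p $ q
      = (\<Sum>a\<in>UNIV. \<Sum>b\<in>UNIV. cnj (hol_jac c d x $ p $ a) * hol_jac c d x $ q $ b * \<eta> c x $ a $ b)" for p q
    by (simp add: matrix_matrix_mult_def transpose_def sum_distrib_left sum_distrib_right mult_ac)
       (subst sum.swap, simp)
  ultimately show ?thesis by (simp add: vec_eq_iff)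
qed

lemma herm_co_transform_iff:
  assumes "complex_manifold M \<A>" "c \<in> \<A>" "d \<in> \<A>" "x \<in> overlap c d"
  shows "(\<forall>b a. w * H c x $ b $ a = (\<Sum>q\<in>UNIV. \<Sum>p\<in>UNIV. jac c d x (Inl q) (Inl b) * jac c d x (Inr p) (Inr a)
             * H d (trans_map c d x) $ q $ p))
    \<longleftrightarrow> mat w ** H c x = transpose (hol_jac c d x) ** H d (trans_map c d x) ** cnj_mat (hol_jac c d x)"
proof -
  have "(transpose (hol_jac c d x) ** H d (trans_map c d x) ** cnj_mat (hol_jac c d x)) $ b $ a
      = (\<Sum>q\<in>UNIV. \<Sum>p\<in>UNIV. jac c d x (Inl q) (Inl b) * jac c d x (Inr p) (Inr a)
             * H d (trans_map c d x) $ q $ p)" for a b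
    by (simp add: matrix_matrix_mult_def transpose_def sum_distrib_left sum_distrib_right mult_ac
        jac_mixed(3)[OF assms] hol_jac_def) (subst sum.swap, simp)
  then show ?thesis by (simp add: vec_eq_iff)
qed

lemma real_herm_coI:
  assumes cm: "complex_manifold M \<A>"
    and sm: "\<And>c b a. c \<in> \<A> \<Longrightarrow> smooth_on (coords c) (\<lambda>x. H c x $ b $ a)"
    and herm: "\<And>c x a b. c \<in> \<A> \<Longrightarrow> x \<in> coords c \<Longrightarrow> cnj (H c x $ b $ a) = H c x $ a $ b"
    and trans: "\<And>c d x. c \<in> \<A> \<Longrightarrow> d \<in> \<A> \<Longrightarrow> x \<in> overlap c d \<Longrightarrow> mat (density_factor k c d x) ** H c x
        = transpose (hol_jac c d x) ** H d (trans_map c d x) ** cnj_mat (hol_jac c d x)"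
  shows "real_herm_co k \<A> H"
  unfolding real_herm_co_def
  using herm herm_co_transform_iff[OF cm] trans
  by (auto intro!: smooth_on_vecI open_coords[OF cm] sm)

lemma pd_transform:
  assumes cm: "complex_manifold M \<A>" and f: "real_function \<A> f"
    and cd: "c \<in> \<A>" "d \<in> \<A>" "x \<in> overlap c d"
  shows "pd (Inl a) (f c) x = (\<Sum>p\<in>UNIV. hol_jac c d x $ p $ a * pd (Inl p) (f d) (trans_map c d x))"
proof -
  have fd: "f d differentiable (at (trans_map c d x))"
    using f cd trans_map_coords[OF cm cd(1,3)] smooth_on_differentiable unfolding real_function_def by blast
  have "pd (Inl a) (f c) x = pd (Inl a) (\<lambda>y. f d (trans_map c d y)) x"
    by (rule pd_cong_open[OF open_overlap[OF cm cd(1,2)] cd(3)]) (use f cd in \<open>auto simp: real_function_def\<close>)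
  also have "\<dots> = (\<Sum>\<kappa>\<in>UNIV. pd \<kappa> (f d) (trans_map c d x) * jac c d x \<kappa> (Inl a))"
    unfolding jac_def by (rule pd_chain[OF trans_map_differentiable(1)[OF cm cd] fd])
  finally show ?thesis
    by (simp add: sum_idx jac_mixed(2)[OF cm cd] hol_jac_def mult.commute)
qed

section \<open>Complex connections\<close>

text \<open>
  For a connection with \<open>\<nabla>J = 0\<close> and without torsion these components and their conjugates are the only
  ones that can be nonzero.
\<close>

definition conn_mat :: "('m, 'n::finite) conn \<Rightarrow> ('m, 'n) chart \<Rightarrow> complex^'n \<Rightarrow> 'n \<Rightarrow> complex^'n^'n" where
  "conn_mat \<Gamma> c x a = (\<chi> b d. \<Gamma> c x (Inl a) (Inl b) (Inl d))"

lemma sum_J: "(\<Sum>\<delta>\<in>UNIV. J \<beta> \<delta> * F \<delta>) = J \<beta> \<beta> * F \<beta>" "(\<Sum>\<delta>\<in>UNIV. J \<delta> \<beta> * F \<delta>) = J \<beta> \<beta> * F \<beta>"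
    "(\<Sum>\<delta>\<in>UNIV. F \<delta> * J \<beta> \<delta>) = F \<beta> * J \<beta> \<beta>" "(\<Sum>\<delta>\<in>UNIV. F \<delta> * J \<delta> \<beta>) = F \<beta> * J \<beta> \<beta>"
  by (simp_all add: J_def if_distrib[of "\<lambda>x. x * _"] if_distrib[of "\<lambda>x. _ * x"] cong: if_cong)

text \<open>
  \<open>\<nabla>J = 0\<close> makes the last two indices of a Christoffel symbol of the same type, and by symmetry
  all three are.
\<close>

lemma connection_mixed:
  assumes "complex_connection \<A> \<Gamma>" "c \<in> \<A>" "x \<in> coords c"
  shows "\<Gamma> c x \<alpha> (Inl b) (Inr d) = 0" "\<Gamma> c x \<alpha> (Inr b) (Inl d) = 0"
    "\<Gamma> c x (Inl a) (Inr b) \<gamma> = 0" "\<Gamma> c x (Inr a) (Inl b) \<gamma> = 0"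
proof -
  have J: "\<Gamma> c x \<alpha> \<beta> \<gamma> * J \<beta> \<beta> - \<Gamma> c x \<alpha> \<beta> \<gamma> * J \<gamma> \<gamma> = 0" for \<alpha> \<beta> \<gamma>
    using assms by (simp add: complex_connection_def preserves_J_def sum_J)
  show 1: "\<Gamma> c x \<alpha> (Inl b) (Inr d) = 0" "\<Gamma> c x \<alpha> (Inr b) (Inl d) = 0" for \<alpha> b d
    using J[of \<alpha> "Inl b" "Inr d"] J[of \<alpha> "Inr b" "Inl d"] by (simp_all add: J_def)
  have sym: "\<Gamma> c x \<alpha> \<beta> \<gamma> = \<Gamma> c x \<beta> \<alpha> \<gamma>" for \<alpha> \<beta> \<gamma>
    using assms by (simp add: complex_connection_def torsion_free_def)
  show "\<Gamma> c x (Inl a) (Inr b) \<gamma> = 0" by (cases \<gamma>) (metis 1 sym)+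
  then show "\<Gamma> c x (Inr a) (Inl b) \<gamma> = 0" by (metis 1 sym sum.exhaust)
qed

lemma conn_trace_Inl:
  assumes "complex_connection \<A> \<Gamma>" "c \<in> \<A>" "x \<in> coords c"
  shows "conn_trace (\<Gamma> c) x (Inl a) = trace (conn_mat \<Gamma> c x a)"
  by (simp add: conn_trace_def trace_def conn_mat_def sum_idx connection_mixed[OF assms])

lemma cov_herm_contra_Inl:
  fixes \<Gamma> :: "('m, 'n::finite) conn"
  assumes "complex_connection \<A> \<Gamma>" "c \<in> \<A>" "x \<in> coords c"
  shows "cov_herm_contra k (\<Gamma> c) \<eta> x (Inl a) b d = (pd_mat (Inl a) \<eta> x + \<eta> x ** conn_mat \<Gamma> c x a
    + mat (of_int k / (of_nat CARD('n) + 1) * trace (conn_mat \<Gamma> c x a)) ** \<eta> x) $ b $ d"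
  by (simp add: cov_herm_contra_def conn_trace_Inl[OF assms] connection_mixed[OF assms])
     (simp add: matrix_matrix_mult_def conn_mat_def mult.commute)

lemma cov_herm_co_Inl:
  fixes \<Gamma> :: "('m, 'n::finite) conn"
  assumes "complex_connection \<A> \<Gamma>" "c \<in> \<A>" "x \<in> coords c"
  shows "cov_herm_co k (\<Gamma> c) H x (Inl a) b e = (pd_mat (Inl a) H x - conn_mat \<Gamma> c x a ** H x
    + mat (of_int k / (of_nat CARD('n) + 1) * trace (conn_mat \<Gamma> c x a)) ** H x) $ b $ e"
  by (simp add: cov_herm_co_def conn_trace_Inl[OF assms] connection_mixed[OF assms])
     (simp add: matrix_matrix_mult_def conn_mat_def)

lemma cov_herm_co_Inr:
  fixes \<Gamma> :: "('m, 'n::finite) conn"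
  assumes cc: "complex_connection \<A> \<Gamma>" "c \<in> \<A>" "x \<in> coords c" and op: "open (coords c)"
    and herm: "\<And>y a b. y \<in> coords c \<Longrightarrow> cnj (H y $ a $ b) = H y $ b $ a"
    and diff: "\<And>a b. (\<lambda>y. H y $ a $ b) differentiable (at x)"
  shows "cov_herm_co k (\<Gamma> c) H x (Inr a) b e = cnj (cov_herm_co k (\<Gamma> c) H x (Inl a) e b)"
proof -
  have G: "cnj (\<Gamma> c x \<alpha> \<beta> \<gamma>) = \<Gamma> c x (bar \<alpha>) (bar \<beta>) (bar \<gamma>)" for \<alpha> \<beta> \<gamma>
    using cc unfolding complex_connection_def affine_connection_def by blast
  have "pd (Inr a) (\<lambda>y. H y $ b $ e) x = pd (Inr a) (\<lambda>y. cnj (H y $ e $ b)) x"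
    by (rule pd_cong_open[OF op cc(3)]) (simp add: herm)
  then have pd: "pd (Inr a) (\<lambda>y. H y $ b $ e) x = cnj (pd (Inl a) (\<lambda>y. H y $ e $ b) x)"
    using pd_cnj[OF diff, of "Inr a" e b] by simp
  have tr: "cnj (conn_trace (\<Gamma> c) x (Inl a)) = conn_trace (\<Gamma> c) x (Inr a)"
    by (simp add: conn_trace_def sum_idx G)
  show ?thesis
    by (simp add: cov_herm_co_def pd tr herm[OF cc(3)] G connection_mixed[OF cc])
qed

lemma cprojective_complex_connection: "cprojective_manifold M \<A> \<C> \<Longrightarrow> \<Gamma> \<in> \<C> \<Longrightarrow> complex_connection \<A> \<Gamma>"
  by (auto simp: cprojective_manifold_def)

lemma cproj_change:
  fixes \<Gamma> :: "('m, 'n::finite) conn"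
  assumes cp: "cproj_equivalent \<A> \<Gamma> \<Gamma>'"
  obtains \<upsilon> :: "('m, 'n) chart \<Rightarrow> complex^'n \<Rightarrow> complex^'n"
    where "\<And>c b. c \<in> \<A> \<Longrightarrow> smooth_on (coords c) (\<lambda>x. \<upsilon> c x $ b)"
      and "\<And>c x a. c \<in> \<A> \<Longrightarrow> x \<in> coords c \<Longrightarrow>
        conn_mat \<Gamma>' c x a = conn_mat \<Gamma> c x a + mat (\<upsilon> c x $ a) + outer (\<upsilon> c x) (axis a 1)"
proof -
  obtain \<Upsilon> where \<Upsilon>: "real_one_form \<A> \<Upsilon>" and eq: "\<And>c x \<alpha> \<beta> \<gamma>. c \<in> \<A> \<Longrightarrow> x \<in> coords c \<Longrightarrow>
      \<Gamma>' c x \<alpha> \<beta> \<gamma> = \<Gamma> c x \<alpha> \<beta> \<gamma> + 1/2 * (\<Upsilon> c x \<alpha> * kron \<beta> \<gamma> + \<Upsilon> c x \<beta> * kron \<alpha> \<gamma>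
         - (\<Sum>\<delta>\<in>UNIV. J \<alpha> \<delta> * \<Upsilon> c x \<delta>) * J \<beta> \<gamma> - (\<Sum>\<delta>\<in>UNIV. J \<beta> \<delta> * \<Upsilon> c x \<delta>) * J \<alpha> \<gamma>)"
    using cp unfolding cproj_equivalent_def by blast
  define \<upsilon> where "\<upsilon> c x = (\<chi> b. \<Upsilon> c x (Inl b))" for c x
  show thesis
  proof (rule that[of \<upsilon>])
    show "smooth_on (coords c) (\<lambda>x. \<upsilon> c x $ b)" if "c \<in> \<A>" for c b
      using \<Upsilon> that by (simp add: real_one_form_def \<upsilon>_def)
    show "conn_mat \<Gamma>' c x a = conn_mat \<Gamma> c x a + mat (\<upsilon> c x $ a) + outer (\<upsilon> c x) (axis a 1)"
      if "c \<in> \<A>" "x \<in> coords c" for c x a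
    proof -
      have "- (\<i> * u * \<i>) = u" for u by (simp add: complex_eq_iff)
      then show ?thesis
        by (auto simp: vec_eq_iff conn_mat_def eq[OF that, unfolded sum_J] J_def kron_def mat_def \<upsilon>_def axis_def)
    qed
  qed
qed

lemma cprojective_change:
  fixes \<Gamma> :: "('m, 'n::finite) conn"
  assumes cp: "cprojective_manifold M \<A> \<C>" "\<Gamma> \<in> \<C>" "\<Gamma>' \<in> \<C>"
  obtains \<upsilon> :: "('m, 'n) chart \<Rightarrow> complex^'n \<Rightarrow> complex^'n"
    where "\<And>c b. c \<in> \<A> \<Longrightarrow> smooth_on (coords c) (\<lambda>x. \<upsilon> c x $ b)"
      and "\<And>c x a. c \<in> \<A> \<Longrightarrow> x \<in> coords c \<Longrightarrow>
        conn_mat \<Gamma>' c x a = conn_mat \<Gamma> c x a + mat (\<upsilon> c x $ a) + outer (\<upsilon> c x) (axis a 1)"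
proof -
  obtain \<Gamma>0 where 0: "cproj_equivalent \<A> \<Gamma>0 \<Gamma>" "cproj_equivalent \<A> \<Gamma>0 \<Gamma>'"
    using cp unfolding cprojective_manifold_def by blast
  obtain \<upsilon> :: "('m, 'n) chart \<Rightarrow> complex^'n \<Rightarrow> complex^'n" where
    s: "\<And>c b. c \<in> \<A> \<Longrightarrow> smooth_on (coords c) (\<lambda>x. \<upsilon> c x $ b)"
    and e: "\<And>c x a. c \<in> \<A> \<Longrightarrow> x \<in> coords c \<Longrightarrow>
        conn_mat \<Gamma> c x a = conn_mat \<Gamma>0 c x a + mat (\<upsilon> c x $ a) + outer (\<upsilon> c x) (axis a 1)"
    by (rule cproj_change[OF 0(1)]) blast
  obtain \<upsilon>' :: "('m, 'n) chart \<Rightarrow> complex^'n \<Rightarrow> complex^'n" where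
    s': "\<And>c b. c \<in> \<A> \<Longrightarrow> smooth_on (coords c) (\<lambda>x. \<upsilon>' c x $ b)"
    and e': "\<And>c x a. c \<in> \<A> \<Longrightarrow> x \<in> coords c \<Longrightarrow>
        conn_mat \<Gamma>' c x a = conn_mat \<Gamma>0 c x a + mat (\<upsilon>' c x $ a) + outer (\<upsilon>' c x) (axis a 1)"
    by (rule cproj_change[OF 0(2)]) blast
  have op: "open (coords c)" if "c \<in> \<A>" for c
    using cp that by (auto simp: cprojective_manifold_def intro: open_coords)
  show thesis
  proof (rule that[of "\<lambda>c x. \<upsilon>' c x - \<upsilon> c x"])
    show "smooth_on (coords c) (\<lambda>x. (\<upsilon>' c x - \<upsilon> c x) $ b)" if "c \<in> \<A>" for c b
      by (simp, intro smooth_on_diff op s s' that)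
    show "conn_mat \<Gamma>' c x a = conn_mat \<Gamma> c x a + mat ((\<upsilon>' c x - \<upsilon> c x) $ a) + outer (\<upsilon>' c x - \<upsilon> c x) (axis a 1)"
      if "c \<in> \<A>" "x \<in> coords c" for c x a
      by (auto simp: vec_eq_iff e[OF that] e'[OF that] mat_def axis_def algebra_simps)
  qed
qed

text \<open>
  The unbarred half of the metrisability equation, solved for the coordinate derivatives. The trace
  term comes from the weight \<open>(-1,-1)\<close>.
\<close>

definition chart_metrisability :: "('m, 'n::finite) conn \<Rightarrow> ('m, 'n) chart \<Rightarrow> ('m, 'n) herm_field \<Rightarrow> (complex^'n \<Rightarrow> complex^'n) \<Rightarrow> bool" where
  "chart_metrisability \<Gamma> c \<eta> X \<longleftrightarrow> (\<forall>x\<in>coords c. \<forall>a. pd_mat (Inl a) (\<eta> c) x = - (\<eta> c x ** conn_mat \<Gamma> c x a)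
      + mat (trace (conn_mat \<Gamma> c x a) / (of_nat CARD('n) + 1)) ** \<eta> c x - outer (X x) (axis a 1))"

text \<open>
  A change of connection by \<open>\<upsilon>\<close> changes the covariant derivative of a section of weight \<open>(-1,-1)\<close>
  only by a multiple of \<open>\<delta>\<^sub>a\<^sup>c\<close>, which is absorbed into \<open>X\<close>. So the metrisability equation holds for
  every connection in the class.
\<close>

lemma chart_metrisability_solution:
  fixes \<eta> :: "('m, 'n::finite) herm_field"
  assumes cp: "cprojective_manifold M \<A> \<C>" and sol: "metrisability_solution \<A> \<C> \<eta>"
    and \<Gamma>: "\<Gamma> \<in> \<C>" and c: "c \<in> \<A>"
  obtains X :: "complex^'n \<Rightarrow> complex^'n" where "\<And>b. smooth_on (coords c) (\<lambda>x. X x $ b)"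
    and "chart_metrisability \<Gamma> c \<eta> X"
proof -
  let ?N = "of_nat CARD('n) + 1 :: complex"
  have N: "?N \<noteq> 0" by (rule of_nat_plus_one_neq_0)
  have op: "open (coords c)" using cp c by (auto simp: cprojective_manifold_def intro: open_coords)
  obtain \<Gamma>' X where \<Gamma>': "\<Gamma>' \<in> \<C>" and X: "real_vector_field (-1) \<A> X"
    and eq: "\<And>x a b d. x \<in> coords c \<Longrightarrow> cov_herm_contra (-1) (\<Gamma>' c) (\<eta> c) x (Inl a) b d + kron a d * X c x (Inr b) = 0"
    using sol c unfolding metrisability_solution_def metrisability_eq_def by blast
  obtain \<upsilon> :: "('m, 'n) chart \<Rightarrow> complex^'n \<Rightarrow> complex^'n"
    where s: "\<And>c b. c \<in> \<A> \<Longrightarrow> smooth_on (coords c) (\<lambda>x. \<upsilon> c x $ b)"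
      and e: "\<And>c x a. c \<in> \<A> \<Longrightarrow> x \<in> coords c \<Longrightarrow>
        conn_mat \<Gamma>' c x a = conn_mat \<Gamma> c x a + mat (\<upsilon> c x $ a) + outer (\<upsilon> c x) (axis a 1)"
    using cprojective_change[OF cp \<Gamma> \<Gamma>'] by blast
  define Y where "Y x = (\<chi> b. X c x (Inr b)) + \<eta> c x *v \<upsilon> c x" for x
  show thesis
  proof (rule that[of Y])
    have "smooth_on (coords c) (\<lambda>x. \<eta> c x $ i $ j)" for i j
      using sol c op by (auto simp: metrisability_solution_def real_herm_contra_def intro!: smooth_on_nth)
    then show "smooth_on (coords c) (\<lambda>x. Y x $ b)" for b
      using X c unfolding Y_def matrix_vector_mult_def
      by (simp, intro smooth_intros op s c) (auto simp: real_vector_field_def)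
    show "chart_metrisability \<Gamma> c \<eta> Y"
      unfolding chart_metrisability_def
    proof (intro ballI allI)
      fix x a assume x: "x \<in> coords c"
      let ?G = "conn_mat \<Gamma> c x a" and ?G' = "conn_mat \<Gamma>' c x a"
      have tr: "trace ?G' = trace ?G + ?N * \<upsilon> c x $ a"
      proof -
        have "trace (mat (\<upsilon> c x $ a) :: complex^'n^'n) = of_nat CARD('n) * \<upsilon> c x $ a"
          by (simp add: trace_def mat_def)
        moreover have "trace (outer (\<upsilon> c x) (axis a 1)) = \<upsilon> c x $ a"
          by (simp add: trace_def axis_def if_distrib[of "\<lambda>x. _ * x"] cong: if_cong)
        ultimately show ?thesis by (simp add: e[OF c x] trace_add algebra_simps)
      qed
      have o: "\<eta> c x ** outer (\<upsilon> c x) (axis a 1) = outer (\<eta> c x *v \<upsilon> c x) (axis a 1)"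
        using mult_outer_mult[of "\<eta> c x" "\<upsilon> c x" "axis a 1" "mat 1"] by simp
      have w: "of_int (-1) / ?N * trace ?G' = - (trace ?G / ?N) - \<upsilon> c x $ a"
        unfolding tr using N by (simp add: field_simps)
      have p: "\<eta> c x ** ?G' = \<eta> c x ** ?G + mat (\<upsilon> c x $ a) ** \<eta> c x + outer (\<eta> c x *v \<upsilon> c x) (axis a 1)"
        unfolding e[OF c x] by (simp add: matrix_add_ldistrib mult_mat[of "\<eta> c x"] o)
      have "(pd_mat (Inl a) (\<eta> c) x + \<eta> c x ** ?G' + mat (of_int (-1) / ?N * trace ?G') ** \<eta> c x) $ b $ d
          + (axis a 1 $ d) * X c x (Inr b) = 0" for b d
        using eq[OF x, of a b d] cov_herm_contra_Inl[OF cprojective_complex_connection[OF cp \<Gamma>'] c x, of "-1" "\<eta> c" a b d]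
        by (simp add: kron_def axis_def eq_commute[of a])
      then show "pd_mat (Inl a) (\<eta> c) x = - (\<eta> c x ** ?G) + mat (trace ?G / ?N) ** \<eta> c x - outer (Y x) (axis a 1)"
        unfolding w p by (simp add: vec_eq_iff Y_def) (simp add: algebra_simps eq_neg_iff_add_eq_0)
    qed
  qed
qed

section \<open>Kaehler metrics on a complex manifold\<close>

definition hmat :: "('m, 'n::finite) tensor2_field \<Rightarrow> ('m, 'n) herm_field" where
  "hmat g c x = (\<chi> a b. g c x (Inl a) (Inr b))"

definition conj_transpose :: "complex^'n^'m \<Rightarrow> complex^'m^'n" where
  "conj_transpose A = (\<chi> i j. cnj (A $ j $ i))"

lemma conj_transpose_nth [simp]: "conj_transpose A $ i $ j = cnj (A $ j $ i)"
  by (simp add: conj_transpose_def)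

lemma conj_transpose_mult: "conj_transpose (A ** B) = conj_transpose B ** conj_transpose (A::complex^'n::finite^'n)"
  by (simp add: vec_eq_iff matrix_matrix_mult_def mult.commute)

lemma hermitian_metric_blocks:
  assumes "hermitian_metric \<A> g" "c \<in> \<A>" "x \<in> coords c"
  shows "g c x (Inl a) (Inl b) = 0" "g c x (Inr a) (Inr b) = 0"
    "g c x (Inl a) (Inr b) = hmat g c x $ a $ b" "g c x (Inr b) (Inl a) = hmat g c x $ a $ b"
    "cnj (hmat g c x $ a $ b) = hmat g c x $ b $ a"
proof -
  have J: "(\<Sum>\<gamma>\<in>UNIV. \<Sum>\<delta>\<in>UNIV. J \<alpha> \<gamma> * J \<beta> \<delta> * g c x \<gamma> \<delta>) = J \<alpha> \<alpha> * (J \<beta> \<beta> * g c x \<alpha> \<beta>)" for \<alpha> \<beta>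
    by (simp add: sum_J mult.assoc flip: sum_distrib_left)
  have eq: "g c x \<alpha> \<beta> = J \<alpha> \<alpha> * (J \<beta> \<beta> * g c x \<alpha> \<beta>)" for \<alpha> \<beta>
  proof -
    have "(\<Sum>\<gamma>\<in>UNIV. \<Sum>\<delta>\<in>UNIV. J \<alpha> \<gamma> * J \<beta> \<delta> * g c x \<gamma> \<delta>) = g c x \<alpha> \<beta>"
      using assms unfolding hermitian_metric_def by blast
    then show ?thesis by (simp only: J)
  qed
  show "g c x (Inl a) (Inl b) = 0" "g c x (Inr a) (Inr b) = 0"
    using eq[of "Inl a" "Inl b"] eq[of "Inr a" "Inr b"] by (simp_all add: J_def)
  have sym: "g c x \<alpha> \<beta> = g c x \<beta> \<alpha>" for \<alpha> \<beta> using assms by (simp add: hermitian_metric_def)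
  show "g c x (Inl a) (Inr b) = hmat g c x $ a $ b" "g c x (Inr b) (Inl a) = hmat g c x $ a $ b"
    by (simp_all add: hmat_def sym[of "Inr b"])
  have "cnj (g c x (Inl a) (Inr b)) = g c x (Inr a) (Inl b)"
    using assms by (auto simp: hermitian_metric_def real_covariant2_def)
  then show "cnj (hmat g c x $ a $ b) = hmat g c x $ b $ a"
    by (simp add: hmat_def sym[of "Inr a"])
qed

text \<open>
  The matrix of a hermitian metric on \<open>T\<^sup>1\<^sup>,\<^sup>0M \<oplus> T\<^sup>0\<^sup>,\<^sup>1M\<close> is block antidiagonal, hence so is its inverse.
\<close>

lemma inv_metric_blocks:
  fixes g :: "('m, 'n::finite) tensor2_field"
  assumes "hermitian_metric \<A> g" "c \<in> \<A>" "x \<in> coords c"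
  obtains P where "P ** hmat g c x = mat 1" "hmat g c x ** P = mat 1"
    "\<And>a b. inv_metric g c x (Inr a) (Inl b) = P $ a $ b" "\<And>a b. inv_metric g c x (Inl b) (Inr a) = P $ a $ b"
    "\<And>a b. inv_metric g c x (Inl a) (Inl b) = 0" "\<And>a b. inv_metric g c x (Inr a) (Inr b) = 0"
    "\<And>a b. cnj (P $ a $ b) = P $ b $ a"
proof -
  note g = hermitian_metric_blocks[OF assms]
  let ?h = "hmat g c x"
  let ?G = "\<chi> \<alpha> \<beta>. g c x \<alpha> \<beta> :: complex^('n idx)^('n idx)"
  have "\<exists>I. ?G ** I = mat 1 \<and> I ** ?G = mat 1"
    using assms unfolding hermitian_metric_def invertible_def by blast
  then have I: "matrix_inv ?G ** ?G = mat 1" unfolding matrix_inv_def by (rule someI2_ex) simp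
  let ?i = "inv_metric g c x"
  have "(matrix_inv ?G ** ?G) $ \<alpha> $ \<beta> = (if \<alpha> = \<beta> then 1 else 0)" for \<alpha> \<beta>
    unfolding I by (simp add: mat_def)
  then have i: "(\<Sum>\<gamma>\<in>UNIV. ?i \<alpha> \<gamma> * g c x \<gamma> \<beta>) = (if \<alpha> = \<beta> then 1 else 0)" for \<alpha> \<beta>
    by (simp add: matrix_matrix_mult_def inv_metric_def)
  define P where "P = (\<chi> a b. ?i (Inr a) (Inl b))"
  define Q where "Q = (\<chi> a b. ?i (Inl b) (Inr a))"
  have 1: "P ** ?h = mat 1"
    using i[of "Inr _" "Inr _"] by (simp add: vec_eq_iff matrix_matrix_mult_def mat_def sum_idx g P_def)
  then have 2: "?h ** P = mat 1" using matrix_left_right_inverse by blast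
  have "(?h ** Q) $ p $ q = mat 1 $ p $ q" for p q
    using i[of "Inl q" "Inl p"]
    by (simp add: matrix_matrix_mult_def mat_def sum_idx g Q_def mult.commute eq_commute[of q])
  then have "?h ** Q = mat 1" by (simp add: vec_eq_iff)
  then have "P ** ?h ** Q = P" by (simp add: matrix_mul_assoc[symmetric])
  then have PQ: "Q = P" by (simp add: 1)
  have ll: "(\<chi> a b. ?i (Inl a) (Inl b)) ** ?h = 0"
    using i[of "Inl _" "Inr _"] by (simp add: vec_eq_iff matrix_matrix_mult_def sum_idx g)
  then have "(\<chi> a b. ?i (Inl a) (Inl b)) ** (?h ** P) = 0" by (simp add: matrix_mul_assoc)
  then have ll: "?i (Inl a) (Inl b) = 0" for a b by (simp add: 2 vec_eq_iff)
  have "(\<chi> a b. ?i (Inr a) (Inr b)) ** transpose ?h = 0"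
    using i[of "Inr _" "Inl _"] by (simp add: vec_eq_iff matrix_matrix_mult_def transpose_def sum_idx g)
  then have "(\<chi> a b. ?i (Inr a) (Inr b)) ** (transpose ?h ** transpose P) = 0"
    by (simp add: matrix_mul_assoc)
  then have rr: "?i (Inr a) (Inr b) = 0" for a b
    by (simp add: matrix_transpose_mul[symmetric] 1 vec_eq_iff)
  have "conj_transpose ?h = ?h" by (simp add: vec_eq_iff g)
  then have "conj_transpose (P ** ?h) = ?h ** conj_transpose P" by (simp add: conj_transpose_mult)
  moreover have "conj_transpose (mat 1 :: complex^'n^'n) = mat 1" by (auto simp: vec_eq_iff mat_def)
  ultimately have "?h ** conj_transpose P = mat 1" by (simp add: 1)
  then have "P ** ?h ** conj_transpose P = P" by (simp add: matrix_mul_assoc[symmetric])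
  then have "conj_transpose P = P" by (simp add: 1)
  then have cP: "cnj (P $ b $ a) = P $ a $ b" for a b
    by (simp add: vec_eq_iff)
  show thesis
  proof (rule that[OF 1 2 _ _ ll rr cP])
    show "inv_metric g c x (Inr a) (Inl b) = P $ a $ b" for a b by (simp add: P_def)
    show "inv_metric g c x (Inl b) (Inr a) = P $ a $ b" for a b
      by (simp add: PQ[symmetric]) (simp add: Q_def)
  qed
qed

lemma compatible_metricD:
  assumes "compatible_metric \<A> \<C> g"
  obtains \<Gamma> where "\<Gamma> \<in> \<C>" "levi_civita \<A> \<Gamma> g" "hermitian_metric \<A> g"
  using assms unfolding compatible_metric_def pseudo_kaehler_def by blast

lemma levi_civita_pd:
  assumes cc: "complex_connection \<A> \<Gamma>" and lc: "levi_civita \<A> \<Gamma> g" and hm: "hermitian_metric \<A> g"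
    and c: "c \<in> \<A>" "x \<in> coords c"
  shows "pd_mat (Inl a) (hmat g c) x = conn_mat \<Gamma> c x a ** hmat g c x"
proof -
  have "pd (Inl a) (\<lambda>y. g c y (Inl b) (Inr e)) x - (\<Sum>\<delta>\<in>UNIV. \<Gamma> c x (Inl a) (Inl b) \<delta> * g c x \<delta> (Inr e))
          - (\<Sum>\<delta>\<in>UNIV. \<Gamma> c x (Inl a) (Inr e) \<delta> * g c x (Inl b) \<delta>) = 0" for b e
    using lc c unfolding levi_civita_def by blast
  then show ?thesis
    by (simp add: vec_eq_iff matrix_matrix_mult_def sum_idx connection_mixed[OF cc c] conn_mat_def
        hermitian_metric_blocks[OF hm c]) (simp add: hmat_def)
qed

lemma kaehler_chart_metric:
  assumes cp: "cprojective_manifold M \<A> \<C>" and g: "compatible_metric \<A> \<C> g" and c: "c \<in> \<A>"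
  shows "kaehler_chart (coords c) (hmat g c)"
proof -
  obtain \<Gamma> where \<Gamma>: "\<Gamma> \<in> \<C>" and lc: "levi_civita \<A> \<Gamma> g" and hm: "hermitian_metric \<A> g"
    using g by (rule compatible_metricD)
  note cc = cprojective_complex_connection[OF cp \<Gamma>]
  show ?thesis
  proof
    show "open (coords c)" using cp c by (auto simp: cprojective_manifold_def intro: open_coords)
    show "smooth_on (coords c) (\<lambda>x. hmat g c x $ i $ j)" for i j
      using hm c by (simp add: hermitian_metric_def real_covariant2_def hmat_def)
    show "cnj (hmat g c x $ a $ b) = hmat g c x $ b $ a" if "x \<in> coords c" for x a b
      using hermitian_metric_blocks[OF hm c that] by simp
    show "det (hmat g c x) \<noteq> 0" if x: "x \<in> coords c" for x
    proof -
      obtain P where "P ** hmat g c x = mat 1" using inv_metric_blocks[OF hm c x] .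
      then have "det P * det (hmat g c x) = 1" by (metis det_I det_mul)
      then show ?thesis by auto
    qed
    show "pd (Inl a) (\<lambda>y. hmat g c y $ b $ e) x = pd (Inl b) (\<lambda>y. hmat g c y $ a $ e) x"
      if x: "x \<in> coords c" for x a b e
    proof -
      have "conn_mat \<Gamma> c x a $ b $ d = conn_mat \<Gamma> c x b $ a $ d" for d
        using lc c x by (simp add: levi_civita_def torsion_free_def conn_mat_def)
      then show ?thesis
        using levi_civita_pd[OF cc lc hm c x, of a] levi_civita_pd[OF cc lc hm c x, of b]
        by (simp add: vec_eq_iff matrix_matrix_mult_def)
    qed
  qed
qed

lemma Omega_up_eq: "Omega_up g c x \<alpha> \<beta> = J \<beta> \<beta> * inv_metric g c x \<alpha> \<beta>"
  by (simp add: Omega_up_def sum_J)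

lemma real_vector_real: "cnj (real_vector V \<alpha>) = real_vector V (bar \<alpha>)"
  by (cases \<alpha>) auto

text \<open>
  With the unbarred gradient of \<open>f\<close> written as \<open>- h V\<close>, where \<open>h\<close> is the matrix of the metric, the
  inverse metric in the definition of the symplectic gradient cancels.
\<close>

lemma symp_grad_eq:
  assumes cp: "cprojective_manifold M \<A> \<C>" and g: "compatible_metric \<A> \<C> g"
    and c: "c \<in> \<A>" "x \<in> coords c" and f: "real_function \<A> f"
    and grad: "\<And>a. pd (Inl a) (f c) x = - (hmat g c x *v V) $ a"
  shows "symp_grad g f c x \<beta> = real_vector V \<beta>"
proof -
  interpret kaehler_chart "coords c" "hmat g c"
    by (rule kaehler_chart_metric[OF cp g c(1)])
  have hm: "hermitian_metric \<A> g" using g by (rule compatible_metricD)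
  let ?h = "hmat g c x"
  have fc: "smooth_on (coords c) (f c)" "\<And>y. y \<in> coords c \<Longrightarrow> f c y \<in> \<real>"
    using f c by (auto simp: real_function_def)
  have bar: "pd (Inr a) (f c) x = - cnj ((?h *v V) $ a)" for a
    using pd_bar_real[OF c(2) fc(2) smooth_on_differentiable[OF fc(1) c(2)]] grad by simp
  obtain P where P: "P ** ?h = mat 1" "\<And>a b. inv_metric g c x (Inr a) (Inl b) = P $ a $ b"
    "\<And>a b. inv_metric g c x (Inl b) (Inr a) = P $ a $ b" "\<And>a b. inv_metric g c x (Inl a) (Inl b) = 0"
    "\<And>a b. inv_metric g c x (Inr a) (Inr b) = 0" "\<And>a b. cnj (P $ a $ b) = P $ b $ a"
    by (rule inv_metric_blocks[OF hm c]) blast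
  have PhV: "(\<Sum>a\<in>UNIV. P $ b $ a * (?h *v V) $ a) = V $ b" for b
  proof -
    have "(P *v (?h *v V)) $ b = V $ b" by (simp add: matrix_vector_mul_assoc P(1))
    then show ?thesis by (simp only: matrix_vector_mult_def[of P] vec_lambda_beta)
  qed
  have PhVc: "(\<Sum>a\<in>UNIV. P $ a $ b * cnj ((?h *v V) $ a)) = cnj (V $ b)" for b
  proof -
    have "cnj (\<Sum>a\<in>UNIV. P $ b $ a * (?h *v V) $ a) = cnj (V $ b)" using PhV by simp
    then show ?thesis by (simp only: cnj_sum complex_cnj_mult P(6))
  qed
  show ?thesis
  proof (cases \<beta>)
    case (Inl b)
    have "symp_grad g f c x \<beta> = \<i> * (\<Sum>a\<in>UNIV. P $ a $ b * - cnj ((?h *v V) $ a))"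
      by (simp add: Inl symp_grad_def Omega_up_eq sum_idx P bar J_def sum_distrib_left mult.assoc)
    then show ?thesis using PhVc[of b] by (simp add: Inl sum_negf)
  next
    case (Inr b)
    have "symp_grad g f c x \<beta> = - \<i> * (\<Sum>a\<in>UNIV. P $ b $ a * - (?h *v V) $ a)"
      by (simp add: Inr symp_grad_def Omega_up_eq sum_idx P grad J_def sum_distrib_left mult.assoc)
    then show ?thesis using PhV[of b] by (simp add: Inr sum_negf)
  qed
qed

text \<open>
  The gradients of \<open>f\<close> in two charts are related by the chain rule. Cancelling the transformation
  law of the metric leaves the one of the vector field.
\<close>

lemma gradient_vector_field:
  fixes V :: "('m, 'n::finite) chart \<Rightarrow> complex^'n \<Rightarrow> complex^'n"
  assumes cp: "cprojective_manifold M \<A> \<C>" and g: "compatible_metric \<A> \<C> g" and f: "real_function \<A> f"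
    and smooth_V: "\<And>c b. c \<in> \<A> \<Longrightarrow> smooth_on (coords c) (\<lambda>x. V c x $ b)"
    and grad: "\<And>c x a. c \<in> \<A> \<Longrightarrow> x \<in> coords c \<Longrightarrow> pd (Inl a) (f c) x = - (hmat g c x *v V c x) $ a"
    and K: "\<And>c x \<beta>. c \<in> \<A> \<Longrightarrow> x \<in> coords c \<Longrightarrow> K c x \<beta> = real_vector (V c x) \<beta>"
  shows "real_vector_field 0 \<A> K"
proof -
  have cm: "complex_manifold M \<A>" using cp by (simp add: cprojective_manifold_def)
  have hm: "hermitian_metric \<A> g" using g by (rule compatible_metricD)
  show ?thesis
    unfolding real_vector_field_def
  proof (intro conjI ballI allI)
    show "smooth_on (coords c) (\<lambda>x. K c x \<alpha>)" if c: "c \<in> \<A>" for c \<alpha>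
    proof (rule smooth_on_cong[OF open_coords[OF cm c]])
      show "real_vector (V c x) \<alpha> = K c x \<alpha>" if "x \<in> coords c" for x using c that by (simp add: K)
      show "smooth_on (coords c) (\<lambda>x. real_vector (V c x) \<alpha>)"
        by (cases \<alpha>; simp; intro smooth_intros smooth_V c open_coords[OF cm c])
    qed
    show "cnj (K c x \<alpha>) = K c x (bar \<alpha>)" if "c \<in> \<A>" "x \<in> coords c" for c x \<alpha>
      by (simp add: K that real_vector_real)
    fix c d x \<kappa> assume c: "c \<in> \<A>" and d: "d \<in> \<A>" and x: "x \<in> overlap c d"
    let ?x = "trans_map c d x" and ?J = "hol_jac c d x"
    have xc: "x \<in> coords c" and xd: "?x \<in> coords d"
      using overlap_coords[OF x] trans_map_coords[OF cm c x] by auto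
    have h: "hmat g c x = transpose ?J ** hmat g d ?x ** cnj_mat ?J"
    proof -
      have "g c x (Inl b) (Inr a) = (\<Sum>\<kappa>\<in>UNIV. \<Sum>\<mu>\<in>UNIV. jac c d x \<kappa> (Inl b) * jac c d x \<mu> (Inr a) * g d ?x \<kappa> \<mu>)" for a b
        using hm c d x unfolding hermitian_metric_def real_covariant2_def by blast
      then have "\<forall>b a. 1 * hmat g c x $ b $ a = (\<Sum>q\<in>UNIV. \<Sum>p\<in>UNIV. jac c d x (Inl q) (Inl b) * jac c d x (Inr p) (Inr a)
             * hmat g d ?x $ q $ p)"
        by (simp add: sum_idx jac_mixed[OF cm c d x] hmat_def)
      then show ?thesis using herm_co_transform_iff[OF cm c d x, of 1 "hmat g"] by simp
    qed
    have "det (hmat g c x) \<noteq> 0"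
      using kaehler_chart.det_h[OF kaehler_chart_metric[OF cp g c] xc] .
    then have dJ: "det ?J \<noteq> 0" and dh: "det (hmat g d ?x) \<noteq> 0" unfolding h by (auto simp: det_mul)
    have "hmat g c x *v V c x = transpose ?J *v (hmat g d ?x *v V d ?x)"
    proof -
      have "(hmat g c x *v V c x) $ a = (\<Sum>p\<in>UNIV. ?J $ p $ a * (hmat g d ?x *v V d ?x) $ p)" for a
        using pd_transform[OF cm f c d x, of a] by (simp add: grad[OF c xc] grad[OF d xd] sum_negf)
      then show ?thesis by (simp add: vec_eq_iff matrix_vector_mult_def transpose_def)
    qed
    then have e: "transpose ?J ** hmat g d ?x *v (cnj_mat ?J *v V c x) = transpose ?J ** hmat g d ?x *v V d ?x"
      unfolding h by (simp add: matrix_vector_mul_assoc)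
    obtain D where D: "D ** (transpose ?J ** hmat g d ?x) = mat 1"
      by (rule inverse_matrix_exists[of "transpose ?J ** hmat g d ?x"]) (auto simp: det_mul dJ dh)
    have "D *v (transpose ?J ** hmat g d ?x *v (cnj_mat ?J *v V c x)) = D *v (transpose ?J ** hmat g d ?x *v V d ?x)"
      by (simp only: e)
    then have Vd: "V d ?x = cnj_mat ?J *v V c x"
      by (simp only: matrix_vector_mul_assoc[of D] D matrix_vector_mul_lid)
    have "density_factor 0 c d x = 1" using dJ by (simp add: density_factor_hol_jac)
    then show "K d ?x \<kappa> = density_factor 0 c d x * (\<Sum>\<alpha>\<in>UNIV. jac c d x \<kappa> \<alpha> * K c x \<alpha>)"
      unfolding K[OF c xc] K[OF d xd] Vd
      by (cases \<kappa>) (simp_all add: sum_idx jac_mixed[OF cm c d x] matrix_vector_mult_def hol_jac_def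
          sum_distrib_left mult_ac sum_negf)
  qed
qed

text \<open>
  The components of the Lie derivative of \<open>g\<close> with indices of equal type vanish because the field
  preserves \<open>J\<close>; the mixed ones vanish for every symplectic gradient.
\<close>

lemma symp_grad_holomorphic_killing:
  fixes V :: "('m, 'n::finite) chart \<Rightarrow> complex^'n \<Rightarrow> complex^'n"
  assumes cp: "cprojective_manifold M \<A> \<C>" and g: "compatible_metric \<A> \<C> g" and f: "real_function \<A> f"
    and smooth_V: "\<And>c b. c \<in> \<A> \<Longrightarrow> smooth_on (coords c) (\<lambda>x. V c x $ b)"
    and grad: "\<And>c x a. c \<in> \<A> \<Longrightarrow> x \<in> coords c \<Longrightarrow> pd (Inl a) (f c) x = - (hmat g c x *v V c x) $ a"
    and hol: "\<And>c x a b. c \<in> \<A> \<Longrightarrow> x \<in> coords c \<Longrightarrow> pd (Inl a) (\<lambda>y. V c y $ b) x = 0"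
    and K: "\<And>c x \<beta>. c \<in> \<A> \<Longrightarrow> x \<in> coords c \<Longrightarrow> K c x \<beta> = real_vector (V c x) \<beta>"
  shows "holomorphic_killing_field \<A> g K"
proof -
  have cm: "complex_manifold M \<A>" using cp by (simp add: cprojective_manifold_def)
  have hm: "hermitian_metric \<A> g" using g by (rule compatible_metricD)
  have diff_V: "(\<lambda>y. V c y $ b) differentiable (at x)" if "c \<in> \<A>" "x \<in> coords c" for c x b
    using smooth_on_differentiable[OF smooth_V] that .
  have pdK: "pd \<alpha> (\<lambda>y. K c y \<beta>) x = pd \<alpha> (\<lambda>y. real_vector (V c y) \<beta>) x" if "c \<in> \<A>" "x \<in> coords c" for c x \<alpha> \<beta>
    by (rule pd_cong_open[OF open_coords[OF cm that(1)] that(2)]) (simp add: K that)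
  have holK: "pd (Inl a) (\<lambda>y. real_vector (V c y) (Inr b)) x = 0" "pd (Inr a) (\<lambda>y. real_vector (V c y) (Inl b)) x = 0"
    if "c \<in> \<A>" "x \<in> coords c" for c x a b
  proof -
    show "pd (Inl a) (\<lambda>y. real_vector (V c y) (Inr b)) x = 0"
      using pd_cmult[OF diff_V[OF that], of "Inl a" \<i> b] by (simp add: hol that)
    have "(\<lambda>y. cnj (V c y $ b)) differentiable (at x)"
      using smooth_on_differentiable[OF smooth_on_cnj[OF open_coords[OF cm] smooth_V]] that by blast
    then show "pd (Inr a) (\<lambda>y. real_vector (V c y) (Inl b)) x = 0"
      using pd_cmult[of "\<lambda>y. cnj (V c y $ b)" x "Inr a" "-\<i>"] pd_cnj[OF diff_V[OF that], of "Inr a" b]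
      by (simp add: hol that)
  qed
  have LJ: "(\<Sum>\<gamma>\<in>UNIV. K c x \<gamma> * pd \<gamma> (\<lambda>_. J \<alpha> \<beta>) x + J \<gamma> \<beta> * pd \<alpha> (\<lambda>y. K c y \<gamma>) x
             - J \<alpha> \<gamma> * pd \<gamma> (\<lambda>y. K c y \<beta>) x) = 0" if cx: "c \<in> \<A>" "x \<in> coords c" for c x \<alpha> \<beta>
    unfolding pdK[OF cx]
  proof -
    have "J \<beta> \<beta> * pd \<alpha> (\<lambda>y. real_vector (V c y) \<beta>) x = J \<alpha> \<alpha> * pd \<alpha> (\<lambda>y. real_vector (V c y) \<beta>) x"
      by (cases \<alpha>; cases \<beta>) (simp_all add: J_def holK[OF cx] del: real_vector.simps)
    then show "(\<Sum>\<gamma>\<in>UNIV. K c x \<gamma> * pd \<gamma> (\<lambda>_. J \<alpha> \<beta>) x + J \<gamma> \<beta> * pd \<alpha> (\<lambda>y. real_vector (V c y) \<gamma>) x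
             - J \<alpha> \<gamma> * pd \<gamma> (\<lambda>y. real_vector (V c y) \<beta>) x) = 0"
      by (simp add: sum.distrib sum_subtractf sum_J)
  qed
  have Lg: "(\<Sum>\<gamma>\<in>UNIV. K c x \<gamma> * pd \<gamma> (\<lambda>y. g c y \<alpha> \<beta>) x + g c x \<gamma> \<beta> * pd \<alpha> (\<lambda>y. K c y \<gamma>) x
             + g c x \<alpha> \<gamma> * pd \<beta> (\<lambda>y. K c y \<gamma>) x) = 0" if cx: "c \<in> \<A>" "x \<in> coords c" for c x \<alpha> \<beta>
  proof -
    interpret kaehler_chart "coords c" "hmat g c"
      by (rule kaehler_chart_metric[OF cp g cx(1)])
    note hb = hermitian_metric_blocks[OF hm cx]
    have pg: "pd \<gamma> (\<lambda>y. g c y \<alpha> \<beta>) x = pd \<gamma> (\<lambda>y. G y) x" if "\<And>y. y \<in> coords c \<Longrightarrow> g c y \<alpha> \<beta> = G y" for \<alpha> \<beta> \<gamma> G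
      by (rule pd_cong_open[OF open_U cx(2) that])
    have LL: "pd \<gamma> (\<lambda>y. g c y (Inl a) (Inl b)) x = 0" "pd \<gamma> (\<lambda>y. g c y (Inr a) (Inr b)) x = 0" for a b \<gamma>
      using pg[of "Inl a" "Inl b" "\<lambda>_. 0"] pg[of "Inr a" "Inr b" "\<lambda>_. 0"] hermitian_metric_blocks[OF hm cx(1)] by simp_all
    have LR: "pd \<gamma> (\<lambda>y. g c y (Inl a) (Inr b)) x = pd \<gamma> (\<lambda>y. hmat g c y $ a $ b) x"
      "pd \<gamma> (\<lambda>y. g c y (Inr b) (Inl a)) x = pd \<gamma> (\<lambda>y. hmat g c y $ a $ b) x" for a b \<gamma>
      using pg[of "Inl a" "Inr b" "\<lambda>y. hmat g c y $ a $ b"] pg[of "Inr b" "Inl a" "\<lambda>y. hmat g c y $ a $ b"]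
        hermitian_metric_blocks[OF hm cx(1)] by simp_all
    have fc: "smooth_on (coords c) (f c)" "\<And>y. y \<in> coords c \<Longrightarrow> f c y \<in> \<real>"
      using f cx by (auto simp: real_function_def)
    note main = symplectic_gradient_killing[OF cx(2) fc smooth_V[OF cx(1)] grad[OF cx(1)]]
    show ?thesis
      unfolding pdK[OF cx] K[OF cx]
    proof (cases \<alpha>; cases \<beta>)
      let ?E = "\<lambda>\<alpha> \<beta>. (\<Sum>\<gamma>\<in>UNIV. real_vector (V c x) \<gamma> * pd \<gamma> (\<lambda>y. g c y \<alpha> \<beta>) x
        + g c x \<gamma> \<beta> * pd \<alpha> (\<lambda>y. real_vector (V c y) \<gamma>) x + g c x \<alpha> \<gamma> * pd \<beta> (\<lambda>y. real_vector (V c y) \<gamma>) x) = 0"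
      fix a b
      show "?E \<alpha> \<beta>" if "\<alpha> = Inl a" "\<beta> = Inl b"
        using that by (simp add: sum_idx hb LL holK[OF cx] del: real_vector.simps)
      show "?E \<alpha> \<beta>" if "\<alpha> = Inr a" "\<beta> = Inr b"
        using that by (simp add: sum_idx hb LL holK[OF cx] del: real_vector.simps)
      show "?E \<alpha> \<beta>" if "\<alpha> = Inl a" "\<beta> = Inr b"
        using that main[of a b] by (simp add: sum.distrib sum_idx hb LR del: real_vector.simps)
      show "?E \<alpha> \<beta>" if "\<alpha> = Inr a" "\<beta> = Inl b"
        using that main[of b a] by (simp add: sum.distrib sum_idx hb LR add_ac del: real_vector.simps)
    qed
  qed
  show ?thesis
    unfolding holomorphic_killing_field_def
    using LJ Lg gradient_vector_field[OF cp g f smooth_V grad K] by blast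
qed

text \<open>
  The bracket is \<open>\<i>\<close> times the difference of \<open>h(V, W)\<close> and its conjugate \<open>h(W, V)\<close>.
\<close>

lemma poisson_commuteI:
  fixes V W :: "('m, 'n::finite) chart \<Rightarrow> complex^'n \<Rightarrow> complex^'n"
  assumes cp: "cprojective_manifold M \<A> \<C>" and g: "compatible_metric \<A> \<C> g"
    and fh: "real_function \<A> f" "real_function \<A> h"
    and gf: "\<And>c x a. c \<in> \<A> \<Longrightarrow> x \<in> coords c \<Longrightarrow> pd (Inl a) (f c) x = - (hmat g c x *v V c x) $ a"
    and gh: "\<And>c x a. c \<in> \<A> \<Longrightarrow> x \<in> coords c \<Longrightarrow> pd (Inl a) (h c) x = - (hmat g c x *v W c x) $ a"
    and sym: "\<And>c x. c \<in> \<A> \<Longrightarrow> x \<in> coords c \<Longrightarrow>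
      sesquilinear (hmat g c x) (V c x) (W c x) = sesquilinear (hmat g c x) (W c x) (V c x)"
    and K: "\<And>c x \<beta>. c \<in> \<A> \<Longrightarrow> x \<in> coords c \<Longrightarrow> K c x \<beta> = real_vector (V c x) \<beta>"
    and K': "\<And>c x \<beta>. c \<in> \<A> \<Longrightarrow> x \<in> coords c \<Longrightarrow> K' c x \<beta> = real_vector (W c x) \<beta>"
  shows "poisson_commute \<A> g K K'"
proof -
  have "poisson_bracket g f h c x = 0" if cx: "c \<in> \<A>" "x \<in> coords c" for c x
  proof -
    interpret kaehler_chart "coords c" "hmat g c"
      by (rule kaehler_chart_metric[OF cp g cx(1)])
    let ?k = "hmat g c x" and ?V = "V c x" and ?W = "W c x"
    have hc: "smooth_on (coords c) (h c)" "\<And>y. y \<in> coords c \<Longrightarrow> h c y \<in> \<real>"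
      using fh cx by (auto simp: real_function_def)
    have bar: "pd (Inr a) (h c) x = - cnj ((?k *v ?W) $ a)" for a
      using pd_bar_real[OF cx(2) hc(2) smooth_on_differentiable[OF hc(1) cx(2)]] gh[OF cx] by simp
    have "(\<Sum>a\<in>UNIV. ?V $ a * cnj ((?k *v ?W) $ a)) = (\<Sum>a\<in>UNIV. \<Sum>b\<in>UNIV. ?V $ a * (?k $ b $ a * cnj (?W $ b)))"
      by (simp add: matrix_vector_mult_def hermitian_h[OF cx(2)] sum_distrib_left)
    also have "\<dots> = (\<Sum>a\<in>UNIV. cnj (?W $ a) * (?k *v ?V) $ a)"
      by (subst sum.swap) (simp add: matrix_vector_mult_def sum_distrib_left mult_ac)
    finally have r: "(\<Sum>a\<in>UNIV. ?V $ a * cnj ((?k *v ?W) $ a)) = (\<Sum>a\<in>UNIV. cnj (?V $ a) * (?k *v ?W) $ a)"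
      using sym[OF cx] by (simp add: sesquilinear_def)
    have "poisson_bracket g f h c x = (\<Sum>\<beta>\<in>UNIV. symp_grad g f c x \<beta> * pd \<beta> (h c) x)"
      by (simp add: poisson_bracket_def symp_grad_def sum_distrib_right) (rule sum.swap)
    also have "\<dots> = \<i> * (\<Sum>a\<in>UNIV. cnj (?V $ a) * (?k *v ?W) $ a) - \<i> * (\<Sum>a\<in>UNIV. ?V $ a * cnj ((?k *v ?W) $ a))"
      by (simp add: symp_grad_eq[OF cp g cx fh(1) gf[OF cx]] sum_idx gh[OF cx] bar sum_distrib_left mult_ac sum_negf)
    finally show ?thesis by (simp add: r)
  qed
  then show ?thesis
    unfolding poisson_commute_def
    using fh symp_grad_eq[OF cp g _ _ fh(1)] symp_grad_eq[OF cp g _ _ fh(2)] gf gh K K'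
    by (intro exI[of _ f] exI[of _ h]) simp
qed

text \<open>
  A Killing field of \<open>g\<close> acts on the weighted tensor \<open>\<eta>\<close> with \<open>g\<^sup>-\<^sup>1 = (det \<eta>) \<eta>\<close> as the Lie
  derivative of weight \<open>(-1,-1)\<close> predicts: it preserves \<open>\<eta>\<close>.
\<close>

lemma killing_field_weighted_inverse:
  fixes \<eta> :: "('m, 'n::finite) herm_field"
  assumes cp: "cprojective_manifold M \<A> \<C>" and g: "compatible_metric \<A> \<C> g"
    and K: "holomorphic_killing_field \<A> g K" and c: "c \<in> \<A>" "x \<in> coords c"
    and d\<eta>: "\<And>i j. (\<lambda>y. \<eta> c y $ i $ j) differentiable (at x)"
    and inv: "\<And>y. y \<in> coords c \<Longrightarrow> hmat g c y ** (mat (det (\<eta> c y)) ** \<eta> c y) = mat 1"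
  defines "M' \<equiv> \<chi> a b. pd (Inl a) (\<lambda>y. K c y (Inl b)) x" and "N' \<equiv> \<chi> a b. pd (Inr b) (\<lambda>y. K c y (Inr a)) x"
  shows "along_mat (K c x) (\<eta> c) x = \<eta> c x ** M' + N' ** \<eta> c x
    - mat ((trace M' + trace N') / (of_nat CARD('n) + 1)) ** \<eta> c x"
proof (rule along_weighted_inverse(1)[OF _ c(2) d\<eta> _ inv])
  interpret kaehler_chart "coords c" "hmat g c" by (rule kaehler_chart_metric[OF cp g c(1)])
  have hm: "hermitian_metric \<A> g" using g by (rule compatible_metricD)
  show "open (coords c)" by (rule open_U)
  show "(\<lambda>y. hmat g c y $ i $ j) differentiable (at x)" for i j by (rule diff_h[OF c(2)])
  have "(\<Sum>\<gamma>\<in>UNIV. K c x \<gamma> * pd \<gamma> (\<lambda>y. g c y (Inl a) (Inr b)) x + g c x \<gamma> (Inr b) * pd (Inl a) (\<lambda>y. K c y \<gamma>) x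
             + g c x (Inl a) \<gamma> * pd (Inr b) (\<lambda>y. K c y \<gamma>) x) = 0" for a b
    using K c unfolding holomorphic_killing_field_def by blast
  then have "along (K c x) (\<lambda>y. hmat g c y $ a $ b) x
      + (\<Sum>d\<in>UNIV. M' $ a $ d * hmat g c x $ d $ b) + (\<Sum>d\<in>UNIV. hmat g c x $ a $ d * N' $ d $ b) = 0" for a b
    by (simp add: sum.distrib along_def M'_def N'_def sum_idx hermitian_metric_blocks[OF hm c] mult_ac)
       (simp add: hmat_def)
  then show "along_mat (K c x) (hmat g c) x = - (M' ** hmat g c x) - hmat g c x ** N'"
    by (simp add: vec_eq_iff matrix_matrix_mult_def algebra_simps eq_neg_iff_add_eq_0)
qed

section \<open>Weights and the metric normalisation\<close>

lemma corresponds_inverse: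
  assumes g: "compatible_metric \<A> \<C> g" and corr: "corresponds_to_metric \<A> \<eta> g"
    and c: "c \<in> \<A>" "x \<in> coords c"
  shows "det (\<eta> c x) \<noteq> 0"
    "hmat g c x ** (mat (det (\<eta> c x)) ** \<eta> c x) = mat 1"
    "(mat (det (\<eta> c x)) ** \<eta> c x) ** hmat g c x = mat 1"
proof -
  have hm: "hermitian_metric \<A> g" using g by (rule compatible_metricD)
  obtain P where P: "P ** hmat g c x = mat 1" "hmat g c x ** P = mat 1"
    "\<And>a b. inv_metric g c x (Inr a) (Inl b) = P $ a $ b"
    by (rule inv_metric_blocks[OF hm c]) blast
  have "P = mat (det (\<eta> c x)) ** \<eta> c x"
    using corr c P(3) by (simp add: vec_eq_iff corresponds_to_metric_def det_contra_eq_det)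
  then show "hmat g c x ** (mat (det (\<eta> c x)) ** \<eta> c x) = mat 1"
    "(mat (det (\<eta> c x)) ** \<eta> c x) ** hmat g c x = mat 1" using P by auto
  show "det (\<eta> c x) \<noteq> 0" using corr c by (simp add: corresponds_to_metric_def det_contra_eq_det)
qed

lemma herm_contraD:
  assumes "real_herm_contra k \<A> \<eta>" "c \<in> \<A>"
  shows "open (coords c) \<Longrightarrow> smooth_on (coords c) (\<lambda>x. \<eta> c x $ i $ j)"
    "x \<in> coords c \<Longrightarrow> cnj (\<eta> c x $ i $ j) = \<eta> c x $ j $ i"
  using assms by (auto simp: real_herm_contra_def intro!: smooth_on_nth)

lemma herm_coD:
  assumes "real_herm_co k \<A> H" "c \<in> \<A>"
  shows "open (coords c) \<Longrightarrow> smooth_on (coords c) (\<lambda>x. H c x $ i $ j)"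
    "x \<in> coords c \<Longrightarrow> cnj (H c x $ i $ j) = H c x $ j $ i"
  using assms by (auto simp: real_herm_co_def intro!: smooth_on_nth)

text \<open>
  The density factor of weight \<open>(k,k)\<close> is \<open>D\<close> to the power \<open>k/(n+1)\<close>. For \<open>\<eta>\<close> of weight \<open>(-1,-1)\<close> the
  entries of \<open>adj \<eta>\<close> have degree \<open>n - 1\<close> and \<open>det \<eta>\<close> has degree \<open>n\<close> in \<open>\<eta>\<close>, and both acquire one
  factor \<open>D\<close> from the Jacobian.
\<close>

lemma density_factor_powers:
  fixes c d :: "('m, 'n::finite) chart"
  assumes "det (hol_jac c d x) \<noteq> 0"
  defines "\<rho> \<equiv> density_factor (-1) c d x" and "D \<equiv> det (cnj_mat (hol_jac c d x)) * det (hol_jac c d x)"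
  shows "\<rho> ^ (CARD('n) - 1) * D = density_factor 2 c d x" "(\<rho> ^ CARD('n) * D)\<^sup>2 = density_factor 2 c d x"
    "density_factor 0 c d x = 1"
proof -
  define r where "r = (cmod (det (hol_jac c d x)))\<^sup>2"
  have r: "r > 0" using assms(1) by (simp add: r_def)
  have D: "D = of_real r"
    unfolding D_def r_def det_cnj_mat complex_norm_square by (rule mult.commute)
  let ?N = "real CARD('n) + 1"
  have N: "?N > 0" by simp
  have pow: "\<rho> ^ m = of_real (r powr (- real m / ?N))" for m
  proof -
    have "\<rho> ^ m = of_real ((r powr (- 1 / ?N)) ^ m)" by (simp add: \<rho>_def density_factor_hol_jac r_def)
    also have "(r powr (- 1 / ?N)) ^ m = (r powr (- 1 / ?N)) powr real m"
      using r by (simp add: powr_realpow)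
    finally show ?thesis by (simp add: powr_powr)
  qed
  have two: "density_factor 2 c d x = of_real (r powr (2 / ?N))" by (simp add: density_factor_hol_jac r_def)
  have mul: "\<rho> ^ m * D = of_real (r powr (1 - real m / ?N))" for m
    using r powr_add[of r 1 "- real m / ?N"] by (simp add: pow D mult.commute)
  have "real (CARD('n) - 1) = real CARD('n) - 1" by (simp add: of_nat_diff Suc_leI)
  then have e: "1 - real (CARD('n) - 1) / ?N = 2 / ?N" using N by (simp add: field_simps)
  show "\<rho> ^ (CARD('n) - 1) * D = density_factor 2 c d x" by (simp only: mul two e)
  have "1 - real CARD('n) / ?N = 1 / ?N" using N by (simp add: field_simps)
  moreover have "(r powr (1 / ?N))\<^sup>2 = r powr (2 / ?N)"
    using r powr_add[of r "1 / ?N" "1 / ?N"] by (simp add: power2_eq_square add_divide_distrib[symmetric])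
  ultimately show "(\<rho> ^ CARD('n) * D)\<^sup>2 = density_factor 2 c d x" unfolding mul two by (simp flip: of_real_power)
  show "density_factor 0 c d x = 1" using r by (simp add: density_factor_hol_jac r_def)
qed

lemma herm_contra_det_jac:
  assumes cm: "complex_manifold M \<A>" and \<eta>: "real_herm_contra k \<A> \<eta>"
    and nz: "\<And>c x. c \<in> \<A> \<Longrightarrow> x \<in> coords c \<Longrightarrow> det (\<eta> c x) \<noteq> 0"
    and cd: "c \<in> \<A>" "d \<in> \<A>" "x \<in> overlap c d"
  shows "det (hol_jac c d x) \<noteq> 0"
  using nz[OF cd(2) trans_map_coords[OF cm cd(1,3)]]
  unfolding herm_contra_transform[OF cm \<eta> cd] by (auto simp: det_mul)

text \<open>
  As \<open>H\<close> is hermitian, the barred half of the Killing equation is the conjugate of the unbarred half.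
\<close>

lemma killing_eqI:
  assumes cm: "complex_manifold M \<A>" and cc: "complex_connection \<A> \<Gamma>" and H: "real_herm_co l \<A> H"
    and k: "\<And>c x a b e. c \<in> \<A> \<Longrightarrow> x \<in> coords c \<Longrightarrow>
      cov_herm_co k (\<Gamma> c) (H c) x (Inl a) b e + cov_herm_co k (\<Gamma> c) (H c) x (Inl b) a e = 0"
  shows "killing_eq k \<A> \<Gamma> H"
  unfolding killing_eq_def
proof (intro ballI allI conjI)
  fix c x a b e assume c: "c \<in> \<A>" "x \<in> coords c"
  show "cov_herm_co k (\<Gamma> c) (H c) x (Inl a) b e + cov_herm_co k (\<Gamma> c) (H c) x (Inl b) a e = 0"
    by (rule k[OF c])
  have "cov_herm_co k (\<Gamma> c) (H c) x (Inr a) b e = cnj (cov_herm_co k (\<Gamma> c) (H c) x (Inl a) e b)" for a b e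
    using smooth_on_differentiable[OF herm_coD(1)[OF H c(1) open_coords[OF cm c(1)]] c(2)] herm_coD(2)[OF H c(1)]
    by (intro cov_herm_co_Inr[OF cc c open_coords[OF cm c(1)]]) auto
  then show "cov_herm_co k (\<Gamma> c) (H c) x (Inr a) b e + cov_herm_co k (\<Gamma> c) (H c) x (Inr e) b a = 0"
    using k[OF c, of a e b] by (simp flip: complex_cnj_add)
qed

lemma untwist_herm_co:
  fixes \<eta> H :: "('m, 'n::finite) herm_field"
  assumes cm: "complex_manifold M \<A>" and \<eta>: "real_herm_contra (-1) \<A> \<eta>" and H: "real_herm_co 2 \<A> H"
    and nz: "\<And>c x. c \<in> \<A> \<Longrightarrow> x \<in> coords c \<Longrightarrow> det (\<eta> c x) \<noteq> 0"
  shows "real_herm_co 0 \<A> (untwist (tau \<eta>) H)"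
proof (rule real_herm_coI[OF cm])
  have u: "untwist (tau \<eta>) H c x $ b $ a = H c x $ b $ a / (det (\<eta> c x))\<^sup>2" for c x a b
    by (simp add: untwist_def tau_def det_contra_eq_det)
  show "smooth_on (coords c) (\<lambda>x. untwist (tau \<eta>) H c x $ b $ a)" if c: "c \<in> \<A>" for c b a
    unfolding u power2_eq_square
    using nz[OF c]
    by (intro smooth_intros smooth_on_det open_coords[OF cm c] herm_coD[OF H c] herm_contraD[OF \<eta> c]) auto
  show "cnj (untwist (tau \<eta>) H c x $ b $ a) = untwist (tau \<eta>) H c x $ a $ b" if c: "c \<in> \<A>" "x \<in> coords c" for c x b a
  proof -
    have "(\<chi> i j. cnj (\<eta> c x $ j $ i)) = \<eta> c x" by (simp add: vec_eq_iff herm_contraD[OF \<eta> c(1)] c(2))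
    then have "cnj (det (\<eta> c x)) = det (\<eta> c x)" by (simp add: det_conj_transpose)
    then show ?thesis by (simp add: u herm_coD[OF H c(1)] c(2))
  qed
  fix c d x assume cd: "c \<in> \<A>" "d \<in> \<A>" "x \<in> overlap c d"
  let ?x = "trans_map c d x" and ?J = "hol_jac c d x" and ?\<rho> = "density_factor (-1) c d x"
  have dJ: "det ?J \<noteq> 0" by (rule herm_contra_det_jac[OF cm \<eta> nz cd])
  have t: "(det (\<eta> d ?x))\<^sup>2 = density_factor 2 c d x * (det (\<eta> c x))\<^sup>2"
    unfolding herm_contra_transform[OF cm \<eta> cd] density_factor_powers(2)[OF dJ, symmetric]
    unfolding det_mat_mult by (simp add: det_mul power2_eq_square mult_ac)
  have dd: "det (\<eta> d ?x) \<noteq> 0" "det (\<eta> c x) \<noteq> 0"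
    using nz cd trans_map_coords[OF cm cd(1,3)] overlap_coords[OF cd(3)] by auto
  have Ht: "mat (density_factor 2 c d x) ** H c x = transpose ?J ** H d ?x ** cnj_mat ?J"
    using H cd unfolding herm_co_transform_iff[OF cm cd, symmetric] real_herm_co_def by blast
  have ud: "untwist (tau \<eta>) H d ?x = mat (1 / (det (\<eta> d ?x))\<^sup>2) ** H d ?x" for d x
    by (simp add: vec_eq_iff u)
  have "transpose ?J ** (mat (1 / (det (\<eta> d ?x))\<^sup>2) ** H d ?x) ** cnj_mat ?J
      = mat (1 / (det (\<eta> d ?x))\<^sup>2) ** (transpose ?J ** H d ?x ** cnj_mat ?J)"
    by (simp only: mult_mat[of "transpose ?J"] matrix_mul_assoc)
  also have "\<dots> = mat (1 / (det (\<eta> d ?x))\<^sup>2) ** (mat (density_factor 2 c d x) ** H c x)"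
    by (simp only: Ht)
  also have "\<dots> = mat (density_factor 0 c d x) ** untwist (tau \<eta>) H c x"
  proof -
    have "density_factor 2 c d x \<noteq> 0" using dd t by auto
    then show ?thesis using dd t by (simp add: vec_eq_iff u density_factor_powers(3)[OF dJ] field_simps)
  qed
  finally show "mat (density_factor 0 c d x) ** untwist (tau \<eta>) H c x
      = transpose ?J ** untwist (tau \<eta>) H d ?x ** cnj_mat ?J" by (simp add: ud)
qed

text \<open>
  For the Levi-Civita connection of \<open>g\<close> the density \<open>det \<eta>\<close> is parallel, so dividing by its square
  does not change the Killing equation.
\<close>

lemma untwist_killing:
  fixes \<eta> H :: "('m, 'n::finite) herm_field"
  assumes cp: "cprojective_manifold M \<A> \<C>" and \<eta>: "real_herm_contra (-1) \<A> \<eta>" and H: "real_herm_co 2 \<A> H"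
    and g: "compatible_metric \<A> \<C> g" and corr: "corresponds_to_metric \<A> \<eta> g"
    and killing: "\<And>\<Gamma>. \<Gamma> \<in> \<C> \<Longrightarrow> killing_eq 2 \<A> \<Gamma> H"
  shows "metric_killing_tensor \<A> g (untwist (tau \<eta>) H)"
proof -
  have cm: "complex_manifold M \<A>" using cp by (simp add: cprojective_manifold_def)
  note inv = corresponds_inverse[OF g corr]
  obtain \<Gamma> where \<Gamma>: "\<Gamma> \<in> \<C>" and lc: "levi_civita \<A> \<Gamma> g" and hm: "hermitian_metric \<A> g"
    using g by (rule compatible_metricD)
  note cc = cprojective_complex_connection[OF cp \<Gamma>]
  let ?U = "untwist (tau \<eta>) H"
  have U: "real_herm_co 0 \<A> ?U" by (rule untwist_herm_co[OF cm \<eta> H inv(1)])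
  have u: "?U c x $ b $ a = H c x $ b $ a / (det (\<eta> c x) * det (\<eta> c x))" for c x a b
    by (simp add: untwist_def tau_def det_contra_eq_det power2_eq_square)
  have cov: "cov_herm_co 0 (\<Gamma> c) (?U c) x (Inl a) b e = cov_herm_co 2 (\<Gamma> c) (H c) x (Inl a) b e / (det (\<eta> c x))\<^sup>2"
    if c: "c \<in> \<A>" "x \<in> coords c" for c x a b e
  proof -
    interpret kaehler_chart "coords c" "hmat g c" by (rule kaehler_chart_metric[OF cp g c(1)])
    let ?\<tau> = "\<lambda>y. det (\<eta> c y)" and ?G = "conn_mat \<Gamma> c x a"
    let ?s = "trace ?G / (of_nat CARD('n) + 1)"
    have d\<eta>: "(\<lambda>y. \<eta> c y $ i $ j) differentiable (at x)" for i j
      using smooth_on_differentiable[OF herm_contraD(1)[OF \<eta> c(1) open_U] c(2)] .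
    have dH: "(\<lambda>y. H c y $ i $ j) differentiable (at x)" for i j
      using smooth_on_differentiable[OF herm_coD(1)[OF H c(1) open_U] c(2)] .
    have d\<tau>: "?\<tau> differentiable (at x)" by (rule differentiable_det[OF d\<eta>])
    have "along_mat (kron (Inl a)) (hmat g c) x = - (- ?G ** hmat g c x) - hmat g c x ** 0"
      unfolding along_mat_kron levi_civita_pd[OF cc lc hm c] matrix_minus_left by simp
    from along_weighted_inverse(2)[OF open_U c(2) d\<eta> diff_h[OF c(2)] inv(2)[OF c(1)] this]
    have p\<tau>: "pd (Inl a) ?\<tau> x = - ?s * ?\<tau> x"
      by (simp add: along_kron trace_def sum_negf)
    have \<tau>0: "?\<tau> x \<noteq> 0" by (rule inv(1)[OF c])
    have quotient: "pd (Inl a) (\<lambda>y. ?U c y $ b $ e) x = (pd (Inl a) (\<lambda>y. H c y $ b $ e) x * (?\<tau> x * ?\<tau> x)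
        - H c x $ b $ e * pd (Inl a) (\<lambda>y. ?\<tau> y * ?\<tau> y) x) / (?\<tau> x * ?\<tau> x)\<^sup>2" for b e
      unfolding u by (rule pd_divide) (use dH d\<tau> \<tau>0 in auto)
    have pU: "pd (Inl a) (\<lambda>y. ?U c y $ b $ e) x
        = (pd (Inl a) (\<lambda>y. H c y $ b $ e) x + 2 * ?s * H c x $ b $ e) / (?\<tau> x)\<^sup>2" for b e
    proof -
      have "(A * (T * T) - B * (- S * T * T + T * (- S * T))) / (T * T)\<^sup>2 = (A + 2 * S * B) / T\<^sup>2"
        if "T \<noteq> 0" for A B S T :: complex
        using that by (simp add: field_simps power2_eq_square)
      from this[OF \<tau>0] show "pd (Inl a) (\<lambda>y. ?U c y $ b $ e) x
        = (pd (Inl a) (\<lambda>y. H c y $ b $ e) x + 2 * ?s * H c x $ b $ e) / (?\<tau> x)\<^sup>2" for b e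
        unfolding quotient pd_mult[OF d\<tau> d\<tau>] p\<tau> .
    qed
    show ?thesis
      unfolding cov_herm_co_Inl[OF cc c]
      by (simp add: pU) (simp add: u matrix_matrix_mult_def sum_divide_distrib add_divide_distrib
          diff_divide_distrib power2_eq_square algebra_simps)
  qed
  have "killing_eq 0 \<A> \<Gamma> ?U"
  proof (rule killing_eqI[OF cm cc U])
    fix c x a b e assume c: "c \<in> \<A>" "x \<in> coords c"
    have "cov_herm_co 2 (\<Gamma> c) (H c) x (Inl a) b e + cov_herm_co 2 (\<Gamma> c) (H c) x (Inl b) a e = 0"
      using killing[OF \<Gamma>] c unfolding killing_eq_def by blast
    then show "cov_herm_co 0 (\<Gamma> c) (?U c) x (Inl a) b e + cov_herm_co 0 (\<Gamma> c) (?U c) x (Inl b) a e = 0"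
      by (simp add: cov[OF c] flip: add_divide_distrib)
  qed
  then show ?thesis using U lc unfolding metric_killing_tensor_def by blast
qed

lemma det_shift_similar:
  assumes "det k \<noteq> 0" "M ** k = k ** (L::complex^'n::finite^'n)"
  shows "det (M - mat t) = det (L - mat t)" "dual_potential t M = dual_potential t L"
proof -
  have s: "det (M - mat t) = det (L - mat t)" for t
  proof -
    have "(M - mat t) ** k = k ** (L - mat t)"
      by (simp add: matrix_sub_rdistrib matrix_sub_ldistrib assms(2) mult_mat[of k])
    then have "det (M - mat t) * det k = det k * det (L - mat t)" by (metis det_mul)
    then show ?thesis using assms(1) by simp
  qed
  show "det (M - mat t) = det (L - mat t)" by (rule s)
  obtain i where i: "k ** i = mat 1" "i ** k = mat 1" using assms(1) by (rule inverse_matrix_exists)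
  have "trace (adj M) = trace (adj M ** k ** i)" by (simp add: matrix_mul_assoc[symmetric] i)
  also have "\<dots> = trace (k ** adj L ** i)" by (simp add: adj_intertwine[OF assms])
  also have "\<dots> = trace (adj L)" using trace_mul_sym[of "k ** adj L" i] by (simp add: matrix_mul_assoc i)
  finally show "dual_potential t M = dual_potential t L"
    using s[of 0] s[of t] by (simp add: dual_potential_def trace_mat_mult)
qed

section \<open>The metrisability pencil\<close>

locale metrisability_pencil =
  fixes M :: "'m topology"
    and \<A> :: "('m, 'n::finite) chart set"
    and \<C> :: "('m, 'n) conn set"
    and \<eta> \<eta>' :: "('m, 'n) herm_field"
    and g g' :: "('m, 'n) tensor2_field"
  assumes dim: "CARD('n) \<ge> 2"
    and cp: "cprojective_manifold M \<A> \<C>"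
    and sol: "metrisability_solution \<A> \<C> \<eta>" and sol': "metrisability_solution \<A> \<C> \<eta>'"
    and metric: "compatible_metric \<A> \<C> g" and metric': "compatible_metric \<A> \<C> g'"
    and corr: "corresponds_to_metric \<A> \<eta> g" and corr': "corresponds_to_metric \<A> \<eta>' g'"
begin

lemma cm: "complex_manifold M \<A>"
  using cp by (simp add: cprojective_manifold_def)

lemma herm: "real_herm_contra (-1) \<A> \<eta>" "real_herm_contra (-1) \<A> \<eta>'"
  using sol sol' by (simp_all add: metrisability_solution_def)

lemma diff_\<eta>:
  assumes "c \<in> \<A>" "x \<in> coords c"
  shows "(\<lambda>y. \<eta> c y $ i $ j) differentiable (at x)" "(\<lambda>y. \<eta>' c y $ i $ j) differentiable (at x)"
  using assms herm smooth_on_differentiable herm_contraD(1) open_coords[OF cm] by blast+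

lemmas inv = corresponds_inverse[OF metric corr]
lemmas inv' = corresponds_inverse[OF metric' corr']

text \<open>
  The matrix \<open>\<eta>' \<eta>\<^sup>-\<^sup>1\<close> is conjugate to \<open>A = \<eta>\<^sup>-\<^sup>1 \<eta>'\<close>, but its unbarred derivatives do not involve the
  connection: it acts on \<open>T\<^sup>0\<^sup>,\<^sup>1M\<close>, where the Christoffel symbols with unbarred first index vanish.
\<close>

definition L :: "('m, 'n) herm_field" where
  "L c x = \<eta>' c x ** (mat (inverse (det (\<eta> c x))) ** adj (\<eta> c x))"

lemma L_mult:
  assumes c: "c \<in> \<A>" "x \<in> coords c"
  shows "L c x ** \<eta> c x = \<eta>' c x"
proof -
  have "(mat (inverse (det (\<eta> c x))) ** adj (\<eta> c x)) ** \<eta> c x = mat 1"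
    using inv(1)[OF c] by (simp add: matrix_mul_assoc[symmetric] adj_mult mat_mult_mat)
  then show ?thesis by (simp only: L_def matrix_mul_assoc[symmetric] matrix_mul_rid)
qed

lemma det_L:
  assumes c: "c \<in> \<A>" "x \<in> coords c"
  shows "det (L c x) * det (\<eta> c x) = det (\<eta>' c x)" "det (L c x) \<noteq> 0"
proof -
  show 1: "det (L c x) * det (\<eta> c x) = det (\<eta>' c x)" using L_mult[OF c] by (metis det_mul)
  then show "det (L c x) \<noteq> 0" using inv'(1)[OF c] by auto
qed

lemma det_At_eq:
  assumes c: "c \<in> \<A>" "x \<in> coords c"
  shows "det_At \<eta> \<eta>' t c x = det (L c x - mat (of_real t))"
proof -
  obtain D where D: "\<eta> c x ** D = mat 1" "D ** \<eta> c x = mat 1"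
    using inv(1)[OF c] by (rule inverse_matrix_exists)
  have "A_endo \<eta> \<eta>' c x = D ** \<eta>' c x"
    unfolding A_endo_def
  proof (rule the_equality)
    show "\<eta>' c x = \<eta> c x ** (D ** \<eta>' c x)" by (simp add: matrix_mul_assoc D)
    show "A = D ** \<eta>' c x" if "\<eta>' c x = \<eta> c x ** A" for A
      unfolding that by (simp add: matrix_mul_assoc D)
  qed
  then have "\<eta> c x ** A_endo \<eta> \<eta>' c x = L c x ** \<eta> c x"
    by (simp add: matrix_mul_assoc D L_mult[OF c])
  then have "\<eta> c x ** (A_endo \<eta> \<eta>' c x - mat (of_real t)) = (L c x - mat (of_real t)) ** \<eta> c x"
    by (simp add: matrix_sub_ldistrib matrix_sub_rdistrib mult_mat[of "\<eta> c x"])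
  then have "det (\<eta> c x) * det (A_endo \<eta> \<eta>' c x - mat (of_real t)) = det (L c x - mat (of_real t)) * det (\<eta> c x)"
    by (metis det_mul)
  then show ?thesis using inv(1)[OF c] by (simp add: det_At_def)
qed

lemma second_metric:
  assumes c: "c \<in> \<A>" "x \<in> coords c"
  shows "hmat g c x = mat (det (L c x)) ** (hmat g' c x ** L c x)"
proof -
  let ?A = "mat (det (L c x)) ** (hmat g' c x ** L c x)" and ?P = "mat (det (\<eta> c x)) ** \<eta> c x"
  have "?A ** ?P = mat (det (L c x)) ** (hmat g' c x ** L c x ** ?P)"
    by (simp only: matrix_mul_assoc)
  also have "hmat g' c x ** L c x ** ?P = mat (det (\<eta> c x)) ** (hmat g' c x ** L c x ** \<eta> c x)"
    by (rule mult_mat_left)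
  also have "mat (det (L c x)) ** \<dots> = mat (det (L c x) * det (\<eta> c x)) ** (hmat g' c x ** (L c x ** \<eta> c x))"
    by (simp only: mat_mult_mat matrix_mul_assoc)
  also have "\<dots> = hmat g' c x ** (mat (det (\<eta>' c x)) ** \<eta>' c x)"
    by (simp only: det_L[OF c] L_mult[OF c] mult_mat_left[of "hmat g' c x"])
  also have "\<dots> = mat 1" by (rule inv'(2)[OF c])
  finally have "?A ** ?P ** hmat g c x = hmat g c x" by simp
  then show ?thesis by (simp only: matrix_mul_assoc[symmetric, of ?A] inv(3)[OF c] matrix_mul_rid)
qed

lemma selfadjoint:
  assumes c: "c \<in> \<A>" "x \<in> coords c"
  shows "(\<chi> i j. cnj (L c x $ j $ i)) ** hmat g c x = hmat g c x ** L c x"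
proof -
  let ?P = "mat (det (\<eta> c x)) ** \<eta> c x" and ?h = "hmat g c x" and ?Ls = "conj_transpose (L c x)"
  have "conj_transpose (\<eta> c x) = \<eta> c x" "conj_transpose (\<eta>' c x) = \<eta>' c x"
    by (simp_all add: vec_eq_iff herm_contraD(2)[OF herm(1) c(1)] herm_contraD(2)[OF herm(2) c(1)] c(2))
  then have "\<eta> c x ** ?Ls = L c x ** \<eta> c x" using L_mult[OF c] by (metis conj_transpose_mult)
  then have "?P ** ?Ls = L c x ** ?P"
    by (simp only: mult_mat_left[of "L c x"] matrix_mul_assoc[symmetric])
  then have "?h ** (?P ** ?Ls) ** ?h = ?h ** (L c x ** ?P) ** ?h" by simp
  then have "(?h ** ?P) ** ?Ls ** ?h = ?h ** L c x ** (?P ** ?h)" by (simp only: matrix_mul_assoc)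
  then show ?thesis by (simp add: inv[OF c] conj_transpose_def)
qed

text \<open>
  In the derivative of \<open>L \<eta> = \<eta>'\<close> the connection and weight terms of the two metrisability equations
  cancel. The factor \<open>det \<eta>\<close> in \<open>X\<close> converts \<open>\<eta>\<^sup>-\<^sup>1\<close> into the metric.
\<close>

lemma pencil_chart_exists:
  assumes c: "c \<in> \<A>"
  shows "\<exists>X. pencil_chart (coords c) (hmat g c) (L c) X"
proof -
  obtain \<Gamma> where \<Gamma>: "\<Gamma> \<in> \<C>" using metric by (rule compatible_metricD)
  obtain Y where Y: "\<And>b. smooth_on (coords c) (\<lambda>x. Y x $ b)"
    "chart_metrisability \<Gamma> c \<eta> Y"
    using chart_metrisability_solution[OF cp sol \<Gamma> c] by blast
  obtain Y' where Y': "\<And>b. smooth_on (coords c) (\<lambda>x. Y' x $ b)"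
    "chart_metrisability \<Gamma> c \<eta>' Y'"
    using chart_metrisability_solution[OF cp sol' \<Gamma> c] by blast
  interpret kaehler_chart "coords c" "hmat g c" by (rule kaehler_chart_metric[OF cp metric c])
  have "smooth_on (coords c) (\<lambda>x. (mat (inverse (det (\<eta> c x))) ** adj (\<eta> c x)) $ i $ j)" for i j
    by (simp, intro smooth_on_mult smooth_on_inverse smooth_on_det smooth_on_adj open_U
          herm_contraD(1)[OF herm(1) c] inv(1)[OF c])
  then have sL: "smooth_on (coords c) (\<lambda>x. L c x $ i $ j)" for i j
    unfolding L_def by (intro smooth_on_matrix_mult[OF open_U herm_contraD(1)[OF herm(2) c open_U]])
  define X where "X x = det (\<eta> c x) *s (Y' x - L c x *v Y x)" for x
  show ?thesis
  proof (rule exI[of _ X], unfold_locales)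
    show "CARD('n) \<ge> 2" by (rule dim)
    show "smooth_on (coords c) (\<lambda>x. L c x $ i $ j)" for i j by (rule sL)
    show "smooth_on (coords c) (\<lambda>x. X x $ b)" for b
      unfolding X_def matrix_vector_mult_def
      by (simp, intro smooth_on_mult smooth_on_diff smooth_on_sum smooth_on_det open_U
          herm_contraD(1)[OF herm(1) c] sL Y(1) Y'(1))
    fix x assume x: "x \<in> coords c"
    show "(\<chi> i j. cnj (L c x $ j $ i)) ** hmat g c x = hmat g c x ** L c x"
      by (rule selfadjoint[OF c x])
    have dL: "(\<lambda>y. L c y $ i $ j) differentiable (at x)" for i j
      by (rule smooth_on_differentiable[OF sL x])
    show "pd (Inl a) (\<lambda>y. L c y $ b $ e) x = - (X x $ b * hmat g c x $ a $ e)" for a b e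
    proof -
      let ?G = "conn_mat \<Gamma> c x a" and ?L = "L c x" and ?e = "axis a 1 :: complex^'n"
      let ?s = "mat (trace ?G / (of_nat CARD('n) + 1))"
      have "pd_mat (Inl a) (\<lambda>y. L c y ** \<eta> c y) x = pd_mat (Inl a) (\<eta>' c) x"
        by (rule pd_mat_cong_open[OF open_U x]) (rule L_mult[OF c])
      then have "pd_mat (Inl a) (L c) x ** \<eta> c x = pd_mat (Inl a) (\<eta>' c) x - ?L ** pd_mat (Inl a) (\<eta> c) x"
        by (simp add: pd_mat_mult[OF dL diff_\<eta>(1)[OF c x]] eq_diff_eq)
      moreover have L\<eta>: "?L ** (\<eta> c x ** Z) = \<eta>' c x ** Z" for Z :: "complex^'n^'n"
        by (simp add: matrix_mul_assoc L_mult[OF c x])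
      ultimately have "pd_mat (Inl a) (L c) x ** \<eta> c x = ?L ** outer (Y x) ?e - outer (Y' x) ?e"
        unfolding Y(2)[unfolded chart_metrisability_def, rule_format, OF x]
          Y'(2)[unfolded chart_metrisability_def, rule_format, OF x]
        by (simp add: matrix_sub_ldistrib matrix_add_ldistrib matrix_minus_right mult_mat_left[of ?L]
            L_mult[OF c x] L\<eta>)
      also have "\<dots> = - outer (Y' x - ?L *v Y x) ?e"
        using mult_outer_mult[of ?L "Y x" ?e "mat 1"] by (simp add: vec_eq_iff algebra_simps)
      finally have "pd_mat (Inl a) (L c) x ** \<eta> c x = - outer (Y' x - ?L *v Y x) ?e" .
      then have "pd_mat (Inl a) (L c) x ** (mat (det (\<eta> c x)) ** \<eta> c x) = - outer (X x) ?e"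
        by (simp only: mult_mat_left[of "pd_mat (Inl a) (L c) x"]) (simp add: vec_eq_iff X_def algebra_simps)
      then have "pd_mat (Inl a) (L c) x ** (mat (det (\<eta> c x)) ** \<eta> c x) ** hmat g c x
          = - (mat 1 ** outer (X x) ?e ** hmat g c x)"
        by (simp add: matrix_minus_left)
      then have "pd_mat (Inl a) (L c) x = - outer (X x) (?e v* hmat g c x)"
        unfolding mult_outer_mult by (simp add: matrix_mul_assoc[symmetric, of "pd_mat (Inl a) (L c) x"] inv(3)[OF c x])
      moreover have "(?e v* hmat g c x) $ e = hmat g c x $ a $ e"
        by (simp add: vector_matrix_mult_def axis_def if_distrib[of "\<lambda>x. x * _"] if_distrib[of "\<lambda>x. _ * x"] cong: if_cong)
      ultimately show ?thesis by (simp add: vec_eq_iff)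
    qed
  qed
qed

text \<open>
  The rank one equation determines \<open>X\<close> since \<open>h\<close> is nondegenerate, so nothing depends on the choice.
\<close>

definition X :: "('m, 'n) chart \<Rightarrow> complex^'n \<Rightarrow> complex^'n" where
  "X c = (SOME X. pencil_chart (coords c) (hmat g c) (L c) X)"

lemma pencil_chart: "c \<in> \<A> \<Longrightarrow> pencil_chart (coords c) (hmat g c) (L c) (X c)"
  unfolding X_def by (rule someI_ex[OF pencil_chart_exists])

definition Vt :: "real \<Rightarrow> ('m, 'n) chart \<Rightarrow> complex^'n \<Rightarrow> complex^'n" where
  "Vt t c x = pencil_chart.V (L c) (X c) (of_real t) x"

lemma smooth_Vt: "c \<in> \<A> \<Longrightarrow> smooth_on (coords c) (\<lambda>x. Vt t c x $ b)"
  unfolding Vt_def by (rule pencil_chart.smooth_V[OF pencil_chart])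

lemma holomorphic_Vt: "c \<in> \<A> \<Longrightarrow> x \<in> coords c \<Longrightarrow> pd (Inl a) (\<lambda>y. Vt t c y $ b) x = 0"
  unfolding Vt_def by (rule pencil_chart.pd_V[OF pencil_chart])

lemma L_transform:
  assumes cd: "c \<in> \<A>" "d \<in> \<A>" "x \<in> overlap c d"
  shows "det (cnj_mat (hol_jac c d x)) \<noteq> 0"
    "L d (trans_map c d x) ** cnj_mat (hol_jac c d x) = cnj_mat (hol_jac c d x) ** L c x"
proof -
  let ?x = "trans_map c d x" and ?J = "hol_jac c d x" and ?\<rho> = "density_factor (-1) c d x"
  have xc: "x \<in> coords c" and xd: "?x \<in> coords d"
    using overlap_coords[OF cd(3)] trans_map_coords[OF cm cd(1,3)] by auto
  have dJ: "det ?J \<noteq> 0" by (rule herm_contra_det_jac[OF cm herm(1) inv(1) cd])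
  then show "det (cnj_mat ?J) \<noteq> 0" by (simp add: det_cnj_mat)
  note t = herm_contra_transform[OF cm herm(1) cd] herm_contra_transform[OF cm herm(2) cd]
  have r: "?\<rho> \<noteq> 0" using inv(1)[OF cd(2) xd] unfolding t by (auto simp: det_mat_mult)
  have "L d ?x ** \<eta> d ?x = \<eta>' d ?x" by (rule L_mult[OF cd(2) xd])
  then have "mat ?\<rho> ** (L d ?x ** (cnj_mat ?J ** \<eta> c x ** transpose ?J))
      = mat ?\<rho> ** (cnj_mat ?J ** \<eta>' c x ** transpose ?J)"
    unfolding t by (simp only: mult_mat_left[of "L d ?x"])
  then have "L d ?x ** (cnj_mat ?J ** \<eta> c x ** transpose ?J) = cnj_mat ?J ** (L c x ** \<eta> c x) ** transpose ?J"
    by (simp add: mat_mult_left_cancel[OF r] L_mult[OF cd(1) xc])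
  then have e: "L d ?x ** cnj_mat ?J ** (\<eta> c x ** transpose ?J) = cnj_mat ?J ** L c x ** (\<eta> c x ** transpose ?J)"
    by (simp only: matrix_mul_assoc)
  obtain i where i: "(\<eta> c x ** transpose ?J) ** i = mat 1"
    by (rule inverse_matrix_exists[of "\<eta> c x ** transpose ?J"]) (auto simp: det_mul dJ inv(1)[OF cd(1) xc])
  have "L d ?x ** cnj_mat ?J ** ((\<eta> c x ** transpose ?J) ** i) = L d ?x ** cnj_mat ?J ** (\<eta> c x ** transpose ?J) ** i"
    by (rule matrix_mul_assoc)
  also have "\<dots> = cnj_mat ?J ** L c x ** (\<eta> c x ** transpose ?J) ** i" by (simp only: e)
  also have "\<dots> = cnj_mat ?J ** L c x ** ((\<eta> c x ** transpose ?J) ** i)"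
    by (rule matrix_mul_assoc[symmetric])
  finally show "L d ?x ** cnj_mat ?J = cnj_mat ?J ** L c x" by (simp only: i matrix_mul_rid)
qed

lemma potential_function: "real_function \<A> (det_At \<eta> \<eta>' t)"
  unfolding real_function_def
proof (intro conjI ballI)
  fix c assume c: "c \<in> \<A>"
  interpret pencil_chart "coords c" "hmat g c" "L c" "X c" by (rule pencil_chart[OF c])
  show "smooth_on (coords c) (det_At \<eta> \<eta>' t c)"
    by (rule smooth_on_cong[OF open_U _ smooth_potential[of "of_real t"]]) (simp add: det_At_eq c)
  show "det_At \<eta> \<eta>' t c x \<in> \<real>" if "x \<in> coords c" for x
    using potential_real[OF that] by (simp add: det_At_eq c that)
next
  fix c d x assume cd: "c \<in> \<A>" "d \<in> \<A>" "x \<in> overlap c d"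
  show "det_At \<eta> \<eta>' t d (trans_map c d x) = det_At \<eta> \<eta>' t c x"
    using det_shift_similar(1)[OF L_transform[OF cd]] overlap_coords[OF cd(3)] trans_map_coords[OF cm cd(1,3)] cd
    by (simp add: det_At_eq)
qed

lemma pd_det_At:
  assumes c: "c \<in> \<A>" "x \<in> coords c"
  shows "pd (Inl a) (det_At \<eta> \<eta>' t c) x = - (hmat g c x *v Vt t c x) $ a"
proof -
  interpret pencil_chart "coords c" "hmat g c" "L c" "X c" by (rule pencil_chart[OF c(1)])
  have "pd (Inl a) (det_At \<eta> \<eta>' t c) x = pd (Inl a) (\<lambda>y. det (L c y - mat (of_real t))) x"
    by (rule pd_cong_open[OF open_U c(2)]) (simp add: det_At_eq c)
  then show ?thesis by (simp add: pd_potential[OF c(2)] Vt_def)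
qed

definition second_potential :: "real \<Rightarrow> ('m, 'n) scalar_field" where
  "second_potential t c x = dual_potential (of_real t) (L c x)"

lemma second_potential_function: "real_function \<A> (second_potential t)"
  unfolding real_function_def
proof (intro conjI ballI)
  fix c assume c: "c \<in> \<A>"
  interpret pencil_chart "coords c" "hmat g c" "L c" "X c" by (rule pencil_chart[OF c])
  show "smooth_on (coords c) (second_potential t c)"
    unfolding second_potential_def[abs_def] by (rule smooth_dual_potential[OF det_L(2)[OF c]])
  show "second_potential t c x \<in> \<real>" if "x \<in> coords c" for x
    unfolding second_potential_def by (rule dual_potential_real[OF that det_L(2)[OF c that]])
next
  fix c d x assume cd: "c \<in> \<A>" "d \<in> \<A>" "x \<in> overlap c d"
  show "second_potential t d (trans_map c d x) = second_potential t c x"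
    using det_shift_similar(2)[OF L_transform[OF cd]] by (simp add: second_potential_def)
qed

lemma pd_second_potential:
  assumes c: "c \<in> \<A>" "x \<in> coords c"
  shows "pd (Inl a) (second_potential t c) x = - (hmat g' c x *v Vt t c x) $ a"
proof -
  interpret pencil_chart "coords c" "hmat g c" "L c" "X c" by (rule pencil_chart[OF c(1)])
  show ?thesis
    using pd_dual_potential[OF c(2) det_L(2)[OF c(1)] second_metric[OF c], of a "of_real t"]
    by (simp add: second_potential_def[abs_def] Vt_def)
qed

lemma Kt_eq: "c \<in> \<A> \<Longrightarrow> x \<in> coords c \<Longrightarrow> Kt g \<eta> \<eta>' t c x \<beta> = real_vector (Vt t c x) \<beta>"
  unfolding Kt_def by (rule symp_grad_eq[OF cp metric _ _ potential_function pd_det_At])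

lemma killing_fields:
  "holomorphic_killing_field \<A> g (Kt g \<eta> \<eta>' t)" "holomorphic_killing_field \<A> g' (Kt g \<eta> \<eta>' t)"
  by (rule symp_grad_holomorphic_killing[OF cp metric potential_function smooth_Vt pd_det_At holomorphic_Vt Kt_eq]
      symp_grad_holomorphic_killing[OF cp metric' second_potential_function smooth_Vt pd_second_potential
        holomorphic_Vt Kt_eq]; assumption)+

lemma pairing:
  assumes c: "c \<in> \<A>" "x \<in> coords c"
  shows "sesquilinear (hmat g c x) (Vt s c x) (Vt t c x)
      = sesquilinear (hmat g c x) (Vt t c x) (Vt s c x)"
    "sesquilinear (hmat g' c x) (Vt s c x) (Vt t c x)
      = sesquilinear (hmat g' c x) (Vt t c x) (Vt s c x)"
proof -
  interpret k: kaehler_chart "coords c" "hmat g' c" by (rule kaehler_chart_metric[OF cp metric' c(1)])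
  interpret pencil_chart "coords c" "hmat g c" "L c" "X c" by (rule pencil_chart[OF c(1)])

  show "sesquilinear (hmat g c x) (Vt s c x) (Vt t c x)
      = sesquilinear (hmat g c x) (Vt t c x) (Vt s c x)"
    unfolding Vt_def by (rule V_pairing_symmetric[OF c(2) det_h[OF c(2)] selfadjoint_L[OF c(2)]])
  let ?h' = "hmat g' c x" and ?Ls = "conj_transpose (L c x)" and ?d = "det (L c x)"
  have d: "?d \<noteq> 0" "cnj ?d = ?d"
    using det_L(2)[OF c] potential_real[OF c(2), of 0] by (simp_all add: Reals_cnj_iff)
  have hh: "conj_transpose ?h' = ?h'" "conj_transpose (hmat g c x) = hmat g c x"
    by (simp_all add: vec_eq_iff k.hermitian_h[OF c(2)] hermitian_h[OF c(2)])
  have "mat ?d ** (?Ls ** ?h') = conj_transpose (mat ?d ** (?h' ** L c x))"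
    using conj_transpose_mult[of ?h' "L c x"] by (simp add: vec_eq_iff hh d)
  also have "\<dots> = mat ?d ** (?h' ** L c x)" by (simp only: second_metric[OF c, symmetric] hh)
  finally have "?Ls ** ?h' = ?h' ** L c x" by (simp only: mat_mult_left_cancel[OF d(1)])
  then show "sesquilinear ?h' (Vt s c x) (Vt t c x)
      = sesquilinear ?h' (Vt t c x) (Vt s c x)"
    unfolding Vt_def by (intro V_pairing_symmetric[OF c(2) k.det_h[OF c(2)]]) (simp add: conj_transpose_def)
qed

lemma poisson_commuting:
  "poisson_commute \<A> g (Kt g \<eta> \<eta>' s) (Kt g \<eta> \<eta>' t)" "poisson_commute \<A> g' (Kt g \<eta> \<eta>' s) (Kt g \<eta> \<eta>' t)"
  by (rule poisson_commuteI[OF cp metric potential_function potential_function pd_det_At pd_det_At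
        pairing(1) Kt_eq Kt_eq]
      poisson_commuteI[OF cp metric' second_potential_function second_potential_function
        pd_second_potential pd_second_potential pairing(2) Kt_eq Kt_eq]; assumption)+

subsection \<open>Killing tensors\<close>

lemma pencil_matrix: "pencil \<eta> \<eta>' t c x = \<eta>' c x - mat (of_real t) ** \<eta> c x"
  by (simp add: pencil_def vec_eq_iff) (simp add: scaleR_conv_of_real)

lemma diff_pencil:
  assumes "c \<in> \<A>" "x \<in> coords c"
  shows "(\<lambda>y. pencil \<eta> \<eta>' t c y $ i $ j) differentiable (at x)"
  unfolding pencil_matrix using diff_\<eta>[OF assms] by simp

lemma Ht_herm_co: "real_herm_co 2 \<A> (Ht \<eta> \<eta>' t)"
proof (rule real_herm_coI[OF cm])
  show "smooth_on (coords c) (\<lambda>x. Ht \<eta> \<eta>' t c x $ b $ a)" if c: "c \<in> \<A>" for c b a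
    unfolding Ht_def pencil_matrix
    by (intro smooth_on_adj open_coords[OF cm c])
       (simp, intro smooth_intros open_coords[OF cm c] herm_contraD(1)[OF herm(1) c] herm_contraD(1)[OF herm(2) c])
  show "cnj (Ht \<eta> \<eta>' t c x $ b $ a) = Ht \<eta> \<eta>' t c x $ a $ b" if c: "c \<in> \<A>" "x \<in> coords c" for c x b a
  proof -
    have "(\<chi> i j. cnj (pencil \<eta> \<eta>' t c x $ j $ i)) = pencil \<eta> \<eta>' t c x"
      unfolding pencil_matrix
      by (simp add: vec_eq_iff herm_contraD(2)[OF herm(1) c(1) c(2)] herm_contraD(2)[OF herm(2) c(1) c(2)])
    then show ?thesis by (simp add: Ht_def adj_conj_transpose)
  qed
  fix c d x assume cd: "c \<in> \<A>" "d \<in> \<A>" "x \<in> overlap c d"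
  let ?x = "trans_map c d x" and ?J = "hol_jac c d x" and ?\<rho> = "density_factor (-1) c d x"
  have dJ: "det ?J \<noteq> 0" by (rule herm_contra_det_jac[OF cm herm(1) inv(1) cd])
  have "pencil \<eta> \<eta>' t d ?x = mat ?\<rho> ** (cnj_mat ?J ** pencil \<eta> \<eta>' t c x ** transpose ?J)"
  proof -
    have j: "cnj_mat ?J ** pencil \<eta> \<eta>' t c x ** transpose ?J
        = cnj_mat ?J ** \<eta>' c x ** transpose ?J - mat (of_real t) ** (cnj_mat ?J ** \<eta> c x ** transpose ?J)"
      by (simp only: pencil_matrix matrix_sub_ldistrib matrix_sub_rdistrib matrix_mul_assoc mult_mat[of "cnj_mat ?J"])
    show ?thesis
      unfolding j pencil_matrix[of t d] herm_contra_transform[OF cm herm(1) cd] herm_contra_transform[OF cm herm(2) cd]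
      by (simp add: vec_eq_iff algebra_simps)
  qed
  then have "Ht \<eta> \<eta>' t d ?x = mat (?\<rho> ^ (CARD('n) - 1)) ** adj (cnj_mat ?J ** pencil \<eta> \<eta>' t c x ** transpose ?J)"
    by (simp add: Ht_def adj_mat_mult)
  then have "transpose ?J ** Ht \<eta> \<eta>' t d ?x ** cnj_mat ?J = mat (?\<rho> ^ (CARD('n) - 1)) **
      (transpose ?J ** adj (cnj_mat ?J ** pencil \<eta> \<eta>' t c x ** transpose ?J) ** cnj_mat ?J)"
    by (simp only: mult_mat[of "transpose ?J"] matrix_mul_assoc)
  also have "\<dots> = mat (?\<rho> ^ (CARD('n) - 1) * (det (cnj_mat ?J) * det ?J)) ** Ht \<eta> \<eta>' t c x"
    using dJ by (subst adj_congruence) (simp_all add: det_cnj_mat Ht_def mat_mult_mat_assoc)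
  also have "\<dots> = mat (density_factor 2 c d x) ** Ht \<eta> \<eta>' t c x"
    by (simp only: density_factor_powers(1)[OF dJ])
  finally show "mat (density_factor 2 c d x) ** Ht \<eta> \<eta>' t c x = transpose ?J ** Ht \<eta> \<eta>' t d ?x ** cnj_mat ?J" ..
qed

text \<open>
  The connection terms of the derivative of the adjugate are those of the bundle
  \<open>\<Lambda>\<^sup>1\<^sup>,\<^sup>0 \<otimes> \<Lambda>\<^sup>0\<^sup>,\<^sup>1(2,2)\<close>; what remains is the derivative along the rank one term of the
  metrisability equation.
\<close>

lemma killing_Ht:
  assumes \<Gamma>: "\<Gamma> \<in> \<C>"
  shows "killing_eq 2 \<A> \<Gamma> (Ht \<eta> \<eta>' t)"
proof -
  note cc = cprojective_complex_connection[OF cp \<Gamma>]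
  let ?H = "Ht \<eta> \<eta>' t"
  show ?thesis
  proof (rule killing_eqI[OF cm cc Ht_herm_co])
    fix c x a b e assume c: "c \<in> \<A>" "x \<in> coords c"
    obtain Y where "\<And>b. smooth_on (coords c) (\<lambda>x. Y x $ b)" and Y: "chart_metrisability \<Gamma> c \<eta> Y"
      using chart_metrisability_solution[OF cp sol \<Gamma> c(1)] by blast
    obtain Y' where "\<And>b. smooth_on (coords c) (\<lambda>x. Y' x $ b)" and Y': "chart_metrisability \<Gamma> c \<eta>' Y'"
      using chart_metrisability_solution[OF cp sol' \<Gamma> c(1)] by blast
    let ?C = "pencil \<eta> \<eta>' t c x"
    define y where "y = Y' x - of_real t *s Y x"
    have "cov_herm_co 2 (\<Gamma> c) (?H c) x (Inl a) b e = - dadj ?C (outer y (axis a 1)) $ b $ e" for a b e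
    proof -
      let ?G = "conn_mat \<Gamma> c x a" and ?N = "of_nat CARD('n) + 1 :: complex"
      let ?s = "trace ?G / ?N"
      have N: "?N \<noteq> 0" by (rule of_nat_plus_one_neq_0)
      have "pd_mat (Inl a) (pencil \<eta> \<eta>' t c) x = pd_mat (Inl a) (\<eta>' c) x - mat (of_real t) ** pd_mat (Inl a) (\<eta> c) x"
        unfolding pencil_matrix[abs_def] using diff_\<eta>[OF c] by (simp add: vec_eq_iff pd_diff pd_cmult)
      also have "\<dots> = mat ?s ** ?C - ?C ** ?G - outer y (axis a 1)"
        unfolding Y[unfolded chart_metrisability_def, rule_format, OF c(2)]
          Y'[unfolded chart_metrisability_def, rule_format, OF c(2)] pencil_matrix
        by (simp add: matrix_sub_rdistrib matrix_mul_assoc[symmetric]) (simp add: vec_eq_iff y_def algebra_simps)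
      finally have pC: "pd_mat (Inl a) (pencil \<eta> \<eta>' t c) x = mat ?s ** ?C - ?C ** ?G - outer y (axis a 1)" .
      have "pd_mat (Inl a) (?H c) x = dadj ?C (pd_mat (Inl a) (pencil \<eta> \<eta>' t c) x)"
        by (simp add: vec_eq_iff Ht_def pd_adj[OF diff_pencil[OF c]])
      then have pH: "pd_mat (Inl a) (?H c) x = mat ?s ** (mat (of_nat CARD('n) - 1) ** ?H c x)
          - (mat (trace ?G) ** ?H c x - ?G ** ?H c x) - dadj ?C (outer y (axis a 1))"
        by (simp only: pC dadj_diff dadj_mat_mult dadj_self dadj_right Ht_def)
      have "?s * (of_nat CARD('n) - 1) + 2 / ?N * trace ?G = trace ?G"
        using N by (simp add: divide_simps) (simp add: algebra_simps)
      then have w: "?s * ((of_nat CARD('n) - 1) * h) + of_int 2 / ?N * trace ?G * h = trace ?G * h" for h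
        by (simp only: mult.assoc[symmetric] distrib_right[symmetric] of_int_numeral)
      have "A - (T - G) - D - G + B = - D" if "A + B = T" for A B D G T :: complex
        unfolding that[symmetric] by simp
      from this[OF w] show ?thesis
        unfolding cov_herm_co_Inl[OF cc c] pH by (simp only: vector_add_component vector_minus_component mat_mult_nth)
    qed
    then show "cov_herm_co 2 (\<Gamma> c) (?H c) x (Inl a) b e + cov_herm_co 2 (\<Gamma> c) (?H c) x (Inl b) a e = 0"
      using dadj_outer_antisym[of ?C y a b e] by (simp add: add_eq_0_iff)
  qed
qed

text \<open>
  The Killing fields preserve both metrics, hence \<open>\<eta>\<close>, \<open>\<eta>'\<close> and the whole pencil, on which
  \<open>Ht\<close> depends naturally.
\<close>

lemma lie_invariant_Ht: "lie_invariant 2 \<A> (Kt g \<eta> \<eta>' s) (Ht \<eta> \<eta>' t)"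
  unfolding lie_invariant_def
proof (intro ballI allI)
  fix c x b a assume c: "c \<in> \<A>" "x \<in> coords c"
  let ?K = "Kt g \<eta> \<eta>' s" and ?C = "pencil \<eta> \<eta>' t c x" and ?H = "Ht \<eta> \<eta>' t c x"
  let ?N = "of_nat CARD('n) + 1 :: complex"
  define M' :: "complex^'n^'n" where "M' = (\<chi> a b. pd (Inl a) (\<lambda>y. ?K c y (Inl b)) x)"
  define N' :: "complex^'n^'n" where "N' = (\<chi> a b. pd (Inr b) (\<lambda>y. ?K c y (Inr a)) x)"
  define \<delta> where "\<delta> = (trace M' + trace N') / ?N"
  have N: "?N \<noteq> 0" by (rule of_nat_plus_one_neq_0)
  have e: "along_mat (?K c x) (\<eta> c) x = \<eta> c x ** M' + N' ** \<eta> c x - mat \<delta> ** \<eta> c x"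
    unfolding M'_def N'_def \<delta>_def
    by (rule killing_field_weighted_inverse[OF cp metric killing_fields(1) c],
        rule diff_\<eta>(1)[OF c], rule inv(2)[OF c(1)])
  have e': "along_mat (?K c x) (\<eta>' c) x = \<eta>' c x ** M' + N' ** \<eta>' c x - mat \<delta> ** \<eta>' c x"
    unfolding M'_def N'_def \<delta>_def
    by (rule killing_field_weighted_inverse[OF cp metric' killing_fields(2) c],
        rule diff_\<eta>(2)[OF c], rule inv'(2)[OF c(1)])
  have "along_mat (?K c x) (pencil \<eta> \<eta>' t c) x
      = along_mat (?K c x) (\<eta>' c) x - mat (of_real t) ** along_mat (?K c x) (\<eta> c) x"
    unfolding pencil_matrix[abs_def] using diff_\<eta>[OF c] by (simp add: vec_eq_iff along_diff along_mult)
  also have "\<dots> = ?C ** M' + N' ** ?C - mat \<delta> ** ?C"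
    unfolding e e' pencil_matrix
    by (simp add: matrix_sub_rdistrib matrix_sub_ldistrib mult_mat_left[of N'] matrix_mul_assoc[symmetric])
       (simp add: vec_eq_iff algebra_simps)
  finally have "along (?K c x) (\<lambda>y. Ht \<eta> \<eta>' t c y $ b $ a) x = dadj ?C (?C ** M' + N' ** ?C - mat \<delta> ** ?C) $ b $ a"
    by (simp add: Ht_def along_adj[OF diff_pencil[OF c]])
  also have "\<dots> = (mat (trace M') ** ?H - M' ** ?H + (mat (trace N') ** ?H - ?H ** N')
      - mat \<delta> ** (mat (of_nat CARD('n) - 1) ** ?H)) $ b $ a"
    by (simp only: dadj_diff dadj_add dadj_mat_mult dadj_self dadj_right dadj_left[where N = N'] Ht_def)
  finally have 1: "along (?K c x) (\<lambda>y. Ht \<eta> \<eta>' t c y $ b $ a) x + (M' ** ?H) $ b $ a + (?H ** N') $ b $ a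
      - (trace M' + trace N' - \<delta> * (of_nat CARD('n) - 1)) * ?H $ b $ a = 0"
    by (simp add: algebra_simps)
  have 2: "trace M' + trace N' - \<delta> * (of_nat CARD('n) - 1) = 2 * \<delta>"
    unfolding \<delta>_def using N by (simp add: divide_simps) (simp add: algebra_simps)
  have 3: "(\<Sum>\<gamma>\<in>UNIV. pd \<gamma> (\<lambda>y. ?K c y \<gamma>) x) = ?N * \<delta>"
    using N by (simp add: sum_idx \<delta>_def trace_def M'_def N'_def)
  show "(\<Sum>\<gamma>\<in>UNIV. ?K c x \<gamma> * pd \<gamma> (\<lambda>y. Ht \<eta> \<eta>' t c y $ b $ a) x)
     + (\<Sum>d\<in>UNIV. ?H $ d $ a * pd (Inl b) (\<lambda>y. ?K c y (Inl d)) x)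
     + (\<Sum>d\<in>UNIV. ?H $ b $ d * pd (Inr a) (\<lambda>y. ?K c y (Inr d)) x)
     - of_int 2 / (of_nat CARD('n) + 1) * (\<Sum>\<gamma>\<in>UNIV. pd \<gamma> (\<lambda>y. ?K c y \<gamma>) x) * ?H $ b $ a = 0"
    using 1 N unfolding 2 3 along_def by (simp add: matrix_matrix_mult_def M'_def N'_def mult.commute)
qed

lemma killing_tensor: "cproj_killing_tensor \<A> \<C> (Ht \<eta> \<eta>' t)"
  unfolding cproj_killing_tensor_def using Ht_herm_co killing_Ht by blast

lemma metric_killing_tensors:
  "metric_killing_tensor \<A> g (untwist (tau \<eta>) (Ht \<eta> \<eta>' t))"
  "metric_killing_tensor \<A> g' (untwist (tau \<eta>') (Ht \<eta> \<eta>' t))"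
  by (rule untwist_killing[OF cp herm(1) Ht_herm_co metric corr killing_Ht]
      untwist_killing[OF cp herm(2) Ht_herm_co metric' corr' killing_Ht]; assumption)+

end

theorem theorem5p11:
  fixes M :: "'m topology"
    and \<A> :: "('m, 'n::finite) chart set"
    and \<C> :: "('m, 'n) conn set"
    and \<eta> \<eta>' :: "('m, 'n) herm_field"
    and g g' :: "('m, 'n) tensor2_field"
  assumes "CARD('n) \<ge> 2"
    and "cprojective_manifold M \<A> \<C>"
    and "metrisability_solution \<A> \<C> \<eta>" and "metrisability_solution \<A> \<C> \<eta>'"
    and "compatible_metric \<A> \<C> g" and "compatible_metric \<A> \<C> g'"
    and "corresponds_to_metric \<A> \<eta> g" and "corresponds_to_metric \<A> \<eta>' g'"
    and "\<not> homothetic \<A> g g'"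
  shows "(\<forall>t. holomorphic_killing_field \<A> g (Kt g \<eta> \<eta>' t) \<and>
              holomorphic_killing_field \<A> g' (Kt g \<eta> \<eta>' t)) \<and>
         (\<forall>s t. poisson_commute \<A> g (Kt g \<eta> \<eta>' s) (Kt g \<eta> \<eta>' t) \<and>
                poisson_commute \<A> g' (Kt g \<eta> \<eta>' s) (Kt g \<eta> \<eta>' t)) \<and>
         (\<forall>t. cproj_killing_tensor \<A> \<C> (Ht \<eta> \<eta>' t)) \<and>
         (\<forall>s t. lie_invariant 2 \<A> (Kt g \<eta> \<eta>' s) (Ht \<eta> \<eta>' t)) \<and>
         (\<forall>t. metric_killing_tensor \<A> g (untwist (tau \<eta>) (Ht \<eta> \<eta>' t)) \<and>
              metric_killing_tensor \<A> g' (untwist (tau \<eta>') (Ht \<eta> \<eta>' t)))"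
proof -
  interpret metrisability_pencil M \<A> \<C> \<eta> \<eta>' g g'
    using assms by unfold_locales
  show ?thesis
    using killing_fields poisson_commuting killing_tensor lie_invariant_Ht metric_killing_tensors by blast
qed

end
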